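(* Let $d\ge1$, let $A,B$ be finite alphabets, let $p$ be a probability vector on $A$ and $q$ a probability vector on $B$, and let $X\sim\mu=p^{\mathbb{Z}^d}$ and $Y\sim\nu=q^{\mathbb{Z}^d}$ be the corresponding i.i.d. $\mathbb{Z}^d$-processes, of equal entropy $h=h(p)=h(q)$. Suppose that for some constant $c>0$ there is a homomorphism $\phi$ with $\phi(X)=Y$ whose coding radius satisfies $\mathbf{P}[R_\phi>n]=O(e^{-cn})$ as $n\to\infty$. Then $p=q$ up to a permutation of the symbols (equivalently, the random variables $\log p(X_0)^{-1}$ and $\log q(Y_0)^{-1}$ have the same distribution, i.e. the multisets of nonzero probabilities of $p$ and of $q$ coincide).
   Context: For a finite probability vector $p$ on $A$, the entropy is $h(p)=-\sum_{a\in A}p_a\log p_a$. A homomorphism (factor map) $\phi:X\to Y$ is a measurable map $\phi:A^{\mathbb{Z}^d}\to B^{\mathbb{Z}^d}$, defined $\mu$-a.e., that commutes with the $\mathbb{Z}^d$-shifts and satisfies $\phi_*\mu=\nu$. With $B(0,n)=[-n,n]^d\subset\mathbb{Z}^d$, the coding radius of $\phi$ is the random variable $R_\phi(x)=\min\{n\in\mathbb{N}\cup\{\infty\}: \text{for }\mu\text{-a.e. } a,\ (a_i)_{i\in B(0,n)}=(x_i)_{i\in B(0,n)}\Rightarrow \phi(a)_0=\phi(x)_0\}$. *)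

theory Defs
  imports "HOL-Probability.Probability" "HOL-Library.Landau_Symbols"
begin

text \<open>Lattice Z^d is modelled as the function space 'd => int for a finite type 'd
  (so d = CARD('d) >= 1). Finite alphabets are finite types; probability vectors are pmfs.\<close>

definition pmf_entropy :: "'a::finite pmf \<Rightarrow> real" where
  "pmf_entropy p = - (\<Sum>a\<in>UNIV. pmf p a * ln (pmf p a))"

definition bernoulli_shift :: "'a pmf \<Rightarrow> (('d::finite \<Rightarrow> int) \<Rightarrow> 'a) measure" where
  "bernoulli_shift p = PiM UNIV (\<lambda>_. measure_pmf p)"

definition zshift :: "('d \<Rightarrow> int) \<Rightarrow> (('d \<Rightarrow> int) \<Rightarrow> 'a) \<Rightarrow> (('d \<Rightarrow> int) \<Rightarrow> 'a)" where
  "zshift v x = (\<lambda>i. x (\<lambda>k. i k + v k))"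

definition lattice_box :: "nat \<Rightarrow> ('d \<Rightarrow> int) set" where
  "lattice_box n = {i. \<forall>k. \<bar>i k\<bar> \<le> int n}"

definition is_factor_map ::
  "(('d \<Rightarrow> int) \<Rightarrow> 'a) measure \<Rightarrow> (('d \<Rightarrow> int) \<Rightarrow> 'b) measure
   \<Rightarrow> ((('d \<Rightarrow> int) \<Rightarrow> 'a) \<Rightarrow> (('d \<Rightarrow> int) \<Rightarrow> 'b)) \<Rightarrow> bool" where
  "is_factor_map \<mu> \<nu> \<phi> \<longleftrightarrow> \<phi> \<in> measurable \<mu> \<nu> \<and> distr \<mu> \<nu> \<phi> = \<nu> \<and>
     (\<forall>v. AE x in \<mu>. \<phi> (zshift v x) = zshift v (\<phi> x))"

definition coding_radius ::
  "(('d \<Rightarrow> int) \<Rightarrow> 'a) measure \<Rightarrow> ((('d \<Rightarrow> int) \<Rightarrow> 'a) \<Rightarrow> (('d \<Rightarrow> int) \<Rightarrow> 'b))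
   \<Rightarrow> (('d \<Rightarrow> int) \<Rightarrow> 'a) \<Rightarrow> enat" where
  "coding_radius \<mu> \<phi> x = (LEAST n::enat. n = \<infinity> \<or>
     (\<exists>m. n = enat m \<and> (AE a in \<mu>. (\<forall>i\<in>lattice_box m. a i = x i) \<longrightarrow> \<phi> a (\<lambda>_. 0) = \<phi> x (\<lambda>_. 0))))"

end

theory Submission
  imports Defs
begin

text \<open>
  Let \<open>u\<close> and \<open>v\<close> be the information functions \<open>- ln p(x\<^sub>0)\<close> and \<open>- ln q(\<phi>(x)\<^sub>0)\<close>, and \<open>w = u - v\<close>.
  Wherever the coding radius is at most \<open>s\<close> throughout a box, the cylinder of \<open>x\<close> over the
  \<open>s\<close>-neighbourhood of the box is contained in the preimage of the cylinder of \<open>\<phi> x\<close> over the box, so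
  the sum of \<open>v\<close> over the box is at most the sum of \<open>u\<close> over its \<open>s\<close>-neighbourhood. Averaging this
  inequality over a measure that has independent local perturbations \<open>1 + G\<close> at a positive density of
  sites, and using that \<open>w\<close> has mean 0 by equality of entropies, yields that \<open>w\<close> summed over the lattice
  is uncorrelated with every local observable \<open>G\<close>; boxes of side exponential in \<open>s\<close> make the error
  exponentially small in \<open>s\<close>.

  Joint cumulants of translates of \<open>u\<close> and \<open>v\<close> decay exponentially in the diameter of the set of
  sites. The sum over all configurations of sites (with one site fixed at the origin) is the \<open>k\<close>-th
  cumulant of \<open>u\<close> if all entries are \<open>u\<close>, and that of \<open>v\<close> if all entries are \<open>v\<close>, as both fields are
  i.i.d.; replacing one entry \<open>u\<close> by \<open>v\<close> does not change the sum, since summing over the position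
  of an entry \<open>w\<close> gives 0. Hence \<open>u\<close> and \<open>v\<close> have the same cumulants, so the same moments and
  the same law.
\<close>

section \<open>Local functions on the Bernoulli shift\<close>

text \<open>A code can only lose information, so the basic inequality has one sign. Equality of
  entropies leaves no slack on average, and using \<open>1 + G\<close> together with its mirror
  image \<open>1 - G\<close> turns the inequality into a near-equality for the correlation of
  \<open>G\<close> with \<open>w\<close>. Cumulants replace moments because moments at distant sites
  tend to products without becoming small, whereas a joint cumulant of independent groups is 0. Only
  then is the sum over sites concentrated on nearby configurations, so that the position of an entry
  \<open>w\<close> may be allowed to run over a whole box at small cost. The number of
  configurations grows polynomially with the range of that sum, so both the correlation bound and
  the decay of cumulants have to beat every polynomial. The exponential tail of the coding radius
  provides both.\<close>

definition depends_on :: "(('i \<Rightarrow> 'a) \<Rightarrow> 'c) \<Rightarrow> 'i set \<Rightarrow> bool" where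
  "depends_on f I \<longleftrightarrow> (\<forall>x y. (\<forall>i\<in>I. x i = y i) \<longrightarrow> f x = f y)"

lemma depends_onI: "(\<And>x y. (\<And>i. i \<in> I \<Longrightarrow> x i = y i) \<Longrightarrow> f x = f y) \<Longrightarrow> depends_on f I"
  unfolding depends_on_def by blast

lemma depends_onD: "depends_on f I \<Longrightarrow> (\<And>i. i \<in> I \<Longrightarrow> x i = y i) \<Longrightarrow> f x = f y"
  unfolding depends_on_def by blast

lemma depends_on_mono: "depends_on f I \<Longrightarrow> I \<subseteq> J \<Longrightarrow> depends_on f J"
  unfolding depends_on_def by blast

lemma depends_on_const: "depends_on (\<lambda>_. c) I"
  by (simp add: depends_on_def)

lemma depends_on_compose: "depends_on f I \<Longrightarrow> depends_on (\<lambda>x. g (f x)) I"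
  unfolding depends_on_def by metis

lemma depends_on_compose2:
  "depends_on f I \<Longrightarrow> depends_on g I \<Longrightarrow> depends_on (\<lambda>x. h (f x) (g x)) I"
  unfolding depends_on_def by metis

lemma depends_on_prod:
  assumes "\<And>m. m \<in> S \<Longrightarrow> depends_on (f m) (I m)"
  shows "depends_on (\<lambda>x. \<Prod>m\<in>S. f m x :: 'c::comm_monoid_mult) (\<Union>m\<in>S. I m)"
  by (rule depends_onI, rule prod.cong[OF refl], rule depends_onD[OF assms]) auto

section \<open>Translations and boxes in the lattice\<close>

definition translate :: "('d \<Rightarrow> int) \<Rightarrow> ('d \<Rightarrow> int) set \<Rightarrow> ('d \<Rightarrow> int) set" where
  "translate v I = (\<lambda>i k. i k + v k) ` I"

lemma depends_on_zshift: "depends_on f I \<Longrightarrow> depends_on (\<lambda>x. f (zshift v x)) (translate v I)"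
  by (rule depends_onI, erule depends_onD) (auto simp: zshift_def translate_def)

lemma zshift_zshift: "zshift v (zshift w x) = zshift (\<lambda>k. v k + w k) x"
  by (simp add: zshift_def fun_eq_iff add.assoc)

lemma zshift_0: "zshift (\<lambda>_. 0) x = x"
  by (simp add: zshift_def)

lemma lattice_box_eq_PiE: "lattice_box n = (PiE UNIV (\<lambda>_. {- int n..int n}) :: ('d::finite \<Rightarrow> int) set)"
  by (auto simp: lattice_box_def PiE_iff abs_le_iff minus_le_iff)

lemma finite_lattice_box [simp]: "finite (lattice_box n :: ('d::finite \<Rightarrow> int) set)"
  by (simp add: lattice_box_eq_PiE finite_PiE)

lemma card_lattice_box: "card (lattice_box n :: ('d::finite \<Rightarrow> int) set) = (2 * n + 1) ^ CARD('d)"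
proof -
  have "nat (int n + int n + 1) = 2 * n + 1" by simp
  then show ?thesis by (simp add: lattice_box_eq_PiE card_PiE)
qed

lemma lattice_box_mono: "m \<le> n \<Longrightarrow> lattice_box m \<subseteq> lattice_box n"
  unfolding lattice_box_def by (auto intro: order_trans)

lemma zero_in_lattice_box: "(\<lambda>_. 0) \<in> lattice_box n"
  by (simp add: lattice_box_def)

lemma finite_translate [simp]: "finite I \<Longrightarrow> finite (translate v I)"
  by (simp add: translate_def)

lemma translate_lattice_box:
  "translate v (lattice_box n) = {i. \<forall>k. \<bar>i k - v k\<bar> \<le> int n}"
proof safe
  fix i k assume "i \<in> translate v (lattice_box n)"
  then show "\<bar>i k - v k\<bar> \<le> int n" by (auto simp: translate_def lattice_box_def)
next
  fix i assume "\<forall>k. \<bar>i k - v k\<bar> \<le> int n"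
  then show "i \<in> translate v (lattice_box n)"
    by (auto simp: translate_def lattice_box_def intro!: image_eqI[of _ _ "\<lambda>k. i k - v k"])
qed

section \<open>The Bernoulli measure: cylinders, shift invariance, integrals of local
  functions\<close>

lemma prob_space_bernoulli_shift: "prob_space (bernoulli_shift p)"
  unfolding bernoulli_shift_def by (intro prob_space_PiM prob_space_measure_pmf)

lemma space_bernoulli_shift [simp]: "space (bernoulli_shift p) = UNIV"
  by (simp add: bernoulli_shift_def space_PiM PiE_UNIV_domain)

lemma measurable_component_bernoulli [measurable]:
  "(\<lambda>x. x i) \<in> measurable (bernoulli_shift p) (count_space UNIV)"
proof -
  have "(\<lambda>x. x i) \<in> measurable (bernoulli_shift p) (measure_pmf p)"
    unfolding bernoulli_shift_def by simp
  then show ?thesis by (simp cong: measurable_cong_sets)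
qed

lemma sets_cylinder [measurable]: 
  assumes "finite I" shows "{x. \<forall>i\<in>I. x i = a i} \<in> sets (bernoulli_shift p)"
proof -
  have "{x \<in> space (bernoulli_shift p). \<forall>i\<in>I. x i = a i} \<in> sets (bernoulli_shift p)"
    using assms by measurable
  then show ?thesis by simp
qed

lemma measure_cylinder:
  fixes I :: "('d::finite \<Rightarrow> int) set" and p :: "'a pmf"
  assumes "finite I"
  shows "measure (bernoulli_shift p) {x. \<forall>i\<in>I. x i = a i} = (\<Prod>i\<in>I. pmf p (a i))"
proof -
  interpret product_prob_space "\<lambda>_::'d \<Rightarrow> int. measure_pmf p" UNIV
    by unfold_locales
  have "emeasure (bernoulli_shift p) {x. \<forall>i\<in>I. x i = a i} = (\<Prod>i\<in>I. ennreal (pmf p (a i)))"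
    using emeasure_PiM_Collect[of I "\<lambda>i. {a i}"] assms
    by (simp add: bernoulli_shift_def[symmetric] emeasure_pmf_single)
  then show ?thesis
    by (simp add: measure_def prod_ennreal prod_nonneg)
qed

lemma measurable_zshift [measurable]:
  "zshift v \<in> measurable (bernoulli_shift p) (bernoulli_shift p)"
proof -
  have "(\<lambda>x i. x (\<lambda>k. i k + v k)) \<in> measurable (bernoulli_shift p) (PiM UNIV (\<lambda>_. measure_pmf p))"
    by (rule measurable_PiM_single') (simp_all add: measurable_component_bernoulli PiE_UNIV_domain)
  then show ?thesis by (simp add: zshift_def[abs_def] bernoulli_shift_def)
qed

lemma distr_zshift:
  fixes p :: "'a pmf" and v :: "'d::finite \<Rightarrow> int"
  shows "distr (bernoulli_shift p) (bernoulli_shift p) (zshift v) = bernoulli_shift p"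
proof -
  have "inj_on (\<lambda>i k. i k + v k) (UNIV :: ('d \<Rightarrow> int) set)"
    by (auto simp: inj_on_def fun_eq_iff)
  then show ?thesis
    using distr_PiM_reindex[of UNIV "\<lambda>_. measure_pmf p" "\<lambda>i k. i k + v k" UNIV]
    by (simp add: zshift_def[abs_def] bernoulli_shift_def prob_space_measure_pmf restrict_UNIV)
qed

lemma integral_zshift:
  fixes f :: "_ \<Rightarrow> real"
  assumes "f \<in> borel_measurable (bernoulli_shift p)"
  shows "(\<integral>x. f (zshift v x) \<partial>bernoulli_shift p) = (\<integral>x. f x \<partial>bernoulli_shift p)"
  using integral_distr[OF measurable_zshift[of v p] assms] by (simp add: distr_zshift)

lemma AE_zshift:
  assumes "AE x in bernoulli_shift p. P x"
  shows "AE x in bernoulli_shift p. P (zshift v x)"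
  by (rule AE_distrD[OF measurable_zshift[of v p]]) (use assms in \<open>simp only: distr_zshift\<close>)

text \<open>Over a finite alphabet a function of finitely many coordinates is a finite combination
  of cylinder indicators, so measurability, integrability and integrals reduce to finite sums. The
  extensional \<open>a\<close> is \<open>undefined\<close> off \<open>I\<close>, which does not
  affect \<open>f a\<close> because \<open>f\<close> depends on \<open>I\<close> only.\<close>

lemma local_eq_sum:
  fixes f :: "('i \<Rightarrow> 'a::finite) \<Rightarrow> real"
  assumes "depends_on f I" "finite I"
  shows "f x = (\<Sum>a\<in>PiE I (\<lambda>_. UNIV). f a * indicator {x. \<forall>i\<in>I. x i = a i} x)"
proof -
  have "(\<Sum>a\<in>PiE I (\<lambda>_. UNIV). f a * indicator {x. \<forall>i\<in>I. x i = a i} x)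
      = (\<Sum>a\<in>PiE I (\<lambda>_. UNIV). if a = restrict x I then f a else 0)"
    by (intro sum.cong) (auto simp: indicator_def PiE_iff extensional_def fun_eq_iff)
  also have "\<dots> = f (restrict x I)"
    using assms by (subst sum.delta) (auto simp: finite_PiE)
  also have "\<dots> = f x"
    by (rule depends_onD[OF assms(1)]) simp
  finally show ?thesis by simp
qed

lemma integrable_local:
  fixes f :: "(('d::finite \<Rightarrow> int) \<Rightarrow> 'a::finite) \<Rightarrow> real"
  assumes "depends_on f I" "finite I"
  shows "integrable (bernoulli_shift p) f"
proof -
  interpret prob_space "bernoulli_shift p" by (rule prob_space_bernoulli_shift)
  have "integrable (bernoulli_shift p) (\<lambda>x. \<Sum>a\<in>PiE I (\<lambda>_. UNIV). f a * indicator {x. \<forall>i\<in>I. x i = a i} x)"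
    using assms(2) by (intro Bochner_Integration.integrable_sum integrable_mult_right)
      (auto intro!: integrable_real_indicator sets_cylinder simp: emeasure_eq_measure)
  then show ?thesis by (simp add: local_eq_sum[OF assms, symmetric])
qed

lemma measurable_local:
  fixes f :: "(('d::finite \<Rightarrow> int) \<Rightarrow> 'a::finite) \<Rightarrow> real"
  assumes "depends_on f I" "finite I"
  shows "f \<in> borel_measurable (bernoulli_shift p)"
  using integrable_local[OF assms] by (rule borel_measurable_integrable)

lemma integral_local:
  fixes f :: "(('d::finite \<Rightarrow> int) \<Rightarrow> 'a::finite) \<Rightarrow> real"
  assumes "depends_on f I" "finite I"
  shows "(\<integral>x. f x \<partial>bernoulli_shift p) = (\<Sum>a\<in>PiE I (\<lambda>_. UNIV). f a * (\<Prod>i\<in>I. pmf p (a i)))"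
proof -
  interpret prob_space "bernoulli_shift p" by (rule prob_space_bernoulli_shift)
  have "(\<integral>x. f x \<partial>bernoulli_shift p)
      = (\<integral>x. (\<Sum>a\<in>PiE I (\<lambda>_. UNIV). f a * indicator {x. \<forall>i\<in>I. x i = a i} x) \<partial>bernoulli_shift p)"
    by (simp add: local_eq_sum[OF assms, symmetric])
  also have "\<dots> = (\<Sum>a\<in>PiE I (\<lambda>_. UNIV). \<integral>x. f a * indicator {x. \<forall>i\<in>I. x i = a i} x \<partial>bernoulli_shift p)"
    using assms(2) by (intro Bochner_Integration.integral_sum integrable_mult_right)
      (auto intro!: integrable_real_indicator sets_cylinder simp: emeasure_eq_measure)
  also have "\<dots> = (\<Sum>a\<in>PiE I (\<lambda>_. UNIV). f a * (\<Prod>i\<in>I. pmf p (a i)))"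
    using assms(2) by (intro sum.cong refl) (simp add: measure_cylinder)
  finally show ?thesis .
qed

text \<open>Shared by three arguments: independence of coordinates, factorisation of replica
  assignments, and separating one site of a configuration from the others.\<close>

lemma sum_PiE_Un_disjoint:
  assumes "I \<inter> J = {}"
  shows "(\<Sum>a\<in>PiE (I \<union> J) F. g a) = (\<Sum>(a, b)\<in>PiE I F \<times> PiE J F. g (\<lambda>i. if i \<in> I then a i else b i))"
proof (rule sum.reindex_bij_witness[where j = "\<lambda>a. (restrict a I, restrict a J)"
      and i = "\<lambda>(a, b) i. if i \<in> I then a i else b i"], goal_cases)
  case (1 a)
  then show ?case by (auto simp: fun_eq_iff PiE_iff extensional_def)
next
  case (2 a)
  then show ?case using assms by (auto simp: PiE_iff)
next
  case (3 ab)
  then show ?case using assms by (auto simp: fun_eq_iff PiE_iff extensional_def)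
next
  case (4 ab)
  then show ?case by (auto simp: PiE_iff extensional_def)
next
  case (5 a)
  then have "(\<lambda>i. if i \<in> I then restrict a I i else restrict a J i) = a"
    by (auto simp: fun_eq_iff PiE_iff extensional_def)
  then show ?case by simp
qed

lemma integral_mult_local:
  fixes f g :: "(('d::finite \<Rightarrow> int) \<Rightarrow> 'a::finite) \<Rightarrow> real"
  assumes f: "depends_on f I" "finite I" and g: "depends_on g J" "finite J" and IJ: "I \<inter> J = {}"
  shows "(\<integral>x. f x * g x \<partial>bernoulli_shift p)
    = (\<integral>x. f x \<partial>bernoulli_shift p) * (\<integral>x. g x \<partial>bernoulli_shift p)"
proof -
  have fg: "depends_on (\<lambda>x. f x * g x) (I \<union> J)"
    by (rule depends_on_compose2) (auto intro: depends_on_mono f(1) g(1))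
  have "f (\<lambda>i. if i \<in> I then a i else b i) = f a" for a b
    by (rule depends_onD[OF f(1)]) simp
  moreover have "g (\<lambda>i. if i \<in> I then a i else b i) = g b" for a b
    using IJ by (intro depends_onD[OF g(1)]) auto
  moreover have "(\<Prod>i\<in>I \<union> J. pmf p (if i \<in> I then a i else b i))
      = (\<Prod>i\<in>I. pmf p (a i)) * (\<Prod>i\<in>J. pmf p (b i))" for a b
  proof -
    have "(\<Prod>i\<in>J. pmf p (if i \<in> I then a i else b i)) = (\<Prod>i\<in>J. pmf p (b i))"
      using IJ by (intro prod.cong) auto
    then show ?thesis using f(2) g(2) IJ by (simp add: prod.union_disjoint)
  qed
  ultimately show ?thesis
    using f g IJ
    by (simp add: integral_local[OF fg] integral_local[OF f] integral_local[OF g]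
        sum_PiE_Un_disjoint[OF IJ] sum_product sum.cartesian_product mult_ac)
qed

lemma integral_prod_local:
  fixes f :: "'s \<Rightarrow> (('d::finite \<Rightarrow> int) \<Rightarrow> 'a::finite) \<Rightarrow> real"
  assumes "finite S" "\<And>s. s \<in> S \<Longrightarrow> depends_on (f s) (I s)" "\<And>s. s \<in> S \<Longrightarrow> finite (I s)"
    and "\<And>s t. s \<in> S \<Longrightarrow> t \<in> S \<Longrightarrow> s \<noteq> t \<Longrightarrow> I s \<inter> I t = {}"
  shows "(\<integral>x. (\<Prod>s\<in>S. f s x) \<partial>bernoulli_shift p) = (\<Prod>s\<in>S. \<integral>x. f s x \<partial>bernoulli_shift p)"
  using assms
proof (induction S rule: finite_induct)
  case empty
  interpret prob_space "bernoulli_shift p" by (rule prob_space_bernoulli_shift)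
  show ?case using prob_space by simp
next
  case (insert t S)
  have dep: "depends_on (\<lambda>x. \<Prod>s\<in>S. f s x) (\<Union>s\<in>S. I s)"
    by (rule depends_on_prod) (use insert.prems in auto)
  have disj: "I t \<inter> (\<Union>s\<in>S. I s) = {}"
  proof -
    have "I t \<inter> I s = {}" if "s \<in> S" for s
      using insert.prems(3)[of t s] insert.hyps(2) that by auto
    then show ?thesis by blast
  qed
  have "(\<integral>x. f t x * (\<Prod>s\<in>S. f s x) \<partial>bernoulli_shift p)
      = (\<integral>x. f t x \<partial>bernoulli_shift p) * (\<integral>x. (\<Prod>s\<in>S. f s x) \<partial>bernoulli_shift p)"
    using insert.prems insert.hyps dep disj by (intro integral_mult_local[of _ "I t" _ "\<Union>s\<in>S. I s"]) auto
  then show ?case using insert by simp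
qed

section \<open>Joint cumulants\<close>

text \<open>
  I. J. Good's formula: with \<open>k\<close> independent copies of \<open>(Z\<^sub>m)\<close> and a primitive \<open>k\<close>-th root of unity \<open>\<omega>\<close>,
  the joint cumulant of \<open>Z\<^sub>0, \<dots>, Z\<^sub>k\<^sub>-\<^sub>1\<close> is, up to a factor \<open>k\<close>, the expectation of the product over \<open>m\<close> of
  \<open>\<Sum>j<k. \<omega>\<^sup>j Z\<^sub>m\<^sup>(\<^sup>j\<^sup>)\<close>. Here \<open>M S\<close> is the mixed moment of \<open>Z\<^sub>m\<close>, \<open>m \<in> S\<close>, and \<open>\<sigma> m\<close> is the copy chosen in the factor \<open>m\<close>.
\<close>
definition replica_sum :: "nat \<Rightarrow> nat set \<Rightarrow> (nat set \<Rightarrow> real) \<Rightarrow> complex" where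
  "replica_sum k A M = (\<Sum>\<sigma>\<in>PiE A (\<lambda>_. {..<k}). cis (2 * pi / real k) ^ (\<Sum>m\<in>A. \<sigma> m) *
     (\<Prod>j<k. complex_of_real (M {m\<in>A. \<sigma> m = j})))"

abbreviation cumulant :: "nat \<Rightarrow> (nat set \<Rightarrow> real) \<Rightarrow> complex" where
  "cumulant k M \<equiv> replica_sum k {..<k} M"

lemma root_of_unity_power_neq_1:
  assumes "0 < a" "a < k"
  shows "cis (2 * pi / real k) ^ a \<noteq> 1"
proof
  assume *: "cis (2 * pi / real k) ^ a = 1"
  have "2 * pi * real a / real k = real a * (2 * pi / real k)" by simp
  then have "cis (2 * pi * real a / real k) = 1"
    using * Complex.DeMoivre[of "2 * pi / real k" a] by (simp only:)
  then have eq: "cis (2 * pi * real a / real k) = cis (2 * pi * real 0 / real k)"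
    by simp
  have inj: "inj_on (\<lambda>j. cis (2 * pi * real j / real k)) {..<k}"
    using Complex.bij_betw_roots_unity[of k] assms by (simp add: bij_betw_def)
  have "a = 0" using inj_onD[OF inj eq] assms by simp
  then show False using assms by simp
qed

lemma root_of_unity_power_mod:
  assumes "0 < k"
  shows "cis (2 * pi / real k) ^ (a mod k) = cis (2 * pi / real k) ^ a"
proof -
  have "cis (2 * pi / real k) ^ k = 1"
    using Complex.DeMoivre[of "2 * pi / real k" k] assms by simp
  then have "cis (2 * pi / real k) ^ (k * (a div k) + a mod k) = cis (2 * pi / real k) ^ (a mod k)"
    by (simp only: power_add power_mult) simp
  then show ?thesis by simp
qed

lemma bij_betw_Suc_mod: "0 < k \<Longrightarrow> bij_betw (\<lambda>j. Suc j mod k) {..<k} {..<k}"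
proof -
  assume k: "0 < k"
  have "inj_on (\<lambda>j. Suc j mod k) {..<k}"
    by (auto simp: inj_on_def mod_Suc split: if_splits)
  then show ?thesis
    using k by (intro bij_betw_imageI endo_inj_surj) auto
qed

text \<open>Cyclically permuting the replicas multiplies the sum by a nontrivial root of unity.\<close>
lemma replica_sum_eq_0:
  assumes "finite A" "0 < card A" "card A < k"
  shows "replica_sum k A M = 0"
proof -
  define \<omega> where "\<omega> = cis (2 * pi / real k)"
  define h where "h j = Suc j mod k" for j
  have k: "0 < k" using assms by simp
  have bij: "bij_betw h {..<k} {..<k}"
    unfolding h_def using bij_betw_Suc_mod[OF k] .
  have hk: "h j < k" for j using k by (simp add: h_def)
  have "bij_betw (\<lambda>\<sigma>. \<lambda>m\<in>A. h (\<sigma> m)) (PiE A (\<lambda>_. {..<k})) (PiE A (\<lambda>_. {..<k}))"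
  proof (rule bij_betw_imageI[OF _ endo_inj_surj])
    show inj: "inj_on (\<lambda>\<sigma>. \<lambda>m\<in>A. h (\<sigma> m)) (PiE A (\<lambda>_. {..<k}))"
    proof (rule inj_onI)
      fix \<sigma> \<tau> assume st: "\<sigma> \<in> PiE A (\<lambda>_. {..<k})" "\<tau> \<in> PiE A (\<lambda>_. {..<k})"
        and eq: "(\<lambda>m\<in>A. h (\<sigma> m)) = (\<lambda>m\<in>A. h (\<tau> m))"
      show "\<sigma> = \<tau>"
      proof (rule PiE_ext[OF st])
        fix m assume m: "m \<in> A"
        then have "h (\<sigma> m) = h (\<tau> m)" using eq by (metis restrict_apply')
        then show "\<sigma> m = \<tau> m"
          using bij st m by (auto simp: bij_betw_def PiE_iff dest: inj_onD)
      qed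
    qed
    show "finite (PiE A (\<lambda>_. {..<k}))" using assms by (intro finite_PiE) auto
    show "(\<lambda>\<sigma>. \<lambda>m\<in>A. h (\<sigma> m)) ` PiE A (\<lambda>_. {..<k}) \<subseteq> PiE A (\<lambda>_. {..<k})"
      using hk by auto
    show "inj_on (\<lambda>\<sigma>. \<lambda>m\<in>A. h (\<sigma> m)) (PiE A (\<lambda>_. {..<k}))" by (rule inj)
  qed
  then have "replica_sum k A M = (\<Sum>\<sigma>\<in>PiE A (\<lambda>_. {..<k}). \<omega> ^ (\<Sum>m\<in>A. (\<lambda>m\<in>A. h (\<sigma> m)) m) *
     (\<Prod>j<k. complex_of_real (M {m\<in>A. (\<lambda>m\<in>A. h (\<sigma> m)) m = j})))"
    unfolding replica_sum_def \<omega>_def by (rule sum.reindex_bij_betw[symmetric])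
  also have "\<dots> = (\<Sum>\<sigma>\<in>PiE A (\<lambda>_. {..<k}). \<omega> ^ card A * (\<omega> ^ (\<Sum>m\<in>A. \<sigma> m) *
     (\<Prod>j<k. complex_of_real (M {m\<in>A. \<sigma> m = j}))))"
  proof (rule sum.cong[OF refl])
    fix \<sigma> assume s: "\<sigma> \<in> PiE A (\<lambda>_. {..<k})"
    have "\<omega> ^ (\<Sum>m\<in>A. (\<lambda>m\<in>A. h (\<sigma> m)) m) = \<omega> ^ (\<Sum>m\<in>A. Suc (\<sigma> m))"
      unfolding power_sum
    proof (rule prod.cong[OF refl])
      fix m assume "m \<in> A"
      then show "\<omega> ^ (restrict (\<lambda>m. h (\<sigma> m)) A m) = \<omega> ^ Suc (\<sigma> m)"
        using root_of_unity_power_mod[OF k, of "Suc (\<sigma> m)"] unfolding h_def \<omega>_def by simp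
    qed
    also have "(\<Sum>m\<in>A. Suc (\<sigma> m)) = (\<Sum>m\<in>A. \<sigma> m + 1)" by simp
    also have "\<omega> ^ \<dots> = \<omega> ^ card A * \<omega> ^ (\<Sum>m\<in>A. \<sigma> m)"
      by (simp only: sum.distrib power_add) simp
    finally have 1: "\<omega> ^ (\<Sum>m\<in>A. (\<lambda>m\<in>A. h (\<sigma> m)) m) = \<omega> ^ card A * \<omega> ^ (\<Sum>m\<in>A. \<sigma> m)" .
    have "(\<Prod>j<k. complex_of_real (M {m\<in>A. (\<lambda>m\<in>A. h (\<sigma> m)) m = j}))
        = (\<Prod>j<k. complex_of_real (M {m\<in>A. (\<lambda>m\<in>A. h (\<sigma> m)) m = h j}))"
      by (rule prod.reindex_bij_betw[OF bij, symmetric])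
    also have "\<dots> = (\<Prod>j<k. complex_of_real (M {m\<in>A. \<sigma> m = j}))"
    proof (rule prod.cong[OF refl])
      fix j assume "j \<in> {..<k}"
      then have "h (\<sigma> m) = h j \<longleftrightarrow> \<sigma> m = j" if "m \<in> A" for m
        using bij s that by (auto simp: bij_betw_def PiE_iff dest: inj_onD)
      then have "{m\<in>A. (\<lambda>m\<in>A. h (\<sigma> m)) m = h j} = {m\<in>A. \<sigma> m = j}" by auto
      then show "complex_of_real (M {m\<in>A. (\<lambda>m\<in>A. h (\<sigma> m)) m = h j})
        = complex_of_real (M {m\<in>A. \<sigma> m = j})" by simp
    qed
    finally show "\<omega> ^ (\<Sum>m\<in>A. (\<lambda>m\<in>A. h (\<sigma> m)) m) *
     (\<Prod>j<k. complex_of_real (M {m\<in>A. (\<lambda>m\<in>A. h (\<sigma> m)) m = j})) =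
     \<omega> ^ card A * (\<omega> ^ (\<Sum>m\<in>A. \<sigma> m) * (\<Prod>j<k. complex_of_real (M {m\<in>A. \<sigma> m = j})))"
      by (simp only: 1 mult.assoc)
  qed
  also have "\<dots> = \<omega> ^ card A * replica_sum k A M"
    unfolding replica_sum_def \<omega>_def by (simp only: sum_distrib_left)
  finally show ?thesis
    using root_of_unity_power_neq_1[OF assms(2,3)] by (auto simp: \<omega>_def)
qed

text \<open>A replica assignment on \<open>A \<union> B\<close> is a pair of assignments chosen
  separately. Both blocks keep the same number \<open>k\<close> of replicas, even if they have fewer
  than \<open>k\<close> indices; this is why \<open>replica_sum\<close> keeps \<open>k\<close> apart
  from the index set.\<close>

lemma replica_sum_Un:
  assumes "finite A" "finite B" "A \<inter> B = {}"
    and M: "\<And>S. S \<subseteq> A \<union> B \<Longrightarrow> M S = M (S \<inter> A) * M (S \<inter> B)"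
  shows "replica_sum k (A \<union> B) M = replica_sum k A M * replica_sum k B M"
proof -
  define \<omega> where "\<omega> = cis (2 * pi / real k)"
  have "replica_sum k (A \<union> B) M = (\<Sum>(\<sigma>, \<tau>)\<in>PiE A (\<lambda>_. {..<k}) \<times> PiE B (\<lambda>_. {..<k}).
      \<omega> ^ (\<Sum>m\<in>A \<union> B. if m \<in> A then \<sigma> m else \<tau> m) *
     (\<Prod>j<k. complex_of_real (M {m\<in>A \<union> B. (if m \<in> A then \<sigma> m else \<tau> m) = j})))"
    unfolding replica_sum_def \<omega>_def by (rule sum_PiE_Un_disjoint[OF assms(3)])
  also have "\<dots> = (\<Sum>(\<sigma>, \<tau>)\<in>PiE A (\<lambda>_. {..<k}) \<times> PiE B (\<lambda>_. {..<k}).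
      (\<omega> ^ (\<Sum>m\<in>A. \<sigma> m) * (\<Prod>j<k. complex_of_real (M {m\<in>A. \<sigma> m = j}))) *
      (\<omega> ^ (\<Sum>m\<in>B. \<tau> m) * (\<Prod>j<k. complex_of_real (M {m\<in>B. \<tau> m = j}))))"
  proof (rule sum.cong[OF refl], clarify)
    fix \<sigma> \<tau> :: "nat \<Rightarrow> nat"
    have "(\<Sum>m\<in>A. if m \<in> A then \<sigma> m else \<tau> m) = (\<Sum>m\<in>A. \<sigma> m)"
      by (rule sum.cong) auto
    moreover have "(\<Sum>m\<in>B. if m \<in> A then \<sigma> m else \<tau> m) = (\<Sum>m\<in>B. \<tau> m)"
      using assms(3) by (intro sum.cong) auto
    ultimately have "(\<Sum>m\<in>A \<union> B. if m \<in> A then \<sigma> m else \<tau> m) = (\<Sum>m\<in>A. \<sigma> m) + (\<Sum>m\<in>B. \<tau> m)"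
      using assms by (simp add: sum.union_disjoint)
    moreover have "M {m\<in>A \<union> B. (if m \<in> A then \<sigma> m else \<tau> m) = j} = M {m\<in>A. \<sigma> m = j} * M {m\<in>B. \<tau> m = j}" for j
    proof -
      let ?T = "{m\<in>A \<union> B. (if m \<in> A then \<sigma> m else \<tau> m) = j}"
      have "?T \<inter> A = {m\<in>A. \<sigma> m = j}" by auto
      moreover have "?T \<inter> B = {m\<in>B. \<tau> m = j}"
        using assms(3) by auto
      moreover have "M ?T = M (?T \<inter> A) * M (?T \<inter> B)" by (rule M) blast
      ultimately show ?thesis by (simp only:)
    qed
    ultimately show "\<omega> ^ (\<Sum>m\<in>A \<union> B. if m \<in> A then \<sigma> m else \<tau> m) *
     (\<Prod>j<k. complex_of_real (M {m\<in>A \<union> B. (if m \<in> A then \<sigma> m else \<tau> m) = j})) =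
      (\<omega> ^ (\<Sum>m\<in>A. \<sigma> m) * (\<Prod>j<k. complex_of_real (M {m\<in>A. \<sigma> m = j}))) *
      (\<omega> ^ (\<Sum>m\<in>B. \<tau> m) * (\<Prod>j<k. complex_of_real (M {m\<in>B. \<tau> m = j})))"
      by (simp only: power_add of_real_mult prod.distrib mult_ac)
  qed
  also have "\<dots> = replica_sum k A M * replica_sum k B M"
    unfolding replica_sum_def \<omega>_def by (simp only: sum_product sum.cartesian_product)
  finally show ?thesis .
qed

text \<open>Why cumulants measure dependence: the sum factors over the two independent groups, and a
  factor with fewer than \<open>k\<close> indices but \<open>k\<close> replicas is killed by the
  cyclic symmetry of the replicas.\<close>

lemma cumulant_eq_0_if_splits:
  assumes AB: "A \<union> B = {..<k}" "A \<inter> B = {}" "A \<noteq> {}" "B \<noteq> {}"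
    and M: "\<And>S. S \<subseteq> {..<k} \<Longrightarrow> M S = M (S \<inter> A) * M (S \<inter> B)"
  shows "cumulant k M = 0"
proof -
  have fin: "finite A" "finite B" using AB(1) by (metis finite_Un finite_lessThan)+
  have "card A + card B = k"
    using card_Un_disjoint[OF fin AB(2)] AB(1) by simp
  moreover have "0 < card A" "0 < card B" using fin AB by (auto simp: card_gt_0_iff)
  ultimately have "replica_sum k A M = 0" using fin by (intro replica_sum_eq_0) auto
  then show ?thesis
    using replica_sum_Un[OF fin AB(2), of M k] M AB(1) by simp
qed

lemma cumulant_cong:
  assumes "\<And>S. S \<subseteq> {..<k} \<Longrightarrow> M S = M' S"
  shows "cumulant k M = cumulant k M'"
proof -
  have "M {m\<in>{..<k}. \<sigma> m = j} = M' {m\<in>{..<k}. \<sigma> m = j}" for \<sigma> :: "nat \<Rightarrow> nat" and j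
    by (rule assms) blast
  then show ?thesis unfolding replica_sum_def by (simp only:)
qed

text \<open>There are k^k replica assignments, and each contributes a difference of two products of
  \<open>k\<close> moments of absolute value at most 1, which telescopes.\<close>

lemma cumulant_diff_le:
  assumes M: "\<And>S. S \<subseteq> {..<k} \<Longrightarrow> \<bar>M S\<bar> \<le> 1" "\<And>S. S \<subseteq> {..<k} \<Longrightarrow> \<bar>M' S\<bar> \<le> 1"
    and d: "\<And>S. S \<subseteq> {..<k} \<Longrightarrow> \<bar>M S - M' S\<bar> \<le> \<delta>"
  shows "norm (cumulant k M - cumulant k M') \<le> real (k ^ k) * (real k * \<delta>)"
proof -
  define \<omega> where "\<omega> = cis (2 * pi / real k)"
  have "norm (cumulant k M - cumulant k M') = norm (\<Sum>\<sigma>\<in>PiE {..<k} (\<lambda>_. {..<k}). \<omega> ^ (\<Sum>m<k. \<sigma> m) *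
     ((\<Prod>j<k. complex_of_real (M {m\<in>{..<k}. \<sigma> m = j})) - (\<Prod>j<k. complex_of_real (M' {m\<in>{..<k}. \<sigma> m = j}))))"
    unfolding replica_sum_def \<omega>_def by (simp only: sum_subtractf right_diff_distrib)
  also have "\<dots> \<le> (\<Sum>\<sigma>\<in>PiE {..<k} (\<lambda>_. {..<k}). real k * \<delta>)"
  proof (rule sum_norm_le)
    fix \<sigma>
    have "norm ((\<Prod>j<k. complex_of_real (M {m\<in>{..<k}. \<sigma> m = j})) - (\<Prod>j<k. complex_of_real (M' {m\<in>{..<k}. \<sigma> m = j})))
      \<le> (\<Sum>j<k. norm (complex_of_real (M {m\<in>{..<k}. \<sigma> m = j}) - complex_of_real (M' {m\<in>{..<k}. \<sigma> m = j})))"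
      by (rule norm_prod_diff) (auto simp: norm_of_real intro!: M)
    also have "\<dots> \<le> (\<Sum>j<k. \<delta>)"
    proof (rule sum_mono)
      fix j
      show "norm (complex_of_real (M {m\<in>{..<k}. \<sigma> m = j}) - complex_of_real (M' {m\<in>{..<k}. \<sigma> m = j})) \<le> \<delta>"
        unfolding of_real_diff[symmetric] norm_of_real by (rule d) auto
    qed
    finally show "norm (\<omega> ^ (\<Sum>m<k. \<sigma> m) *
     ((\<Prod>j<k. complex_of_real (M {m\<in>{..<k}. \<sigma> m = j})) - (\<Prod>j<k. complex_of_real (M' {m\<in>{..<k}. \<sigma> m = j})))) \<le> real k * \<delta>"
      by (simp add: norm_mult norm_power \<omega>_def)
  qed
  also have "\<dots> = real (k ^ k) * (real k * \<delta>)"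
    by (simp add: card_PiE)
  finally show ?thesis .
qed

text \<open>Index \<open>m\<close> lies in exactly one replica, \<open>\<sigma> m\<close>, so a
  single moment in each product involves the \<open>m\<close>-th variable. This exhibits the
  cumulant as linear in that variable.\<close>

lemma cumulant_expand_position:
  assumes "m < k"
  shows "cumulant k M = (\<Sum>\<sigma>\<in>PiE {..<k} (\<lambda>_. {..<k}). cis (2 * pi / real k) ^ (\<Sum>m<k. \<sigma> m) *
     (complex_of_real (M {n\<in>{..<k}. \<sigma> n = \<sigma> m}) *
       (\<Prod>j\<in>{..<k} - {\<sigma> m}. complex_of_real (M {n\<in>{..<k}. \<sigma> n = j}))))"
  unfolding replica_sum_def
proof (intro sum.cong[OF refl] arg_cong2[where f="(*)"] refl)
  fix \<sigma> assume "\<sigma> \<in> PiE {..<k} (\<lambda>_. {..<k})"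
  then have "\<sigma> m \<in> {..<k}" using assms by (auto simp: PiE_iff)
  then show "(\<Prod>j<k. complex_of_real (M {n\<in>{..<k}. \<sigma> n = j})) = complex_of_real (M {n\<in>{..<k}. \<sigma> n = \<sigma> m}) *
       (\<Prod>j\<in>{..<k} - {\<sigma> m}. complex_of_real (M {n\<in>{..<k}. \<sigma> n = j}))"
    by (intro prod.remove) auto
qed

lemma cumulant_sum_position:
  assumes m: "m < k" and F: "finite F"
    and rest: "\<And>i S. i \<in> F \<Longrightarrow> S \<subseteq> {..<k} \<Longrightarrow> m \<notin> S \<Longrightarrow> M i S = M0 S"
  shows "(\<Sum>i\<in>F. complex_of_real (c i) * cumulant k (M i)) = (\<Sum>\<sigma>\<in>PiE {..<k} (\<lambda>_. {..<k}). cis (2 * pi / real k) ^ (\<Sum>m<k. \<sigma> m) *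
     (complex_of_real (\<Sum>i\<in>F. c i * M i {n\<in>{..<k}. \<sigma> n = \<sigma> m}) *
       (\<Prod>j\<in>{..<k} - {\<sigma> m}. complex_of_real (M0 {n\<in>{..<k}. \<sigma> n = j}))))"
proof -
  have "(\<Sum>i\<in>F. complex_of_real (c i) * cumulant k (M i)) = (\<Sum>i\<in>F. \<Sum>\<sigma>\<in>PiE {..<k} (\<lambda>_. {..<k}). cis (2 * pi / real k) ^ (\<Sum>m<k. \<sigma> m) *
     (complex_of_real (c i * M i {n\<in>{..<k}. \<sigma> n = \<sigma> m}) *
       (\<Prod>j\<in>{..<k} - {\<sigma> m}. complex_of_real (M0 {n\<in>{..<k}. \<sigma> n = j}))))"
    unfolding cumulant_expand_position[OF m]
  proof (rule sum.cong[OF refl])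
    fix i assume i: "i \<in> F"
    have "(\<Prod>j\<in>{..<k} - {\<sigma> m}. complex_of_real (M i {n\<in>{..<k}. \<sigma> n = j}))
      = (\<Prod>j\<in>{..<k} - {\<sigma> m}. complex_of_real (M0 {n\<in>{..<k}. \<sigma> n = j}))" for \<sigma>
      by (intro prod.cong[OF refl] arg_cong[where f=of_real] rest[OF i]) auto
    then show "complex_of_real (c i) * (\<Sum>\<sigma>\<in>PiE {..<k} (\<lambda>_. {..<k}). cis (2 * pi / real k) ^ (\<Sum>m<k. \<sigma> m) *
     (complex_of_real (M i {n\<in>{..<k}. \<sigma> n = \<sigma> m}) *
       (\<Prod>j\<in>{..<k} - {\<sigma> m}. complex_of_real (M i {n\<in>{..<k}. \<sigma> n = j}))))
     = (\<Sum>\<sigma>\<in>PiE {..<k} (\<lambda>_. {..<k}). cis (2 * pi / real k) ^ (\<Sum>m<k. \<sigma> m) *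
     (complex_of_real (c i * M i {n\<in>{..<k}. \<sigma> n = \<sigma> m}) *
       (\<Prod>j\<in>{..<k} - {\<sigma> m}. complex_of_real (M0 {n\<in>{..<k}. \<sigma> n = j}))))"
      by (simp only: sum_distrib_left of_real_mult mult_ac)
  qed
  also have "\<dots> = (\<Sum>\<sigma>\<in>PiE {..<k} (\<lambda>_. {..<k}). \<Sum>i\<in>F. cis (2 * pi / real k) ^ (\<Sum>m<k. \<sigma> m) *
     (complex_of_real (c i * M i {n\<in>{..<k}. \<sigma> n = \<sigma> m}) *
       (\<Prod>j\<in>{..<k} - {\<sigma> m}. complex_of_real (M0 {n\<in>{..<k}. \<sigma> n = j}))))"
    by (rule sum.swap)
  finally show ?thesis by (simp only: sum_distrib_left sum_distrib_right of_real_sum)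
qed

text \<open>The sum over \<open>i\<close> is moved inside the moment before absolute values are
  taken, so cancellation among the \<open>M i\<close> survives; the individual cumulants need not be
  small. Later \<open>i\<close> is the position of the entry \<open>w\<close>.\<close>

lemma norm_sum_cumulant_le:
  assumes "m < k" "finite F"
    and rest: "\<And>i S. i \<in> F \<Longrightarrow> S \<subseteq> {..<k} \<Longrightarrow> m \<notin> S \<Longrightarrow> M i S = M0 S"
    and M0: "\<And>S. S \<subseteq> {..<k} \<Longrightarrow> m \<notin> S \<Longrightarrow> \<bar>M0 S\<bar> \<le> 1"
    and d: "\<And>S. S \<subseteq> {..<k} \<Longrightarrow> m \<in> S \<Longrightarrow> \<bar>\<Sum>i\<in>F. M i S\<bar> \<le> \<delta>"
  shows "norm (\<Sum>i\<in>F. cumulant k (M i)) \<le> real (k ^ k) * \<delta>"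
proof -
  have "norm (\<Sum>i\<in>F. cumulant k (M i)) = norm (\<Sum>i\<in>F. complex_of_real 1 * cumulant k (M i))" by simp
  also have "\<dots> \<le> (\<Sum>\<sigma>\<in>PiE {..<k} (\<lambda>_. {..<k}). \<delta>)"
  proof (subst cumulant_sum_position[OF assms(1-3)], assumption+, rule sum_norm_le)
    fix \<sigma> assume "\<sigma> \<in> PiE {..<k} (\<lambda>_. {..<k})"
    have "norm (\<Prod>j\<in>{..<k} - {\<sigma> m}. complex_of_real (M0 {n\<in>{..<k}. \<sigma> n = j})) \<le> 1"
      unfolding prod_norm[symmetric] by (rule prod_le_1) (auto intro!: M0)
    moreover have "\<bar>\<Sum>i\<in>F. 1 * M i {n\<in>{..<k}. \<sigma> n = \<sigma> m}\<bar> \<le> \<delta>"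
      using d[of "{n\<in>{..<k}. \<sigma> n = \<sigma> m}"] assms(1) by auto
    ultimately have "\<bar>\<Sum>i\<in>F. 1 * M i {n\<in>{..<k}. \<sigma> n = \<sigma> m}\<bar> *
        norm (\<Prod>j\<in>{..<k} - {\<sigma> m}. complex_of_real (M0 {n\<in>{..<k}. \<sigma> n = j})) \<le> \<delta> * 1"
      by (intro mult_mono) auto
    then show "norm (cis (2 * pi / real k) ^ (\<Sum>m<k. \<sigma> m) *
     (complex_of_real (\<Sum>i\<in>F. 1 * M i {n\<in>{..<k}. \<sigma> n = \<sigma> m}) *
       (\<Prod>j\<in>{..<k} - {\<sigma> m}. complex_of_real (M0 {n\<in>{..<k}. \<sigma> n = j})))) \<le> \<delta>"
      by (simp only: norm_mult norm_power norm_cis norm_of_real power_one mult_1_left mult_1_right)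
  qed
  also have "\<dots> = real (k ^ k) * \<delta>" by (simp add: card_PiE)
  finally show ?thesis .
qed

lemma cumulant_diff_position:
  assumes "m < k"
    and "\<And>S. S \<subseteq> {..<k} \<Longrightarrow> m \<notin> S \<Longrightarrow> M1 S = M3 S \<and> M2 S = M3 S"
    and "\<And>S. S \<subseteq> {..<k} \<Longrightarrow> m \<in> S \<Longrightarrow> M3 S = M1 S - M2 S"
  shows "cumulant k M1 - cumulant k M2 = cumulant k M3"
proof -
  \<comment> \<open>A two-point index set with weights 1 and -1 makes the difference an instance of
    \<open>cumulant_sum_position\<close>.\<close>
  have "(\<Sum>i\<in>{True, False}. complex_of_real (if i then 1 else -1) * cumulant k (if i then M1 else M2))
    = (\<Sum>\<sigma>\<in>PiE {..<k} (\<lambda>_. {..<k}). cis (2 * pi / real k) ^ (\<Sum>m<k. \<sigma> m) *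
     (complex_of_real (\<Sum>i\<in>{True, False}. (if i then 1 else -1) * (if i then M1 else M2) {n\<in>{..<k}. \<sigma> n = \<sigma> m}) *
       (\<Prod>j\<in>{..<k} - {\<sigma> m}. complex_of_real (M3 {n\<in>{..<k}. \<sigma> n = j}))))"
    by (rule cumulant_sum_position[OF assms(1)]) (use assms(2) in auto)
  also have "\<dots> = cumulant k M3"
    unfolding cumulant_expand_position[OF assms(1), of M3]
  proof (rule sum.cong[OF refl])
    fix \<sigma> :: "nat \<Rightarrow> nat"
    have "M3 {n\<in>{..<k}. \<sigma> n = \<sigma> m} = (\<Sum>i\<in>{True, False}. (if i then 1 else -1) * (if i then M1 else M2) {n\<in>{..<k}. \<sigma> n = \<sigma> m})"
      using assms(3)[of "{n\<in>{..<k}. \<sigma> n = \<sigma> m}"] assms(1) by auto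
    then show "cis (2 * pi / real k) ^ (\<Sum>m<k. \<sigma> m) *
     (complex_of_real (\<Sum>i\<in>{True, False}. (if i then 1 else -1) * (if i then M1 else M2) {n\<in>{..<k}. \<sigma> n = \<sigma> m}) *
       (\<Prod>j\<in>{..<k} - {\<sigma> m}. complex_of_real (M3 {n\<in>{..<k}. \<sigma> n = j})))
     = cis (2 * pi / real k) ^ (\<Sum>m<k. \<sigma> m) *
     (complex_of_real (M3 {n\<in>{..<k}. \<sigma> n = \<sigma> m}) *
       (\<Prod>j\<in>{..<k} - {\<sigma> m}. complex_of_real (M3 {n\<in>{..<k}. \<sigma> n = j})))" by simp
  qed
  finally show ?thesis by simp
qed

text \<open>Only the constant assignments put all \<open>k\<close> indices into one replica, so the
  cumulant is \<open>k\<close> times the \<open>k\<close>-th moment plus an expression in lower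
  moments.\<close>

lemma moment_eq_if_cumulant_eq:
  assumes k: "0 < k" and lower: "\<And>j. j < k \<Longrightarrow> a j = b j" and 0: "a 0 = 1"
    and eq: "cumulant k (\<lambda>S. a (card S)) = cumulant k (\<lambda>S. b (card S))"
  shows "a k = b k"
proof -
  define C where "C = (\<lambda>j. \<lambda>m\<in>{..<k}. j) ` {..<k}"
  have C: "C \<subseteq> PiE {..<k} (\<lambda>_. {..<k})" unfolding C_def by (intro image_subsetI restrict_PiE_iff[THEN iffD2]) auto
  have finP: "finite (PiE {..<k} (\<lambda>_. {..<k::nat}))" by (intro finite_PiE) auto
  define D where "D \<sigma> = (\<Prod>j<k. complex_of_real (a (card {m\<in>{..<k}. \<sigma> m = j})))
     - (\<Prod>j<k. complex_of_real (b (card {m\<in>{..<k}. \<sigma> m = j})))" for \<sigma>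
  have "0 = cumulant k (\<lambda>S. a (card S)) - cumulant k (\<lambda>S. b (card S))" using eq by simp
  also have "\<dots> = (\<Sum>\<sigma>\<in>PiE {..<k} (\<lambda>_. {..<k}). cis (2 * pi / real k) ^ (\<Sum>m<k. \<sigma> m) * D \<sigma>)"
    unfolding replica_sum_def D_def by (simp only: sum_subtractf right_diff_distrib)
  also have "\<dots> = (\<Sum>\<sigma>\<in>C. cis (2 * pi / real k) ^ (\<Sum>m<k. \<sigma> m) * D \<sigma>)"
  proof (rule sum.mono_neutral_right[OF finP C], rule ballI)
    fix \<sigma> assume s: "\<sigma> \<in> PiE {..<k} (\<lambda>_. {..<k}) - C"
    have "card {m\<in>{..<k}. \<sigma> m = j} < k" if j: "j < k" for j
    proof (rule ccontr)
      assume "\<not> card {m\<in>{..<k}. \<sigma> m = j} < k"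
      then have "{m\<in>{..<k}. \<sigma> m = j} = {..<k}"
        using card_mono[of "{..<k}" "{m\<in>{..<k}. \<sigma> m = j}"] by (intro card_subset_eq) auto
      then have "\<sigma> = (\<lambda>m\<in>{..<k}. j)"
        using s by (auto simp: fun_eq_iff PiE_iff extensional_def)
      then show False using s j by (auto simp: C_def)
    qed
    then show "cis (2 * pi / real k) ^ (\<Sum>m<k. \<sigma> m) * D \<sigma> = 0"
      unfolding D_def using lower by simp
  qed
  also have "\<dots> = (\<Sum>\<sigma>\<in>C. complex_of_real (a k - b k))"
  proof (rule sum.cong[OF refl])
    fix \<sigma> assume "\<sigma> \<in> C"
    then obtain i where i: "i < k" and s: "\<sigma> = (\<lambda>m\<in>{..<k}. i)" by (auto simp: C_def)
    have "(\<Sum>m<k. \<sigma> m) = k * i" by (simp add: s)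
    \<comment> \<open>A constant assignment has index sum \<open>k * i\<close>, so its root of unity
      is 1 and the \<open>k\<close> contributions add up without cancelling.\<close>
    then have 1: "cis (2 * pi / real k) ^ (\<Sum>m<k. \<sigma> m) = 1"
      using root_of_unity_power_mod[OF k, of "k * i"] by simp
    have "card {m\<in>{..<k}. \<sigma> m = j} = (if j = i then k else 0)" for j
    proof -
      have "{m\<in>{..<k}. \<sigma> m = j} = (if j = i then {..<k} else {})" by (auto simp: s)
      then show ?thesis by (simp only:) simp
    qed
    then have D: "D \<sigma> = (\<Prod>j<k. complex_of_real (a (if j = i then k else 0))) - (\<Prod>j<k. complex_of_real (b (if j = i then k else 0)))"
      unfolding D_def by (simp only:)
    have "b 0 = 1" using lower[OF k] 0 by simp
    then have "(\<Prod>j<k. complex_of_real (c (if j = i then k else 0))) = complex_of_real (c k)" if "c 0 = 1" for c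
      using i that by (simp add: prod.remove[of "{..<k}" i])
    then show "cis (2 * pi / real k) ^ (\<Sum>m<k. \<sigma> m) * D \<sigma> = complex_of_real (a k - b k)"
      using 0 \<open>b 0 = 1\<close> by (simp add: 1 D)
  qed
  also have "\<dots> = of_nat (card C) * complex_of_real (a k - b k)" by simp
  finally have "card C = 0 \<or> a k = b k" by simp
  moreover have "card C \<noteq> 0" using k by (auto simp: C_def lessThan_empty_iff)
  ultimately show ?thesis by simp
qed

section \<open>The response of the information to local perturbations\<close>

text \<open>The symbol is quantified rather than taken from \<open>\<phi> x\<close>, so that failure
  is a function of the window alone, with no exceptional null set. The corresponding event for
  \<open>coding_radius\<close> is local only almost everywhere.\<close>

definition code_fails :: "'a pmf \<Rightarrow> ((('d::finite \<Rightarrow> int) \<Rightarrow> 'a) \<Rightarrow> ('d \<Rightarrow> int) \<Rightarrow> 'b) \<Rightarrow> nat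
    \<Rightarrow> (('d \<Rightarrow> int) \<Rightarrow> 'a) \<Rightarrow> bool" where
  "code_fails p \<phi> s x \<longleftrightarrow>
     \<not> (\<exists>b. AE a in bernoulli_shift p. (\<forall>i\<in>lattice_box s. a i = x i) \<longrightarrow> \<phi> a (\<lambda>_. 0) = b)"

text \<open>An arbitrary symbol where \<open>code_fails\<close> holds.\<close>
definition local_code :: "'a pmf \<Rightarrow> ((('d::finite \<Rightarrow> int) \<Rightarrow> 'a) \<Rightarrow> ('d \<Rightarrow> int) \<Rightarrow> 'b) \<Rightarrow> nat
    \<Rightarrow> (('d \<Rightarrow> int) \<Rightarrow> 'a) \<Rightarrow> 'b" where
  "local_code p \<phi> s x =
     (SOME b. AE a in bernoulli_shift p. (\<forall>i\<in>lattice_box s. a i = x i) \<longrightarrow> \<phi> a (\<lambda>_. 0) = b)"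

lemma agree_cong:
  assumes "\<And>i. i \<in> I \<Longrightarrow> x i = y i"
  shows "(\<forall>i\<in>I. a i = x i) \<longleftrightarrow> (\<forall>i\<in>I. a i = y i)"
  using assms by auto

lemma depends_on_code_fails: "depends_on (code_fails p \<phi> s) (lattice_box s)"
  by (rule depends_onI) (simp add: code_fails_def cong: agree_cong)

lemma depends_on_local_code: "depends_on (local_code p \<phi> s) (lattice_box s)"
  by (rule depends_onI) (simp add: local_code_def cong: agree_cong)

lemma AE_local_code:
  fixes p :: "'a::finite pmf" and \<phi> :: "(('d::finite \<Rightarrow> int) \<Rightarrow> 'a) \<Rightarrow> ('d \<Rightarrow> int) \<Rightarrow> 'b"
  shows "AE x in bernoulli_shift p. \<not> code_fails p \<phi> s x \<longrightarrow> \<phi> x (\<lambda>_. 0) = local_code p \<phi> s x"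
proof -
  let ?P = "PiE (lattice_box s :: ('d \<Rightarrow> int) set) (\<lambda>_. UNIV :: 'a set)"
  \<comment> \<open>The null set implicit in \<open>local_code\<close> depends on the pattern seen;
    there are finitely many patterns \<open>y\<close> on the box, so one null set serves them
    all.\<close>
  have "AE x in bernoulli_shift p. \<forall>y\<in>?P. \<not> code_fails p \<phi> s y \<longrightarrow>
      (\<forall>i\<in>lattice_box s. x i = y i) \<longrightarrow> \<phi> x (\<lambda>_. 0) = local_code p \<phi> s y"
  proof (rule AE_finite_allI)
    show "finite ?P" by (intro finite_PiE) auto
    fix y :: "('d \<Rightarrow> int) \<Rightarrow> 'a"
    show "AE x in bernoulli_shift p. \<not> code_fails p \<phi> s y \<longrightarrow>
      (\<forall>i\<in>lattice_box s. x i = y i) \<longrightarrow> \<phi> x (\<lambda>_. 0) = local_code p \<phi> s y"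
    proof (cases "code_fails p \<phi> s y")
      case False
      then have "\<exists>b. AE a in bernoulli_shift p. (\<forall>i\<in>lattice_box s. a i = y i) \<longrightarrow> \<phi> a (\<lambda>_. 0) = b"
        by (simp add: code_fails_def)
      from someI_ex[OF this] show ?thesis by (simp add: local_code_def)
    qed simp
  qed
  then show ?thesis
  proof eventually_elim
    case (elim x)
    let ?y = "restrict x (lattice_box s)"
    have "?y \<in> ?P" by simp
    moreover have "code_fails p \<phi> s ?y = code_fails p \<phi> s x"
      by (rule depends_onD[OF depends_on_code_fails]) simp
    moreover have "local_code p \<phi> s ?y = local_code p \<phi> s x"
      by (rule depends_onD[OF depends_on_local_code]) simp
    ultimately show ?case using elim by fastforce
  qed
qed

section \<open>Tiling a box by cells of side 6s + 1\<close>

lemma tile_bij: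
  "bij_betw (\<lambda>(b, j). \<lambda>k. j k + int (6 * s + 1) * b k)
     (lattice_box M \<times> lattice_box (3 * s)) (lattice_box ((6 * s + 1) * M + 3 * s) :: ('d \<Rightarrow> int) set)"
proof -
  define l where "l = int (6 * s + 1)"
  have l: "l > 0" and l_eq: "l = 6 * int s + 1" by (simp_all add: l_def)
  \<comment> \<open>Adding 3s moves the range of \<open>j\<close> to 0..6s, so division with
    remainder by \<open>l\<close> recovers the cell and the offset.\<close>
  have uniq: "b = (i + 3 * int s) div l \<and> j = (i + 3 * int s) mod l - 3 * int s"
    if "\<bar>j\<bar> \<le> int (3 * s)" "i = j + l * b" for i j b
  proof -
    have r: "0 \<le> j + 3 * int s" "j + 3 * int s < l" using that by (auto simp: l_def)
    have i: "i + 3 * int s = (j + 3 * int s) + l * b" using that by simp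
    show ?thesis unfolding i using r l by (simp only: div_mult_self2 mod_mult_self2) simp
  qed
  have ran: "\<bar>j + l * b\<bar> \<le> int ((6 * s + 1) * M + 3 * s)" if "\<bar>j\<bar> \<le> int (3 * s)" "\<bar>b\<bar> \<le> int M" for j b
  proof -
    have "\<bar>l * b\<bar> \<le> l * int M" using that l by (simp add: abs_mult)
    moreover have "int ((6 * s + 1) * M + 3 * s) = l * int M + int (3 * s)" by (simp add: l_def algebra_simps)
    ultimately show ?thesis using that abs_triangle_ineq[of j "l * b"] by linarith
  qed
  have inv: "\<bar>(i + 3 * int s) div l\<bar> \<le> int M" "\<bar>(i + 3 * int s) mod l - 3 * int s\<bar> \<le> int (3 * s)"
    if "\<bar>i\<bar> \<le> int ((6 * s + 1) * M + 3 * s)" for i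
  proof -
    have i: "- (l * int M) \<le> i + 3 * int s" "i + 3 * int s < l * (int M + 1)"
      using that by (auto simp: l_def algebra_simps)
    have "l * ((i + 3 * int s) div l) \<le> i + 3 * int s"
      using mult_div_mod_eq[of l "i + 3 * int s"] pos_mod_sign[OF l, of "i + 3 * int s"] by linarith
    then have "l * ((i + 3 * int s) div l) < l * (int M + 1)" using i(2) by linarith
    then have "(i + 3 * int s) div l < int M + 1" using l by (simp only: mult_less_cancel_left_pos)
    moreover have "- int M \<le> (i + 3 * int s) div l"
      using zdiv_mono1[OF i(1) l] l nonzero_mult_div_cancel_left[of l "- int M"] by simp
    ultimately show "\<bar>(i + 3 * int s) div l\<bar> \<le> int M" by linarith
    show "\<bar>(i + 3 * int s) mod l - 3 * int s\<bar> \<le> int (3 * s)"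
      using pos_mod_bound[OF l, of "i + 3 * int s"] pos_mod_sign[OF l, of "i + 3 * int s"] l_eq
      by linarith
  qed
  define h :: "('d \<Rightarrow> int) \<Rightarrow> ('d \<Rightarrow> int) \<times> ('d \<Rightarrow> int)" where
    "h i = (\<lambda>k. (i k + 3 * int s) div l, \<lambda>k. (i k + 3 * int s) mod l - 3 * int s)" for i
  define f :: "('d \<Rightarrow> int) \<times> ('d \<Rightarrow> int) \<Rightarrow> 'd \<Rightarrow> int" where "f = (\<lambda>(b, j). \<lambda>k. j k + l * b k)"
  have f: "f (b, j) = (\<lambda>k. j k + l * b k)" for b j by (simp add: f_def)
  have "bij_betw f (lattice_box M \<times> lattice_box (3 * s)) (lattice_box ((6 * s + 1) * M + 3 * s))"
  proof (rule bij_betwI)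
    show "f \<in> lattice_box M \<times> lattice_box (3 * s) \<rightarrow> lattice_box ((6 * s + 1) * M + 3 * s)"
    proof clarify
      fix b j :: "'d \<Rightarrow> int" assume "b \<in> lattice_box M" "j \<in> lattice_box (3 * s)"
      then show "f (b, j) \<in> lattice_box ((6 * s + 1) * M + 3 * s)"
        unfolding f lattice_box_def mem_Collect_eq by (intro allI ran) auto
    qed
    show "h \<in> lattice_box ((6 * s + 1) * M + 3 * s) \<rightarrow> lattice_box M \<times> lattice_box (3 * s)"
    proof
      fix i :: "'d \<Rightarrow> int" assume "i \<in> lattice_box ((6 * s + 1) * M + 3 * s)"
      then show "h i \<in> lattice_box M \<times> lattice_box (3 * s)"
        unfolding h_def lattice_box_def mem_Collect_eq mem_Times_iff fst_conv snd_conv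
        by (intro conjI allI inv) auto
    qed
    fix a :: "('d \<Rightarrow> int) \<times> ('d \<Rightarrow> int)" assume a: "a \<in> lattice_box M \<times> lattice_box (3 * s)"
    obtain b j where bj: "a = (b, j)" by (cases a)
    have "b k = (j k + l * b k + 3 * int s) div l \<and> j k = (j k + l * b k + 3 * int s) mod l - 3 * int s" for k
      using a by (intro uniq) (auto simp: lattice_box_def bj)
    then have "b = (\<lambda>k. (j k + l * b k + 3 * int s) div l)"
        "j = (\<lambda>k. (j k + l * b k + 3 * int s) mod l - 3 * int s)"
      by (intro ext, blast)+
    then show "h (f a) = a"
      unfolding bj f h_def by (simp only:)
  next
    fix i :: "'d \<Rightarrow> int"
    have "(i k + 3 * int s) mod l - 3 * int s + l * ((i k + 3 * int s) div l) = i k" for k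
      using mult_div_mod_eq[of l "i k + 3 * int s"] by linarith
    then show "f (h i) = i" unfolding h_def f by (simp only:)
  qed
  then show ?thesis unfolding f_def l_def .
qed

text \<open>Quantities summed over a cell of radius 3s look a further distance \<open>s\<close>,
  hence the radius 4s; a perturbation occupies radius 2s. The spacing 6s + 1 exceeds 4s + 2s, so a
  cell sees only its own perturbation.\<close>

lemma tiles_disjoint:
  fixes b b' :: "'d::finite \<Rightarrow> int"
  assumes "b \<noteq> b'"
  shows "translate (\<lambda>k. int (6 * s + 1) * b k) (lattice_box (4 * s))
    \<inter> translate (\<lambda>k. int (6 * s + 1) * b' k) (lattice_box (2 * s)) = {}"
proof (rule ccontr)
  assume "\<not> ?thesis"
  then obtain i where i: "\<And>k. \<bar>i k - int (6 * s + 1) * b k\<bar> \<le> int (4 * s)"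
      "\<And>k. \<bar>i k - int (6 * s + 1) * b' k\<bar> \<le> int (2 * s)"
    by (auto simp: translate_lattice_box)
  obtain k where "b k \<noteq> b' k" using assms by auto
  then have "1 \<le> \<bar>b k - b' k\<bar>" by linarith
  then have "int (6 * s + 1) * 1 \<le> int (6 * s + 1) * \<bar>b k - b' k\<bar>"
    by (intro mult_left_mono) auto
  also have "\<dots> = \<bar>int (6 * s + 1) * b k - int (6 * s + 1) * b' k\<bar>"
    by (simp add: abs_mult right_diff_distrib[symmetric])
  also have "\<dots> \<le> int (6 * s)"
    using i(1)[of k] i(2)[of k] by linarith
  finally show False by simp
qed

lemma AE_pmf_pos:
  "AE x in bernoulli_shift p. 0 < pmf p (x i)"
  unfolding bernoulli_shift_def
  by (rule AE_PiM_component) (auto simp: prob_space_measure_pmf AE_measure_pmf_iff pmf_positive)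

lemma translate_subset_box:
  fixes i :: "'d::finite \<Rightarrow> int"
  shows "i \<in> lattice_box n \<Longrightarrow> translate i (lattice_box s) \<subseteq> lattice_box (n + s)"
  unfolding translate_def lattice_box_def
proof clarify
  fix j :: "'d \<Rightarrow> int" and k :: 'd assume "\<forall>k. \<bar>i k\<bar> \<le> int n" "\<forall>k. \<bar>j k\<bar> \<le> int s"
  then have "\<bar>i k\<bar> \<le> int n" "\<bar>j k\<bar> \<le> int s" by auto
  then show "\<bar>j k + i k\<bar> \<le> int (n + s)" by linarith
qed

lemma depends_on_coordinate: "depends_on (\<lambda>x. f (x i)) {i}"
  by (simp add: depends_on_def)

section \<open>Standing assumptions and the information inequality under perturbation\<close>

locale exp_coding =
  fixes p :: "'a::finite pmf" and q :: "'b::finite pmf"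
    and \<phi> :: "(('d::finite \<Rightarrow> int) \<Rightarrow> 'a) \<Rightarrow> ('d \<Rightarrow> int) \<Rightarrow> 'b" and K c :: real
  assumes entropy_eq: "pmf_entropy p = pmf_entropy q"
    and factor: "is_factor_map (bernoulli_shift p) (bernoulli_shift q) \<phi>"
    and c_pos: "c > 0"
    and fails_le: "\<And>s. measure (bernoulli_shift p) {x. code_fails p \<phi> s x} \<le> K * exp (- c * real s)"
begin

abbreviation "\<mu> \<equiv> (bernoulli_shift p :: (('d \<Rightarrow> int) \<Rightarrow> 'a) measure)"

sublocale prob_space \<mu> by (rule prob_space_bernoulli_shift)

lemma measurable_phi: "\<phi> \<in> measurable \<mu> (bernoulli_shift q)"
  and distr_phi: "distr \<mu> (bernoulli_shift q) \<phi> = bernoulli_shift q"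
  and phi_zshift: "AE x in \<mu>. \<phi> (zshift v x) = zshift v (\<phi> x)"
  using factor by (auto simp: is_factor_map_def)

text \<open>A crude common bound for both alphabets; null symbols may be included because
  \<open>ln 0 = 0\<close>.\<close>

definition info_bound :: real where
  "info_bound = (\<Sum>a\<in>UNIV. \<bar>ln (pmf p a)\<bar>) + (\<Sum>b\<in>UNIV. \<bar>ln (pmf q b)\<bar>)"

lemma abs_ln_p_le: "\<bar>ln (pmf p a)\<bar> \<le> info_bound"
  and abs_ln_q_le: "\<bar>ln (pmf q b)\<bar> \<le> info_bound"
  and info_bound_nonneg: "0 \<le> info_bound"
proof -
  have "\<bar>ln (pmf p a)\<bar> \<le> (\<Sum>a\<in>UNIV. \<bar>ln (pmf p a)\<bar>)" for a
    by (rule member_le_sum) auto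
  moreover have "\<bar>ln (pmf q b)\<bar> \<le> (\<Sum>b\<in>UNIV. \<bar>ln (pmf q b)\<bar>)" for b
    by (rule member_le_sum) auto
  moreover have "0 \<le> (\<Sum>a\<in>UNIV. \<bar>ln (pmf p a)\<bar>)" "0 \<le> (\<Sum>b\<in>UNIV. \<bar>ln (pmf q b)\<bar>)"
    by (simp_all add: sum_nonneg)
  ultimately show "\<bar>ln (pmf p a)\<bar> \<le> info_bound" "\<bar>ln (pmf q b)\<bar> \<le> info_bound" "0 \<le> info_bound"
    unfolding info_bound_def by (meson add_increasing2 add_increasing add_nonneg_nonneg)+
qed

text \<open>The cylinder of \<open>x\<close> over the larger box is contained in the preimage of the coded cylinder.\<close>
lemma information_decreases:
  assumes good: "\<And>i. i \<in> lattice_box n \<Longrightarrow> \<not> code_fails p \<phi> s (zshift i x)"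
    and pos: "\<And>i. i \<in> lattice_box (n + s) \<Longrightarrow> 0 < pmf p (x i)"
  shows "(\<Sum>i\<in>lattice_box n. - ln (pmf q (local_code p \<phi> s (zshift i x))))
    \<le> (\<Sum>i\<in>lattice_box (n + s). - ln (pmf p (x i)))"
proof -
  define C where "C = {a. \<forall>i\<in>lattice_box (n + s). a i = x i}"
  define D where "D = {y. \<forall>i\<in>lattice_box n. y i = local_code p \<phi> s (zshift i x)}"
  have D: "D \<in> sets (bernoulli_shift q)" unfolding D_def by (rule sets_cylinder) simp
  have "AE a in \<mu>. \<forall>i\<in>lattice_box n. a \<in> C \<longrightarrow> \<phi> a i = local_code p \<phi> s (zshift i x)"
  proof (rule AE_finite_allI)
    show "finite (lattice_box n :: ('d \<Rightarrow> int) set)" by simp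
    fix i :: "'d \<Rightarrow> int" assume i: "i \<in> lattice_box n"
    have "AE a in \<mu>. \<not> code_fails p \<phi> s (zshift i a) \<longrightarrow> \<phi> (zshift i a) (\<lambda>_. 0) = local_code p \<phi> s (zshift i a)"
      by (rule AE_zshift[OF AE_local_code])
    then show "AE a in \<mu>. a \<in> C \<longrightarrow> \<phi> a i = local_code p \<phi> s (zshift i x)"
      using phi_zshift[of i]
    proof eventually_elim
      case (elim a)
      show ?case
      proof
        assume "a \<in> C"
        then have a: "a j = x j" if "j \<in> translate i (lattice_box s)" for j
          using translate_subset_box[OF i, of s] that by (auto simp: C_def)
        have "code_fails p \<phi> s (zshift i a) = code_fails p \<phi> s (zshift i x)"
          by (rule depends_onD[OF depends_on_zshift[OF depends_on_code_fails]]) (rule a)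
        moreover have "local_code p \<phi> s (zshift i a) = local_code p \<phi> s (zshift i x)"
          by (rule depends_onD[OF depends_on_zshift[OF depends_on_local_code]]) (rule a)
        moreover have "\<phi> (zshift i a) (\<lambda>_. 0) = \<phi> a i"
          using elim(2) by (simp add: zshift_def)
        ultimately show "\<phi> a i = local_code p \<phi> s (zshift i x)"
          using elim(1) good[OF i] by simp
      qed
    qed
  qed
  then have "AE a in \<mu>. a \<in> C \<longrightarrow> a \<in> \<phi> -` D \<inter> space \<mu>"
    by eventually_elim (auto simp: D_def)
  then have "measure \<mu> C \<le> measure \<mu> (\<phi> -` D \<inter> space \<mu>)"
    by (rule finite_measure_mono_AE) (rule measurable_sets[OF measurable_phi D])
  also have "\<dots> = measure (bernoulli_shift q) D"
    using measure_distr[OF measurable_phi D] by (simp add: distr_phi)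
  finally have le: "(\<Prod>i\<in>lattice_box (n + s). pmf p (x i)) \<le> (\<Prod>i\<in>lattice_box n. pmf q (local_code p \<phi> s (zshift i x)))"
    by (simp add: C_def D_def measure_cylinder)
  have P: "0 < (\<Prod>i\<in>lattice_box (n + s). pmf p (x i))" using pos by (rule prod_pos)
  then have "0 < (\<Prod>i\<in>lattice_box n. pmf q (local_code p \<phi> s (zshift i x)))" using le by linarith
  \<comment> \<open>Positive mass of the input cylinder forces every coded symbol to have positive
    mass, so \<open>ln\<close> turns the product into a sum despite the convention
    \<open>ln 0 = 0\<close>.\<close>
  then have Q: "0 < pmf q (local_code p \<phi> s (zshift i x))" if "i \<in> lattice_box n" for i
    using that by (metis finite_lattice_box prod_zero_iff less_irrefl pmf_nonneg order_less_le)
  have "ln (\<Prod>i\<in>lattice_box (n + s). pmf p (x i)) \<le> ln (\<Prod>i\<in>lattice_box n. pmf q (local_code p \<phi> s (zshift i x)))"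
    using le P by simp
  then have "(\<Sum>i\<in>lattice_box (n + s). ln (pmf p (x i))) \<le> (\<Sum>i\<in>lattice_box n. ln (pmf q (local_code p \<phi> s (zshift i x))))"
    using ln_prod[of "lattice_box (n + s)" "\<lambda>i. pmf p (x i)"] pos
      ln_prod[of "lattice_box n" "\<lambda>i. pmf q (local_code p \<phi> s (zshift i x))"] Q
    by (metis finite_lattice_box less_irrefl)
  then show ?thesis by (simp add: sum_negf)
qed

text \<open>A local version of v - u, opposite in sign to \<open>info_diff\<close>: the inequality
  bounds output information minus input information from above.\<close>

definition loc_diff :: "nat \<Rightarrow> (('d \<Rightarrow> int) \<Rightarrow> 'a) \<Rightarrow> real" where
  "loc_diff s x = ln (pmf p (x (\<lambda>_. 0))) - ln (pmf q (local_code p \<phi> s x))"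

lemma depends_on_loc_diff: "depends_on (loc_diff s) (lattice_box s)"
  unfolding loc_diff_def
  by (rule depends_on_compose2[OF depends_on_mono[OF depends_on_coordinate]
        depends_on_compose[OF depends_on_local_code]]) (simp add: zero_in_lattice_box)

text \<open>The information inequality is integrated against a product density with one factor
  \<open>1 + G\<close> per cell. By independence and stationarity every cell contributes the same
  integral, so the number of cells appears on the left. The right side collects the input
  information of the outer shell and the cost of a failing code: at a failure the gap is at most
  \<open>info_bound\<close> times the volume, and adding failure probabilities over all sites gives
  the second factor of volume.\<close>

lemma loc_diff_le:
  assumes s: "n = (6 * s + 1) * M + 3 * s"
    and G: "depends_on G (lattice_box (2 * s))" "\<And>x. \<bar>G x\<bar> \<le> 1" "(\<integral>x. G x \<partial>\<mu>) = 0"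
  shows "real (card (lattice_box M :: ('d \<Rightarrow> int) set)) *
      (\<Sum>j\<in>lattice_box (3 * s). \<integral>x. (1 + G x) * loc_diff s (zshift j x) \<partial>\<mu>)
    \<le> info_bound * real (card (lattice_box (n + s) - lattice_box n :: ('d \<Rightarrow> int) set))
      + 2 * info_bound * real (card (lattice_box n :: ('d \<Rightarrow> int) set)) ^ 2 * measure \<mu> {x. code_fails p \<phi> s x}"
proof -
  define l where "l b = (\<lambda>k. int (6 * s + 1) * b k)" for b :: "'d \<Rightarrow> int"
  define t where "t b x = 1 + G (zshift (l b) x)" for b x
  \<comment> \<open>The density of the perturbed measure; its factors live on disjoint windows and
    have mean 1, so it has mean 1.\<close>
  define g where "g x = (\<Prod>b\<in>lattice_box M. t b x)" for x
  define F where "F i x = (if code_fails p \<phi> s (zshift i x) then 1 else 0 :: real)" for i x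
  have dt: "depends_on (t b) (translate (l b) (lattice_box (2 * s)))" for b
    unfolding t_def by (rule depends_on_compose[OF depends_on_zshift[OF G(1)]])
  have t01: "0 \<le> t b x" "t b x \<le> 2" for b x
    using G(2)[of "zshift (l b) x"] by (auto simp: t_def)
  have g0: "0 \<le> g x" for x unfolding g_def by (intro prod_nonneg t01)
  have measG: "G \<in> borel_measurable \<mu>" by (rule measurable_local[OF G(1)]) simp
  have Et: "(\<integral>x. t b x \<partial>\<mu>) = 1" for b
  proof -
    have "(\<integral>x. t b x \<partial>\<mu>) = (\<integral>x. 1 + G x \<partial>\<mu>)"
      unfolding t_def using measG by (intro integral_zshift) simp
    also have "\<dots> = 1"
      using integrable_local[OF G(1)] G(3) prob_space by simp
    finally show ?thesis .
  qed
  have disj: "translate (l b) (lattice_box (4 * s)) \<inter> translate (l b') (lattice_box (2 * s)) = {}"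
    if "b \<noteq> b'" for b b' unfolding l_def using tiles_disjoint[OF that] .
  have disj2: "translate (l b) (lattice_box (2 * s)) \<inter> translate (l b') (lattice_box (2 * s)) = {}"
    if "b \<noteq> b'" for b b'
    using disj[OF that] lattice_box_mono[of "2 * s" "4 * s"] unfolding translate_def by fastforce
  \<comment> \<open>For an observable near cell \<open>b\<close> all other factors are independent
    of what is seen and integrate to 1.\<close>
  have Eg: "(\<integral>x. g x * f x \<partial>\<mu>) = (\<integral>x. t b x * f x \<partial>\<mu>)"
    if b: "b \<in> lattice_box M" and f: "depends_on f (translate (l b) (lattice_box (4 * s)))" for b f
  proof -
    define r where "r x = (\<Prod>b'\<in>lattice_box M - {b}. t b' x)" for x
    have "(\<integral>x. r x \<partial>\<mu>) = (\<Prod>b'\<in>lattice_box M - {b}. \<integral>x. t b' x \<partial>\<mu>)"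
      unfolding r_def by (rule integral_prod_local[OF _ dt]) (auto simp: disj2)
    then have r1: "(\<integral>x. r x \<partial>\<mu>) = 1" by (simp add: Et)
    have dr: "depends_on r (\<Union>b'\<in>lattice_box M - {b}. translate (l b') (lattice_box (2 * s)))"
      unfolding r_def by (rule depends_on_prod[OF dt])
    have dtf: "depends_on (\<lambda>x. t b x * f x) (translate (l b) (lattice_box (4 * s)))"
    proof (rule depends_on_compose2[OF depends_on_mono[OF dt] f])
      show "translate (l b) (lattice_box (2 * s)) \<subseteq> translate (l b) (lattice_box (4 * s))"
        unfolding translate_def by (intro image_mono lattice_box_mono) simp
    qed
    have disjb: "translate (l b) (lattice_box (4 * s)) \<inter>
        (\<Union>b'\<in>lattice_box M - {b}. translate (l b') (lattice_box (2 * s))) = {}"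
    proof (rule equals0I)
      fix i assume "i \<in> translate (l b) (lattice_box (4 * s)) \<inter>
        (\<Union>b'\<in>lattice_box M - {b}. translate (l b') (lattice_box (2 * s)))"
      then have 1: "i \<in> translate (l b) (lattice_box (4 * s))"
        and 2: "i \<in> (\<Union>b'\<in>lattice_box M - {b}. translate (l b') (lattice_box (2 * s)))" by simp_all
      from 2 obtain b' where b': "b' \<in> lattice_box M - {b}" "i \<in> translate (l b') (lattice_box (2 * s))"
        by (rule UN_E)
      then have "b \<noteq> b'" by auto
      from disj[OF this] show False using 1 b'(2) by (metis IntI empty_iff)
    qed
    have "(\<integral>x. g x * f x \<partial>\<mu>) = (\<integral>x. (t b x * f x) * r x \<partial>\<mu>)"
      unfolding g_def r_def using b by (simp add: prod.remove[of "lattice_box M" b] mult_ac)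
    also have "\<dots> = (\<integral>x. t b x * f x \<partial>\<mu>) * (\<integral>x. r x \<partial>\<mu>)"
      by (rule integral_mult_local[OF dtf _ dr _ disjb]) simp_all
    finally show ?thesis by (simp add: r1)
  qed
  have cell: "translate (\<lambda>k. j k + l b k) (lattice_box s) \<subseteq> translate (l b) (lattice_box (4 * s))"
    if "j \<in> lattice_box (3 * s)" for j b
  proof
    fix i assume "i \<in> translate (\<lambda>k. j k + l b k) (lattice_box s)"
    then have i: "\<bar>i k - (j k + l b k)\<bar> \<le> int s" for k by (auto simp: translate_lattice_box)
    have j: "\<bar>j k\<bar> \<le> int (3 * s)" for k using that by (auto simp: lattice_box_def)
    have "\<bar>i k - l b k\<bar> \<le> int (4 * s)" for k
      using i[of k] j[of k] by linarith
    then show "i \<in> translate (l b) (lattice_box (4 * s))" by (simp add: translate_lattice_box)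
  qed
  have bij: "bij_betw (\<lambda>(b, j). \<lambda>k. j k + l b k) (lattice_box M \<times> lattice_box (3 * s)) (lattice_box n)"
    unfolding s l_def by (rule tile_bij)
  have dF: "depends_on (F i) (translate i (lattice_box s))" for i
    unfolding F_def by (rule depends_on_compose[OF depends_on_zshift[OF depends_on_code_fails]])
  have dD: "depends_on (\<lambda>x. loc_diff s (zshift i x)) (translate i (lattice_box s))" for i
    by (rule depends_on_zshift[OF depends_on_loc_diff])
  have dg: "depends_on g (\<Union>b\<in>lattice_box M. translate (l b) (lattice_box (2 * s)))"
    unfolding g_def by (rule depends_on_prod[OF dt])
  have int_gf: "integrable \<mu> (\<lambda>x. g x * f x)" if "depends_on f I" "finite I" for f I
  proof -
    let ?J = "(\<Union>b\<in>lattice_box M. translate (l b) (lattice_box (2 * s))) \<union> I"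
    have "depends_on (\<lambda>x. g x * f x) ?J"
      by (rule depends_on_compose2[OF depends_on_mono[OF dg Un_upper1] depends_on_mono[OF that(1) Un_upper2]])
    then show ?thesis by (rule integrable_local) (simp add: that(2))
  qed
  have Eg1: "(\<integral>x. g x \<partial>\<mu>) = 1"
    using Eg[of "\<lambda>_. 0" "\<lambda>_. 1"] by (simp add: zero_in_lattice_box depends_on_const Et)
  have intg: "integrable \<mu> g" using int_gf[OF depends_on_const[of 1 "{}"]] by simp
  \<comment> \<open>A site belongs to one cell, so the perturbation raises its failure probability
    at most by the bound 2 on a single factor, not by a bound on the whole product.\<close>
  have EF: "(\<integral>x. g x * F i x \<partial>\<mu>) \<le> 2 * measure \<mu> {x. code_fails p \<phi> s x}" if i_in: "i \<in> lattice_box n" for i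
  proof -
    obtain b j where bj: "b \<in> lattice_box M" "j \<in> lattice_box (3 * s)" "i = (\<lambda>k. j k + l b k)"
    proof -
      have "i \<in> (\<lambda>(b, j). \<lambda>k. j k + l b k) ` (lattice_box M \<times> lattice_box (3 * s))"
        using bij_betw_imp_surj_on[OF bij] i_in by (simp only:)
      then show ?thesis by (elim imageE SigmaE) (use that in simp)
    qed
    have "(\<integral>x. g x * F i x \<partial>\<mu>) = (\<integral>x. t b x * F i x \<partial>\<mu>)"
      by (rule Eg[OF bj(1) depends_on_mono[OF dF]]) (use cell[OF bj(2)] bj(3) in simp)
    also have "\<dots> \<le> (\<integral>x. 2 * F i x \<partial>\<mu>)"
    proof (rule integral_mono)
      have "depends_on (\<lambda>x. t b x * F i x) (translate (l b) (lattice_box (2 * s)) \<union> translate i (lattice_box s))"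
        by (rule depends_on_compose2[OF depends_on_mono[OF dt Un_upper1] depends_on_mono[OF dF Un_upper2]])
      then show "integrable \<mu> (\<lambda>x. t b x * F i x)" by (rule integrable_local) simp
      show "integrable \<mu> (\<lambda>x. 2 * F i x)" by (rule integrable_local[OF depends_on_compose[OF dF]]) simp
      show "t b x * F i x \<le> 2 * F i x" for x using t01 by (auto simp: F_def)
    qed
    also have "\<dots> = 2 * (\<integral>x. F (\<lambda>_. 0) (zshift i x) \<partial>\<mu>)"
      by (simp add: F_def zshift_0)
    also have "(\<integral>x. F (\<lambda>_. 0) (zshift i x) \<partial>\<mu>) = (\<integral>x. F (\<lambda>_. 0) x \<partial>\<mu>)"
      by (rule integral_zshift) (rule measurable_local[OF dF], simp)
    also have "\<dots> = (\<integral>x. indicator {x. code_fails p \<phi> s x} x \<partial>\<mu>)"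
      by (rule Bochner_Integration.integral_cong) (auto simp: F_def zshift_0 indicator_def)
    finally show ?thesis by simp
  qed
  define bd :: "('d \<Rightarrow> int) set" where "bd = lattice_box (n + s) - lattice_box n"
  have finbd: "finite bd" by (simp add: bd_def)
  have "AE x in \<mu>. \<forall>i\<in>lattice_box (n + s). 0 < pmf p (x i)"
    by (rule AE_finite_allI) (auto intro: AE_pmf_pos)
  then have key: "AE x in \<mu>. g x * ((\<Sum>i\<in>lattice_box n. loc_diff s (zshift i x)) + (\<Sum>i\<in>bd. ln (pmf p (x i))))
      \<le> g x * (info_bound * real (card (lattice_box n :: ('d \<Rightarrow> int) set)) * (\<Sum>i\<in>lattice_box n. F i x))"
  proof eventually_elim
    case (elim x)
    define V where "V = (\<Sum>i\<in>lattice_box n. - ln (pmf q (local_code p \<phi> s (zshift i x))))"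
    define U where "U = (\<Sum>i\<in>lattice_box (n + s). - ln (pmf p (x i)))"
    have F0: "0 \<le> F i x" for i by (simp add: F_def)
    have sub: "lattice_box n \<subseteq> (lattice_box (n + s) :: ('d \<Rightarrow> int) set)" by (rule lattice_box_mono) simp
    have "(\<Sum>i\<in>lattice_box n. ln (pmf p (x i))) + (\<Sum>i\<in>bd. ln (pmf p (x i))) = - U"
      unfolding U_def bd_def sum_negf using sum.subset_diff[OF sub, of "\<lambda>i. ln (pmf p (x i))"] by simp
    then have eq: "(\<Sum>i\<in>lattice_box n. loc_diff s (zshift i x)) + (\<Sum>i\<in>bd. ln (pmf p (x i))) = V - U"
      unfolding V_def loc_diff_def by (simp add: sum_subtractf sum_negf zshift_def)
    have "V - U \<le> info_bound * real (card (lattice_box n :: ('d \<Rightarrow> int) set)) * (\<Sum>i\<in>lattice_box n. F i x)"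
    proof (cases "\<forall>i\<in>lattice_box n. \<not> code_fails p \<phi> s (zshift i x)")
      case True
      then have "V \<le> U" unfolding V_def U_def using elim by (intro information_decreases) auto
      moreover have "0 \<le> info_bound * real (card (lattice_box n :: ('d \<Rightarrow> int) set)) * (\<Sum>i\<in>lattice_box n. F i x)"
        using info_bound_nonneg F0 by (intro mult_nonneg_nonneg sum_nonneg) auto
      ultimately show ?thesis by linarith
    next
      \<comment> \<open>One failing site makes the sum of \<open>F\<close> at least 1, which pays
        for the trivial bounds: \<open>V\<close> is at most \<open>info_bound\<close> times the
        volume, and \<open>U\<close> is nonnegative.\<close>
      case False
      then obtain i where i: "i \<in> lattice_box n" "F i x = 1" by (auto simp: F_def)
      have "1 \<le> (\<Sum>i\<in>lattice_box n. F i x)"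
        using member_le_sum[of i "lattice_box n" "\<lambda>i. F i x"] i F0 by simp
      then have "info_bound * real (card (lattice_box n :: ('d \<Rightarrow> int) set)) * 1
        \<le> info_bound * real (card (lattice_box n :: ('d \<Rightarrow> int) set)) * (\<Sum>i\<in>lattice_box n. F i x)"
        using info_bound_nonneg by (intro mult_left_mono) auto
      moreover have "V \<le> (\<Sum>i\<in>(lattice_box n :: ('d \<Rightarrow> int) set). info_bound)"
        unfolding V_def by (intro sum_mono abs_ln_q_le[THEN abs_le_D2])
      moreover have "0 \<le> U"
        unfolding U_def by (intro sum_nonneg) (use elim in \<open>auto simp: pmf_le_1\<close>)
      ultimately show ?thesis by (simp add: mult.commute)
    qed
    then show ?case unfolding eq by (rule mult_left_mono[OF _ g0])
  qed
  have dln: "depends_on (\<lambda>x. ln (pmf p (x i))) {i}" for i by (rule depends_on_coordinate)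
  have intD: "integrable \<mu> (\<lambda>x. g x * loc_diff s (zshift i x))" for i by (rule int_gf[OF dD]) simp
  have intln: "integrable \<mu> (\<lambda>x. g x * ln (pmf p (x i)))" for i by (rule int_gf[OF dln]) simp
  have intF: "integrable \<mu> (\<lambda>x. g x * F i x)" for i by (rule int_gf[OF dF]) simp
  have "(\<Sum>i\<in>lattice_box n. \<integral>x. g x * loc_diff s (zshift i x) \<partial>\<mu>) + (\<Sum>i\<in>bd. \<integral>x. g x * ln (pmf p (x i)) \<partial>\<mu>)
    = (\<integral>x. g x * ((\<Sum>i\<in>lattice_box n. loc_diff s (zshift i x)) + (\<Sum>i\<in>bd. ln (pmf p (x i)))) \<partial>\<mu>)"
    using intD intln by (simp add: distrib_left sum_distrib_left Bochner_Integration.integral_add Bochner_Integration.integral_sum)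
  also have "\<dots> \<le> (\<integral>x. g x * (info_bound * real (card (lattice_box n :: ('d \<Rightarrow> int) set)) * (\<Sum>i\<in>lattice_box n. F i x)) \<partial>\<mu>)"
  proof (rule integral_mono_AE[OF _ _ key])
    show "integrable \<mu> (\<lambda>x. g x * ((\<Sum>i\<in>lattice_box n. loc_diff s (zshift i x)) + (\<Sum>i\<in>bd. ln (pmf p (x i)))))"
      using intD intln by (simp add: distrib_left sum_distrib_left)
    have "integrable \<mu> (\<lambda>x. info_bound * real (card (lattice_box n :: ('d \<Rightarrow> int) set)) * (\<Sum>i\<in>lattice_box n. g x * F i x))"
      using intF by (intro integrable_mult_right Bochner_Integration.integrable_sum)
    then show "integrable \<mu> (\<lambda>x. g x * (info_bound * real (card (lattice_box n :: ('d \<Rightarrow> int) set)) * (\<Sum>i\<in>lattice_box n. F i x)))"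
      by (simp only: sum_distrib_left mult_ac)
  qed
  also have "\<dots> = info_bound * real (card (lattice_box n :: ('d \<Rightarrow> int) set)) * (\<Sum>i\<in>lattice_box n. \<integral>x. g x * F i x \<partial>\<mu>)"
  proof -
    have "(\<lambda>x. g x * (info_bound * real (card (lattice_box n :: ('d \<Rightarrow> int) set)) * (\<Sum>i\<in>lattice_box n. F i x)))
      = (\<lambda>x. info_bound * real (card (lattice_box n :: ('d \<Rightarrow> int) set)) * (\<Sum>i\<in>lattice_box n. g x * F i x))"
      by (simp only: sum_distrib_left mult_ac)
    then show ?thesis using intF by (simp only:) (simp add: Bochner_Integration.integral_sum)
  qed
  also have "\<dots> \<le> info_bound * real (card (lattice_box n :: ('d \<Rightarrow> int) set)) *
      (\<Sum>i\<in>(lattice_box n :: ('d \<Rightarrow> int) set). 2 * measure \<mu> {x. code_fails p \<phi> s x})"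
    using info_bound_nonneg EF by (intro mult_left_mono sum_mono) auto
  also have "\<dots> = 2 * info_bound * real (card (lattice_box n :: ('d \<Rightarrow> int) set)) ^ 2 * measure \<mu> {x. code_fails p \<phi> s x}"
    by (simp add: power2_eq_square)
  finally have main: "(\<Sum>i\<in>lattice_box n. \<integral>x. g x * loc_diff s (zshift i x) \<partial>\<mu>) + (\<Sum>i\<in>bd. \<integral>x. g x * ln (pmf p (x i)) \<partial>\<mu>)
    \<le> 2 * info_bound * real (card (lattice_box n :: ('d \<Rightarrow> int) set)) ^ 2 * measure \<mu> {x. code_fails p \<phi> s x}" .
  \<comment> \<open>Sites in the shell have no counterpart in the output; each costs at most
    \<open>info_bound\<close>, because \<open>g\<close> has mean 1.\<close>
  have "- info_bound \<le> (\<integral>x. g x * ln (pmf p (x i)) \<partial>\<mu>)" for i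
  proof -
    have "(\<integral>x. g x * (- info_bound) \<partial>\<mu>) \<le> (\<integral>x. g x * ln (pmf p (x i)) \<partial>\<mu>)"
    proof (rule integral_mono[OF _ intln])
      show "integrable \<mu> (\<lambda>x. g x * (- info_bound))" using intg by simp
      show "g x * (- info_bound) \<le> g x * ln (pmf p (x i))" for x
        using abs_ln_p_le[of "x i"] by (intro mult_left_mono g0) linarith
    qed
    then show ?thesis using Eg1 by simp
  qed
  then have bdle: "- info_bound * real (card bd) \<le> (\<Sum>i\<in>bd. \<integral>x. g x * ln (pmf p (x i)) \<partial>\<mu>)"
    using sum_mono[of bd "\<lambda>_. - info_bound"] by (simp add: mult.commute)
  have "(\<Sum>i\<in>lattice_box n. \<integral>x. g x * loc_diff s (zshift i x) \<partial>\<mu>)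
    = (\<Sum>(b, j)\<in>lattice_box M \<times> lattice_box (3 * s). \<integral>x. g x * loc_diff s (zshift (\<lambda>k. j k + l b k) x) \<partial>\<mu>)"
    using sum.reindex_bij_betw[OF bij, of "\<lambda>i. \<integral>x. g x * loc_diff s (zshift i x) \<partial>\<mu>"]
    by (simp add: case_prod_unfold)
  also have "\<dots> = (\<Sum>(b, j)\<in>(lattice_box M :: ('d \<Rightarrow> int) set) \<times> lattice_box (3 * s). \<integral>x. (1 + G x) * loc_diff s (zshift j x) \<partial>\<mu>)"
  proof (rule sum.cong[OF refl], clarify)
    fix b j :: "'d \<Rightarrow> int" assume b: "b \<in> lattice_box M" and j: "j \<in> lattice_box (3 * s)"
    have "(\<integral>x. g x * loc_diff s (zshift (\<lambda>k. j k + l b k) x) \<partial>\<mu>)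
      = (\<integral>x. t b x * loc_diff s (zshift (\<lambda>k. j k + l b k) x) \<partial>\<mu>)"
      by (rule Eg[OF b depends_on_mono[OF dD]]) (rule cell[OF j])
    also have "\<dots> = (\<integral>x. (1 + G (zshift (l b) x)) * loc_diff s (zshift j (zshift (l b) x)) \<partial>\<mu>)"
      by (simp add: t_def zshift_zshift)
    also have "\<dots> = (\<integral>x. (1 + G x) * loc_diff s (zshift j x) \<partial>\<mu>)"
      using measG measurable_local[OF dD[of j]]
      by (intro integral_zshift borel_measurable_times borel_measurable_add) auto
    finally show "(\<integral>x. g x * loc_diff s (zshift (\<lambda>k. j k + l b k) x) \<partial>\<mu>) = (\<integral>x. (1 + G x) * loc_diff s (zshift j x) \<partial>\<mu>)" .
  qed
  also have "\<dots> = real (card (lattice_box M :: ('d \<Rightarrow> int) set)) *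
      (\<Sum>j\<in>lattice_box (3 * s). \<integral>x. (1 + G x) * loc_diff s (zshift j x) \<partial>\<mu>)"
    by (simp add: sum.cartesian_product[symmetric])
  finally show ?thesis using main bdle unfolding bd_def by linarith
qed

end

section \<open>Elementary growth estimates\<close>

lemma power_le_fact_exp: "0 \<le> (x::real) \<Longrightarrow> x ^ n \<le> fact n * exp x"
proof -
  assume x: "0 \<le> x"
  have "(\<Sum>i\<in>{n}. x ^ i /\<^sub>R fact i) \<le> (\<Sum>i. x ^ i /\<^sub>R fact i)"
    using x by (intro sum_le_suminf summable_exp_generic) auto
  then show ?thesis by (simp add: exp_def field_simps)
qed

text \<open>Half of an exponential rate absorbs a polynomial of any degree, with a constant
  independent of \<open>s\<close>.\<close>

lemma poly_exp_bounded:
  fixes a :: real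
  assumes a: "0 < a"
  obtains C where "0 < C" "\<And>s. real (6 * s + 1) ^ n * exp (- (2 * a) * real s) \<le> C * exp (- a * real s)"
proof
  let ?C = "(6 / a) ^ n * (fact n * exp (a / 6))"
  show "0 < ?C" using a by simp
  fix s :: nat
  \<comment> \<open>Written as a multiple of \<open>a * real s + a / 6\<close>, so that one term of
    the exponential series at that point yields the exponential of
    \<open>a * real s\<close>.\<close>
  have "real (6 * s + 1) = (6 / a) * (a * real s + a / 6)" using a by (simp add: field_simps)
  then have "real (6 * s + 1) ^ n = (6 / a) ^ n * (a * real s + a / 6) ^ n" by (simp only: power_mult_distrib)
  also have "\<dots> \<le> (6 / a) ^ n * (fact n * exp (a * real s + a / 6))"
    using a by (intro mult_left_mono power_le_fact_exp) auto
  also have "\<dots> = ?C * exp (a * real s)" by (simp add: exp_add)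
  finally have "real (6 * s + 1) ^ n * exp (- (2 * a) * real s) \<le> ?C * exp (a * real s) * exp (- (2 * a) * real s)"
    by (intro mult_right_mono) auto
  also have "\<dots> = ?C * exp (- a * real s)"
    by (simp add: exp_add[symmetric] mult.assoc algebra_simps)
  finally show "real (6 * s + 1) ^ n * exp (- (2 * a) * real s) \<le> ?C * exp (- a * real s)" .
qed

text \<open>For the volumes of two concentric boxes: the shell is smaller than the volume by one
  power of the side.\<close>

lemma power_diff_le:
  fixes a b :: real
  assumes "0 \<le> a" "a \<le> b"
  shows "b ^ Suc n - a ^ Suc n \<le> real (Suc n) * (b - a) * b ^ n"
proof (induction n)
  case (Suc n)
  have "b ^ Suc (Suc n) - a ^ Suc (Suc n) = b * (b ^ Suc n - a ^ Suc n) + a ^ Suc n * (b - a)"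
    by (simp add: algebra_simps)
  also have "\<dots> \<le> b * (real (Suc n) * (b - a) * b ^ n) + b ^ Suc n * (b - a)"
    using assms Suc by (intro add_mono mult_left_mono mult_right_mono power_mono) auto
  also have "\<dots> = real (Suc (Suc n)) * (b - a) * b ^ Suc n" by (simp add: algebra_simps)
  finally show ?case .
qed simp

lemma integral_coordinate:
  fixes f :: "'c::finite \<Rightarrow> real" and r :: "'c pmf"
  shows "(\<integral>x. f (x i) \<partial>(bernoulli_shift r :: (('d::finite \<Rightarrow> int) \<Rightarrow> 'c) measure)) = (\<Sum>a\<in>UNIV. pmf r a * f a)"
proof -
  have "(\<integral>x. f (x i) \<partial>bernoulli_shift r) = (\<Sum>a\<in>PiE {i} (\<lambda>_. UNIV). f (a i) * (\<Prod>j\<in>{i}. pmf r (a j)))"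
    by (rule integral_local[OF depends_on_coordinate]) simp
  also have "\<dots> = (\<Sum>a\<in>UNIV. pmf r a * f a)"
    by (rule sum.reindex_bij_witness[where j = "\<lambda>a. a i" and i = "\<lambda>a. \<lambda>j\<in>{i}. a"])
       (auto simp: PiE_iff extensional_def)
  finally show ?thesis .
qed

section \<open>Near-orthogonality of the information difference to local observables\<close>

context exp_coding
begin

text \<open>The \<open>w\<close> of the overview, each logarithm being the negative of an
  information.\<close>

definition info_diff :: "(('d \<Rightarrow> int) \<Rightarrow> 'a) \<Rightarrow> real" where
  "info_diff x = ln (pmf q (\<phi> x (\<lambda>_. 0))) - ln (pmf p (x (\<lambda>_. 0)))"

lemma K_nonneg: "0 \<le> K"
  using order_trans[OF measure_nonneg fails_le[of 0]] by simp

lemma measurable_phi_component: "(\<lambda>x. \<phi> x i) \<in> measurable \<mu> (count_space UNIV)"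
  by (rule measurable_compose[OF measurable_phi measurable_component_bernoulli])

lemma borel_measurable_phi: "(\<lambda>x. f (\<phi> x i)) \<in> borel_measurable \<mu>" for f :: "'b \<Rightarrow> real"
  by (rule measurable_compose[OF measurable_phi_component]) simp

lemma integrable_phi: "integrable \<mu> (\<lambda>x. f (\<phi> x i))" for f :: "'b \<Rightarrow> real"
proof (rule integrable_const_bound)
  show "AE x in \<mu>. norm (f (\<phi> x i)) \<le> (\<Sum>b\<in>UNIV. \<bar>f b\<bar>)"
    by (intro AE_I2) (auto intro!: member_le_sum)
  show "(\<lambda>x. f (\<phi> x i)) \<in> borel_measurable \<mu>" by (rule borel_measurable_phi)
qed

lemma measurable_info_diff: "info_diff \<in> borel_measurable \<mu>"
  unfolding info_diff_def
  by (intro borel_measurable_diff borel_measurable_phi measurable_local[OF depends_on_coordinate]) simp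

lemma integral_phi: "(\<integral>x. f (\<phi> x) \<partial>\<mu>) = (\<integral>y. f y \<partial>bernoulli_shift q)"
  if "f \<in> borel_measurable (bernoulli_shift q)" for f :: "_ \<Rightarrow> real"
  using integral_distr[OF measurable_phi that] by (simp add: distr_phi)

lemma integral_ln_eq: "(\<integral>x. ln (pmf q (\<phi> x (\<lambda>_. 0))) \<partial>\<mu>) = (\<integral>x. ln (pmf p (x (\<lambda>_. 0))) \<partial>\<mu>)"
proof -
  have "(\<integral>x. ln (pmf q (\<phi> x (\<lambda>_. 0))) \<partial>\<mu>) = (\<integral>y. ln (pmf q (y (\<lambda>_. 0))) \<partial>(bernoulli_shift q :: (('d \<Rightarrow> int) \<Rightarrow> 'b) measure))"
    using integral_phi[of "\<lambda>y. ln (pmf q (y (\<lambda>_. 0)))"] measurable_local[OF depends_on_coordinate] by simp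
  then show ?thesis
    using entropy_eq integral_coordinate[of q "\<lambda>b. ln (pmf q b)" "\<lambda>_::'d. 0"]
      integral_coordinate[of p "\<lambda>a. ln (pmf p a)" "\<lambda>_::'d. 0"] by (simp add: pmf_entropy_def)
qed

lemma integral_info_diff: "(\<integral>x. info_diff x \<partial>\<mu>) = 0"
proof -
  have "integrable \<mu> (\<lambda>x. ln (pmf p (x (\<lambda>_. 0))))"
    by (rule integrable_local[OF depends_on_coordinate]) simp
  then show ?thesis
    unfolding info_diff_def
    using integrable_phi[of "\<lambda>b. ln (pmf q b)" "\<lambda>_. 0"] integral_ln_eq by simp
qed

text \<open>The true and the coded symbol agree almost everywhere outside the failure set; on it the
  two values of \<open>f\<close> differ by at most \<open>2 * B\<close>.\<close>

lemma code_error: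
  fixes f :: "'b \<Rightarrow> real"
  assumes f: "\<And>b. \<bar>f b\<bar> \<le> B"
  shows "(\<integral>x. \<bar>f (\<phi> x (\<lambda>_. 0)) - f (local_code p \<phi> s x)\<bar> \<partial>\<mu>) \<le> 2 * B * (K * exp (- c * real s))"
proof -
  have B: "0 \<le> B" using order_trans[OF abs_ge_zero f] .
  have dep: "depends_on (\<lambda>x. f (local_code p \<phi> s x)) (lattice_box s)"
    by (rule depends_on_compose[OF depends_on_local_code])
  have depF: "depends_on (\<lambda>x. 2 * B * indicator {x. code_fails p \<phi> s x} x) (lattice_box s)"
    using depends_on_compose[OF depends_on_code_fails[of p \<phi> s], of "\<lambda>b. 2 * B * of_bool b"]
    by (simp add: indicator_def)
  have "(\<integral>x. \<bar>f (\<phi> x (\<lambda>_. 0)) - f (local_code p \<phi> s x)\<bar> \<partial>\<mu>)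
     \<le> (\<integral>x. 2 * B * indicator {x. code_fails p \<phi> s x} x \<partial>\<mu>)"
  proof (rule integral_mono_AE)
    show "integrable \<mu> (\<lambda>x. \<bar>f (\<phi> x (\<lambda>_. 0)) - f (local_code p \<phi> s x)\<bar>)"
      using integrable_phi integrable_local[OF dep] by (intro integrable_abs Bochner_Integration.integrable_diff) auto
    show "integrable \<mu> (\<lambda>x. 2 * B * indicator {x. code_fails p \<phi> s x} x)"
      by (rule integrable_local[OF depF]) simp
    show "AE x in \<mu>. \<bar>f (\<phi> x (\<lambda>_. 0)) - f (local_code p \<phi> s x)\<bar> \<le> 2 * B * indicator {x. code_fails p \<phi> s x} x"
      using AE_local_code[of p \<phi> s]
    proof eventually_elim
      case (elim x)
      have "\<bar>f (\<phi> x (\<lambda>_. 0)) - f (local_code p \<phi> s x)\<bar> \<le> 2 * B"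
        using f[of "\<phi> x (\<lambda>_. 0)"] f[of "local_code p \<phi> s x"] by linarith
      then show ?case using elim by (auto simp: indicator_def)
    qed
  qed
  also have "\<dots> = 2 * B * measure \<mu> {x. code_fails p \<phi> s x}" by simp
  also have "\<dots> \<le> 2 * B * (K * exp (- c * real s))"
    using B by (intro mult_left_mono fails_le) auto
  finally show ?thesis .
qed

lemma integrable_loc_diff: "integrable \<mu> (\<lambda>x. loc_diff s (zshift j x))"
  by (rule integrable_local[OF depends_on_zshift[OF depends_on_loc_diff]]) simp

lemma integrable_info_diff: "integrable \<mu> (\<lambda>x. info_diff (zshift j x))"
proof (rule integrable_const_bound)
  have "\<bar>info_diff x\<bar> \<le> 2 * info_bound" for x
    unfolding info_diff_def using abs_ln_q_le[of "\<phi> x (\<lambda>_. 0)"] abs_ln_p_le[of "x (\<lambda>_. 0)"] by linarith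
  then show "AE x in \<mu>. norm (info_diff (zshift j x)) \<le> 2 * info_bound" by simp
  show "(\<lambda>x. info_diff (zshift j x)) \<in> borel_measurable \<mu>"
    by (rule measurable_compose[OF measurable_zshift measurable_info_diff])
qed

lemma info_diff_loc_diff_error:
  assumes G: "G \<in> borel_measurable \<mu>" "\<And>x. \<bar>G x\<bar> \<le> 1"
  shows "\<bar>(\<integral>x. G x * info_diff (zshift j x) \<partial>\<mu>) + (\<integral>x. G x * loc_diff s (zshift j x) \<partial>\<mu>)\<bar>
    \<le> 2 * info_bound * (K * exp (- c * real s))"
proof -
  define e where "e x = ln (pmf q (\<phi> x (\<lambda>_. 0))) - ln (pmf q (local_code p \<phi> s x))" for x
  have e: "info_diff x + loc_diff s x = e x" for x by (simp add: e_def info_diff_def loc_diff_def)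
  have bound: "integrable \<mu> (\<lambda>x. G x * f x)" if "integrable \<mu> f" for f
    by (rule Bochner_Integration.integrable_bound[OF that])
      (use G that in \<open>auto simp: abs_mult intro!: AE_I2 mult_left_le_one_le\<close>)
  have meas_e: "e \<in> borel_measurable \<mu>" unfolding e_def
    by (intro borel_measurable_diff borel_measurable_phi
        measurable_local[OF depends_on_compose[OF depends_on_local_code]]) simp
  have int_e: "integrable \<mu> (\<lambda>x. e (zshift j x))"
    using Bochner_Integration.integrable_add[OF integrable_info_diff integrable_loc_diff, of j s j] by (simp add: e)
  have "(\<integral>x. G x * info_diff (zshift j x) \<partial>\<mu>) + (\<integral>x. G x * loc_diff s (zshift j x) \<partial>\<mu>)
    = (\<integral>x. G x * info_diff (zshift j x) + G x * loc_diff s (zshift j x) \<partial>\<mu>)"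
    by (rule Bochner_Integration.integral_add[symmetric])
       (intro bound integrable_info_diff integrable_loc_diff)+
  also have "\<dots> = (\<integral>x. G x * e (zshift j x) \<partial>\<mu>)"
    by (simp only: distrib_left[symmetric] e)
  also have "\<bar>\<dots>\<bar> \<le> (\<integral>x. \<bar>G x * e (zshift j x)\<bar> \<partial>\<mu>)"
    using integral_norm_bound[of \<mu> "\<lambda>x. G x * e (zshift j x)"] by simp
  also have "\<dots> \<le> (\<integral>x. \<bar>e (zshift j x)\<bar> \<partial>\<mu>)"
  proof (rule integral_mono)
    show "integrable \<mu> (\<lambda>x. \<bar>G x * e (zshift j x)\<bar>)" by (rule integrable_abs[OF bound[OF int_e]])
    show "integrable \<mu> (\<lambda>x. \<bar>e (zshift j x)\<bar>)" by (rule integrable_abs[OF int_e])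
    show "\<bar>G x * e (zshift j x)\<bar> \<le> \<bar>e (zshift j x)\<bar>" for x
      using G(2)[of x] by (simp add: abs_mult mult_left_le_one_le)
  qed
  also have "\<dots> = (\<integral>x. \<bar>e x\<bar> \<partial>\<mu>)"
    using meas_e by (intro integral_zshift) simp
  also have "\<dots> \<le> 2 * info_bound * (K * exp (- c * real s))"
    unfolding e_def by (rule code_error[OF abs_ln_q_le])
  finally show ?thesis .
qed

text \<open>One summand for each source of error: the shell, failures of the code inside the box,
  and the mean of \<open>loc_diff\<close>, which is nonzero only through coding errors.\<close>

definition resp_const :: real where
  "resp_const = info_bound * real CARD('d) * 2 ^ CARD('d) + 2 * info_bound * 5 ^ CARD('d) * K + 2 * info_bound * K"

text \<open>The number of cells balances two errors per cell. With \<open>N\<close> cells along a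
  side, the shell costs about 1 / N and failures cost about N^d exp(- c s). Taking \<open>N\<close>
  of order exp(\<beta> s) with \<beta> = c / (2d) makes these exp(- \<beta> s) and exp(- c s / 2),
  up to powers of \<open>6 * s + 1\<close>.\<close>

lemma loc_diff_response_le:
  assumes G: "depends_on G (lattice_box (2 * s))" "\<And>x. \<bar>G x\<bar> \<le> 1" "(\<integral>x. G x \<partial>\<mu>) = 0"
  shows "(\<Sum>j\<in>lattice_box (3 * s). \<integral>x. G x * loc_diff s (zshift j x) \<partial>\<mu>)
    \<le> resp_const * (real (6 * s + 1) ^ (2 * CARD('d)) * exp (- (c / (2 * real CARD('d))) * real s))"
proof -
  define d where "d = CARD('d)"
  define \<beta> where "\<beta> = c / (2 * real d)"
  define M where "M = nat \<lceil>exp (\<beta> * real s)\<rceil>"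
  define n where "n = (6 * s + 1) * M + 3 * s"
  define l where "l = real (6 * s + 1)"
  define N where "N = real (2 * M + 1)"
  define L where "L = info_bound"
  define T where "T = (\<Sum>j\<in>lattice_box (3 * s). \<integral>x. (1 + G x) * loc_diff s (zshift j x) \<partial>\<mu>)"
  have d: "0 < d" by (simp add: d_def)
  have L: "0 \<le> L" by (simp add: L_def info_bound_nonneg)
  have \<beta>: "0 < \<beta>" using c_pos d by (simp add: \<beta>_def)
  have \<beta>d: "\<beta> * real d = c / 2" using d by (simp add: \<beta>_def)
  have l1: "1 \<le> l" by (simp add: l_def)
  have exp1: "1 \<le> exp (\<beta> * real s)" using \<beta> by simp
  have M: "exp (\<beta> * real s) \<le> real M" "real M \<le> exp (\<beta> * real s) + 1"
    unfolding M_def using exp1 by linarith+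
  \<comment> \<open>\<open>N\<close> is \<open>2 * M + 1\<close> and \<open>M\<close> exceeds the
    exponential by at most 1, which leaves a remainder 3; as the exponential is at least 1, the
    total is at most 5 times it.\<close>
  have N1: "exp (\<beta> * real s) \<le> N" "N \<le> 5 * exp (\<beta> * real s)" "1 \<le> N"
    unfolding N_def of_nat_add of_nat_mult of_nat_numeral of_nat_1 using M exp1 by linarith+
  have cn: "real (card (lattice_box n :: ('d \<Rightarrow> int) set)) = (l * N) ^ d"
  proof -
    have "2 * n + 1 = (6 * s + 1) * (2 * M + 1)" by (simp add: n_def algebra_simps)
    then show ?thesis unfolding card_lattice_box d_def l_def N_def by (simp only: of_nat_power of_nat_mult)
  qed
  have cns: "real (card (lattice_box (n + s) :: ('d \<Rightarrow> int) set)) = (l * N + 2 * real s) ^ d"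
  proof -
    have "2 * (n + s) + 1 = (6 * s + 1) * (2 * M + 1) + 2 * s" by (simp add: n_def algebra_simps)
    then show ?thesis unfolding card_lattice_box d_def l_def N_def
      by (simp only: of_nat_power of_nat_mult of_nat_add of_nat_numeral)
  qed
  have cM: "real (card (lattice_box M :: ('d \<Rightarrow> int) set)) = N ^ d"
    by (simp add: card_lattice_box d_def N_def)
  have "real (card (lattice_box (n + s) - lattice_box n :: ('d \<Rightarrow> int) set)) = (l * N + 2 * real s) ^ d - (l * N) ^ d"
  proof -
    have sub: "lattice_box n \<subseteq> (lattice_box (n + s) :: ('d \<Rightarrow> int) set)" by (rule lattice_box_mono) simp
    then show ?thesis
      using cn cns card_mono[OF _ sub] by (simp add: card_Diff_subset of_nat_diff)
  qed
  also have "\<dots> \<le> real d * 2 ^ d * l ^ d * N ^ (d - 1)"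
  proof -
    obtain d' where d': "d = Suc d'" using d by (cases d) auto
    have "0 \<le> l * N" using l1 N1 by simp
    have "(l * N + 2 * real s) ^ d - (l * N) ^ d \<le> real d * (2 * real s) * (l * N + 2 * real s) ^ d'"
      using power_diff_le[of "l * N" "l * N + 2 * real s" d'] \<open>0 \<le> l * N\<close> by (simp only: d') simp
    also have "\<dots> \<le> real d * (2 * l) * (2 * (l * N)) ^ d'"
    proof (intro mult_mono power_mono)
      have sl: "2 * real s \<le> l" by (simp add: l_def)
      then show "real s \<le> l" using l1 by linarith
      have "l * 1 \<le> l * N" using l1 N1 by (intro mult_left_mono) auto
      then show "l * N + 2 * real s \<le> 2 * (l * N)" using sl by linarith
    qed (use \<open>0 \<le> l * N\<close> l1 in auto)
    also have "\<dots> = real d * 2 ^ d * l ^ d * N ^ (d - 1)"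
      by (simp add: d' power_mult_distrib mult_ac)
    finally show ?thesis .
  qed
  finally have bd: "real (card (lattice_box (n + s) - lattice_box n :: ('d \<Rightarrow> int) set)) \<le> real d * 2 ^ d * l ^ d * N ^ (d - 1)" .
  have "N ^ d * T \<le> L * real (card (lattice_box (n + s) - lattice_box n :: ('d \<Rightarrow> int) set))
      + 2 * L * ((l * N) ^ d) ^ 2 * measure \<mu> {x. code_fails p \<phi> s x}"
    using loc_diff_le[OF n_def G] unfolding cM cn T_def[symmetric] L_def[symmetric] .
  also have "\<dots> \<le> L * (real d * 2 ^ d * l ^ d * N ^ (d - 1)) + 2 * L * ((l * N) ^ d) ^ 2 * (K * exp (- c * real s))"
    using L by (intro add_mono mult_left_mono bd fails_le) auto
  also have "\<dots> = N ^ d * (L * real d * 2 ^ d * l ^ d / N + 2 * L * l ^ (2 * d) * N ^ d * (K * exp (- c * real s)))"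
  proof -
    have "N ^ (d - 1) = N ^ d / N" using d N1 by (simp add: power_diff)
    moreover have "((l * N) ^ d) ^ 2 = N ^ d * (l ^ (2 * d) * N ^ d)"
      unfolding mult_2 power_add by (simp add: power_mult_distrib power2_eq_square mult_ac)
    ultimately show ?thesis by (simp only:) (simp add: algebra_simps)
  qed
  finally have "T \<le> L * real d * 2 ^ d * l ^ d / N + 2 * L * l ^ (2 * d) * N ^ d * (K * exp (- c * real s))"
    using N1 by (simp only: mult_le_cancel_left_pos zero_less_power order.strict_trans2[OF zero_less_one])
  also have "L * real d * 2 ^ d * l ^ d / N \<le> L * real d * 2 ^ d * (l ^ (2 * d) * exp (- \<beta> * real s))"
  proof -
    have "1 / N \<le> exp (- \<beta> * real s)"
      using N1 by (simp add: exp_minus field_simps)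
    moreover have "l ^ d \<le> l ^ (2 * d)" using l1 by (intro power_increasing) auto
    ultimately have "l ^ d * (1 / N) \<le> l ^ (2 * d) * exp (- \<beta> * real s)"
      using l1 N1 by (intro mult_mono) auto
    then have "L * real d * 2 ^ d * (l ^ d * (1 / N)) \<le> L * real d * 2 ^ d * (l ^ (2 * d) * exp (- \<beta> * real s))"
      using L by (intro mult_left_mono) auto
    then show ?thesis by simp
  qed
  also have "2 * L * l ^ (2 * d) * N ^ d * (K * exp (- c * real s)) \<le> 2 * L * 5 ^ d * K * (l ^ (2 * d) * exp (- \<beta> * real s))"
  proof -
    have "N ^ d \<le> (5 * exp (\<beta> * real s)) ^ d" using N1 by (intro power_mono) auto
    also have "\<dots> = 5 ^ d * exp (c / 2 * real s)"
      by (simp add: power_mult_distrib exp_of_nat_mult[symmetric] \<beta>d[symmetric] mult_ac)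
    finally have "N ^ d * exp (- c * real s) \<le> 5 ^ d * exp (c / 2 * real s) * exp (- c * real s)"
      by (intro mult_right_mono) auto
    also have "\<dots> = 5 ^ d * exp (- (c / 2) * real s)"
      by (simp add: mult.assoc exp_add[symmetric] algebra_simps)
    also have "\<dots> \<le> 5 ^ d * exp (- \<beta> * real s)"
    proof -
      have "\<beta> * 1 \<le> \<beta> * real d" using \<beta> d by (intro mult_left_mono) auto
      then have "\<beta> * real s \<le> c / 2 * real s" unfolding \<beta>d by (intro mult_right_mono) auto
      then show ?thesis by simp
    qed
    finally have "2 * L * l ^ (2 * d) * K * (N ^ d * exp (- c * real s)) \<le> 2 * L * l ^ (2 * d) * K * (5 ^ d * exp (- \<beta> * real s))"
      using L K_nonneg l1 by (intro mult_left_mono) auto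
    then show ?thesis by (simp add: mult_ac)
  qed
  finally have T: "T \<le> (L * real d * 2 ^ d + 2 * L * 5 ^ d * K) * (l ^ (2 * d) * exp (- \<beta> * real s))"
    by (simp add: algebra_simps)
  \<comment> \<open>\<open>T\<close> is formed with the density \<open>1 + G\<close>. Removing the 1
    costs the mean of \<open>loc_diff\<close>, which is a coding error because
    \<open>info_diff\<close> has mean 0.\<close>
  have "- (\<integral>x. loc_diff s (zshift j x) \<partial>\<mu>) \<le> 2 * L * (K * exp (- c * real s))" for j
  proof -
    have "(\<integral>x. info_diff (zshift j x) \<partial>\<mu>) = 0"
      using integral_zshift[OF measurable_info_diff] integral_info_diff by simp
    then show ?thesis
      using info_diff_loc_diff_error[of "\<lambda>_. 1" j s] unfolding L_def by simp
  qed
  then have "(\<Sum>j\<in>lattice_box (3 * s). - (\<integral>x. loc_diff s (zshift j x) \<partial>\<mu>))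
     \<le> (\<Sum>j\<in>(lattice_box (3 * s) :: ('d \<Rightarrow> int) set). 2 * L * (K * exp (- c * real s)))"
    by (intro sum_mono)
  also have "\<dots> = 2 * L * K * (l ^ d * exp (- c * real s))"
    by (simp add: card_lattice_box d_def l_def)
  also have "\<dots> \<le> 2 * L * K * (l ^ (2 * d) * exp (- \<beta> * real s))"
  proof (intro mult_left_mono mult_mono)
    show "l ^ d \<le> l ^ (2 * d)" using l1 by (intro power_increasing) auto
    have "\<beta> \<le> c" using c_pos d by (simp add: \<beta>_def field_simps)
    then show "exp (- c * real s) \<le> exp (- \<beta> * real s)" by (simp add: mult_right_mono)
  qed (use L K_nonneg l1 in auto)
  finally have E: "(\<Sum>j\<in>lattice_box (3 * s). - (\<integral>x. loc_diff s (zshift j x) \<partial>\<mu>)) \<le> 2 * L * K * (l ^ (2 * d) * exp (- \<beta> * real s))" .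
  have "T = (\<Sum>j\<in>lattice_box (3 * s). (\<integral>x. G x * loc_diff s (zshift j x) \<partial>\<mu>) + (\<integral>x. loc_diff s (zshift j x) \<partial>\<mu>))"
    unfolding T_def
  proof (rule sum.cong[OF refl])
    fix j
    have "integrable \<mu> (\<lambda>x. G x * loc_diff s (zshift j x))"
      by (rule integrable_local[OF depends_on_compose2[OF depends_on_mono[OF G(1) Un_upper1]
            depends_on_mono[OF depends_on_zshift[OF depends_on_loc_diff] Un_upper2]]]) simp
    then show "(\<integral>x. (1 + G x) * loc_diff s (zshift j x) \<partial>\<mu>)
      = (\<integral>x. G x * loc_diff s (zshift j x) \<partial>\<mu>) + (\<integral>x. loc_diff s (zshift j x) \<partial>\<mu>)"
      using integrable_loc_diff[of s j] by (simp add: distrib_right)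
  qed
  then have "(\<Sum>j\<in>lattice_box (3 * s). \<integral>x. G x * loc_diff s (zshift j x) \<partial>\<mu>)
    = T + (\<Sum>j\<in>lattice_box (3 * s). - (\<integral>x. loc_diff s (zshift j x) \<partial>\<mu>))"
    by (simp add: sum.distrib sum_negf)
  also have "\<dots> \<le> (L * real d * 2 ^ d + 2 * L * 5 ^ d * K) * (l ^ (2 * d) * exp (- \<beta> * real s))
     + 2 * L * K * (l ^ (2 * d) * exp (- \<beta> * real s))"
    by (rule add_mono[OF T E])
  also have "\<dots> = resp_const * (l ^ (2 * d) * exp (- \<beta> * real s))"
    by (simp add: resp_const_def L_def d_def algebra_simps)
  finally show ?thesis unfolding l_def d_def \<beta>_def .
qed

text \<open>The previous bound is one-sided, but its hypotheses are invariant under replacing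
  \<open>G\<close> by \<open>- G\<close>; the two bounds together control the absolute
  value.\<close>

lemma loc_diff_response_abs_le:
  assumes G: "depends_on G (lattice_box (2 * s))" "\<And>x. \<bar>G x\<bar> \<le> 1" "(\<integral>x. G x \<partial>\<mu>) = 0"
  shows "\<bar>\<Sum>j\<in>lattice_box (3 * s). \<integral>x. G x * loc_diff s (zshift j x) \<partial>\<mu>\<bar>
    \<le> resp_const * (real (6 * s + 1) ^ (2 * CARD('d)) * exp (- (c / (2 * real CARD('d))) * real s))"
proof -
  have "(\<Sum>j\<in>lattice_box (3 * s). \<integral>x. - G x * loc_diff s (zshift j x) \<partial>\<mu>)
    \<le> resp_const * (real (6 * s + 1) ^ (2 * CARD('d)) * exp (- (c / (2 * real CARD('d))) * real s))"
    by (rule loc_diff_response_le) (use G in \<open>auto intro: depends_on_compose\<close>)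
  then show ?thesis using loc_diff_response_le[OF G] by (simp add: sum_negf abs_le_iff)
qed

text \<open>Formally, \<open>info_diff\<close> summed over the whole lattice is uncorrelated with every local observable.\<close>
lemma response_bound:
  obtains C c' where "0 < C" "0 < c'"
    "\<And>s G. depends_on G (lattice_box (2 * s)) \<Longrightarrow> (\<And>x. \<bar>G x\<bar> \<le> 1) \<Longrightarrow>
      \<bar>\<Sum>j\<in>lattice_box (3 * s). \<integral>x. G x * info_diff (zshift j x) \<partial>\<mu>\<bar> \<le> C * exp (- c' * real s)"
proof -
  define d where "d = CARD('d)"
  have d: "0 < d" by (simp add: d_def)
  \<comment> \<open>Half of the rate \<open>c / (2 * real d)\<close>; the other half absorbs the
    power of \<open>6 * s + 1\<close>.\<close>
  define c' where "c' = c / (4 * real d)"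
  have c': "0 < c'" using c_pos d by (simp add: c'_def)
  have c'2: "c / (2 * real d) = 2 * c'" by (simp add: c'_def)
  obtain C0 where C0: "0 < C0" "\<And>s. real (6 * s + 1) ^ (2 * d) * exp (- (2 * c') * real s) \<le> C0 * exp (- c' * real s)"
    using poly_exp_bounded[OF c', of "2 * d"] by blast
  define R where "R = resp_const + 2 * info_bound * K"
  have resp0: "0 \<le> resp_const" unfolding resp_const_def using info_bound_nonneg K_nonneg by simp
  have R0: "0 \<le> R" unfolding R_def using resp0 info_bound_nonneg K_nonneg by simp
  define C where "C = 2 * R * C0 + 1"
  have "\<bar>\<Sum>j\<in>lattice_box (3 * s). \<integral>x. G x * info_diff (zshift j x) \<partial>\<mu>\<bar> \<le> C * exp (- c' * real s)"
    if G: "depends_on G (lattice_box (2 * s))" "\<And>x. \<bar>G x\<bar> \<le> 1" for s G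
  proof -
    define m where "m = (\<integral>x. G x \<partial>\<mu>)"
    \<comment> \<open>Centred to get mean 0, and halved to keep the bound 1. Subtracting the
      constant \<open>m\<close> leaves the correlations unchanged, because \<open>info_diff\<close>
      has mean 0.\<close>
    define H where "H x = (G x - m) / 2" for x
    define P where "P = real (6 * s + 1) ^ (2 * d) * exp (- (2 * c') * real s)"
    have intG: "integrable \<mu> G" by (rule integrable_local[OF G(1)]) simp
    have m: "\<bar>m\<bar> \<le> 1"
    proof -
      have "\<bar>m\<bar> \<le> (\<integral>x. \<bar>G x\<bar> \<partial>\<mu>)" unfolding m_def using integral_norm_bound[of \<mu> G] by simp
      also have "\<dots> \<le> (\<integral>x. 1 \<partial>\<mu>)" using intG G(2) by (intro integral_mono) auto
      finally show ?thesis using prob_space by simp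
    qed
    have H: "depends_on H (lattice_box (2 * s))" "\<And>x. \<bar>H x\<bar> \<le> 1" "(\<integral>x. H x \<partial>\<mu>) = 0"
    proof -
      show "depends_on H (lattice_box (2 * s))" unfolding H_def by (rule depends_on_compose[OF G(1)])
      show "\<bar>H x\<bar> \<le> 1" for x using m G(2)[of x] unfolding H_def by (simp add: abs_le_iff)
      show "(\<integral>x. H x \<partial>\<mu>) = 0" unfolding H_def using intG prob_space by (simp add: m_def)
    qed
    have measH: "H \<in> borel_measurable \<mu>" by (rule measurable_local[OF H(1)]) simp
    have "(\<integral>x. G x * info_diff (zshift j x) \<partial>\<mu>) = 2 * (\<integral>x. H x * info_diff (zshift j x) \<partial>\<mu>)" for j
    proof -
      have 0: "(\<integral>x. info_diff (zshift j x) \<partial>\<mu>) = 0"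
        using integral_zshift[OF measurable_info_diff] integral_info_diff by simp
      have int: "integrable \<mu> (\<lambda>x. H x * info_diff (zshift j x))"
        by (rule Bochner_Integration.integrable_bound[OF integrable_info_diff[of j]])
           (use H(2) measH integrable_info_diff[of j] in \<open>auto simp: abs_mult intro!: AE_I2 mult_left_le_one_le\<close>)
      have "(\<lambda>x. G x * info_diff (zshift j x)) = (\<lambda>x. 2 * (H x * info_diff (zshift j x)) + m * info_diff (zshift j x))"
        by (simp add: H_def field_simps)
      then have "(\<integral>x. G x * info_diff (zshift j x) \<partial>\<mu>)
        = (\<integral>x. 2 * (H x * info_diff (zshift j x)) + m * info_diff (zshift j x) \<partial>\<mu>)" by (simp only:)
      also have "\<dots> = 2 * (\<integral>x. H x * info_diff (zshift j x) \<partial>\<mu>) + m * (\<integral>x. info_diff (zshift j x) \<partial>\<mu>)"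
        using int integrable_info_diff[of j] by simp
      finally show ?thesis using 0 by simp
    qed
    then have "\<bar>\<Sum>j\<in>lattice_box (3 * s). \<integral>x. G x * info_diff (zshift j x) \<partial>\<mu>\<bar>
      = 2 * \<bar>\<Sum>j\<in>lattice_box (3 * s). \<integral>x. H x * info_diff (zshift j x) \<partial>\<mu>\<bar>"
      by (simp add: sum_distrib_left[symmetric] abs_mult)
    also have "\<bar>\<Sum>j\<in>lattice_box (3 * s). \<integral>x. H x * info_diff (zshift j x) \<partial>\<mu>\<bar> \<le>
       \<bar>\<Sum>j\<in>lattice_box (3 * s). (\<integral>x. H x * info_diff (zshift j x) \<partial>\<mu>) + (\<integral>x. H x * loc_diff s (zshift j x) \<partial>\<mu>)\<bar>
       + \<bar>\<Sum>j\<in>lattice_box (3 * s). \<integral>x. H x * loc_diff s (zshift j x) \<partial>\<mu>\<bar>"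
      by (simp add: sum.distrib)
    also have "\<dots> \<le> 2 * info_bound * K * P + resp_const * P"
    proof (rule add_mono)
      show "\<bar>\<Sum>j\<in>lattice_box (3 * s). \<integral>x. H x * loc_diff s (zshift j x) \<partial>\<mu>\<bar> \<le> resp_const * P"
        using loc_diff_response_abs_le[OF H] unfolding P_def c'2[symmetric] d_def by simp
      have "\<bar>\<Sum>j\<in>lattice_box (3 * s). (\<integral>x. H x * info_diff (zshift j x) \<partial>\<mu>) + (\<integral>x. H x * loc_diff s (zshift j x) \<partial>\<mu>)\<bar>
        \<le> (\<Sum>j\<in>(lattice_box (3 * s) :: ('d \<Rightarrow> int) set). 2 * info_bound * (K * exp (- c * real s)))"
        by (rule order_trans[OF sum_abs]) (intro sum_mono info_diff_loc_diff_error measH H(2))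
      also have "\<dots> = 2 * info_bound * K * (real (6 * s + 1) ^ d * exp (- c * real s))"
        by (simp add: card_lattice_box d_def)
      also have "\<dots> \<le> 2 * info_bound * K * P"
        unfolding P_def
      proof (intro mult_left_mono mult_mono)
        show "real (6 * s + 1) ^ d \<le> real (6 * s + 1) ^ (2 * d)" by (intro power_increasing) auto
        have "2 * c' \<le> c" using c_pos d by (simp add: c'_def field_simps)
        then show "exp (- c * real s) \<le> exp (- (2 * c') * real s)" by (simp add: mult_right_mono)
      qed (use info_bound_nonneg K_nonneg in auto)
      finally show "\<bar>\<Sum>j\<in>lattice_box (3 * s). (\<integral>x. H x * info_diff (zshift j x) \<partial>\<mu>) + (\<integral>x. H x * loc_diff s (zshift j x) \<partial>\<mu>)\<bar>
        \<le> 2 * info_bound * K * P" .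
    qed
    also have "\<dots> = R * P" by (simp add: R_def algebra_simps)
    also have "\<dots> \<le> R * (C0 * exp (- c' * real s))"
      unfolding P_def using R0 C0(2) by (intro mult_left_mono) auto
    finally have "\<bar>\<Sum>j\<in>lattice_box (3 * s). \<integral>x. G x * info_diff (zshift j x) \<partial>\<mu>\<bar> \<le> 2 * (R * (C0 * exp (- c' * real s)))"
      by simp
    also have "\<dots> \<le> C * exp (- c' * real s)" by (simp add: C_def algebra_simps)
    finally show ?thesis .
  qed
  moreover have "0 < C" unfolding C_def using R0 C0(1) by (simp add: add_nonneg_pos)
  ultimately show ?thesis using c' that by blast
qed

end

section \<open>Cumulants of quasi-local fields\<close>

text \<open>Approximation in L1 by functions obeying the same bound 1 as the field: products of
  fields then stay close by telescoping, without higher norms.\<close>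

definition quasi_local :: "'a pmf \<Rightarrow> real \<Rightarrow> real \<Rightarrow> ((('d::finite \<Rightarrow> int) \<Rightarrow> 'a) \<Rightarrow> real) \<Rightarrow> bool" where
  "quasi_local p A a g \<longleftrightarrow> g \<in> borel_measurable (bernoulli_shift p) \<and> (\<forall>x. \<bar>g x\<bar> \<le> 1) \<and>
     (\<forall>s. \<exists>h. depends_on h (lattice_box s) \<and> (\<forall>x. \<bar>h x\<bar> \<le> 1) \<and>
       (\<integral>x. \<bar>g x - h x\<bar> \<partial>bernoulli_shift p) \<le> A * exp (- a * real s))"

definition field_moment :: "'a pmf \<Rightarrow> (nat \<Rightarrow> (('d::finite \<Rightarrow> int) \<Rightarrow> 'a) \<Rightarrow> real) \<Rightarrow> (nat \<Rightarrow> 'd \<Rightarrow> int)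
    \<Rightarrow> nat set \<Rightarrow> real" where
  "field_moment p g \<tau> S = (\<integral>x. (\<Prod>m\<in>S. g m (zshift (\<tau> m) x)) \<partial>bernoulli_shift p)"

lemma abs_prod_le_1:
  fixes f :: "'b \<Rightarrow> real"
  assumes "\<And>m. m \<in> S \<Longrightarrow> \<bar>f m\<bar> \<le> 1"
  shows "\<bar>\<Prod>m\<in>S. f m\<bar> \<le> 1"
  unfolding abs_prod by (rule prod_le_1) (use assms in auto)

lemma abs_prod_diff_le:
  fixes f g :: "'b \<Rightarrow> real"
  assumes "\<And>m. m \<in> S \<Longrightarrow> \<bar>f m\<bar> \<le> 1" "\<And>m. m \<in> S \<Longrightarrow> \<bar>g m\<bar> \<le> 1"
  shows "\<bar>(\<Prod>m\<in>S. f m) - (\<Prod>m\<in>S. g m)\<bar> \<le> (\<Sum>m\<in>S. \<bar>f m - g m\<bar>)"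
  using norm_prod_diff[of S f g] assms by simp

lemma borel_measurable_zshift:
  "g \<in> borel_measurable (bernoulli_shift p) \<Longrightarrow> (\<lambda>x. g (zshift v x)) \<in> borel_measurable (bernoulli_shift p)"
  by (rule measurable_compose[OF measurable_zshift])

lemma integrable_bounded:
  fixes f :: "(('d::finite \<Rightarrow> int) \<Rightarrow> 'a) \<Rightarrow> real"
  assumes "f \<in> borel_measurable (bernoulli_shift p)" "\<And>x. \<bar>f x\<bar> \<le> B"
  shows "integrable (bernoulli_shift p) f"
proof -
  interpret prob_space "bernoulli_shift p :: (('d \<Rightarrow> int) \<Rightarrow> 'a) measure" by (rule prob_space_bernoulli_shift)
  show ?thesis by (rule integrable_const_bound[of _ B]) (use assms in auto)
qed

lemma abs_integral_le_1:
  fixes f :: "(('d::finite \<Rightarrow> int) \<Rightarrow> 'a) \<Rightarrow> real"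
  assumes "f \<in> borel_measurable (bernoulli_shift p)" "\<And>x. \<bar>f x\<bar> \<le> 1"
  shows "\<bar>\<integral>x. f x \<partial>bernoulli_shift p\<bar> \<le> 1"
proof -
  interpret prob_space "bernoulli_shift p :: (('d \<Rightarrow> int) \<Rightarrow> 'a) measure" by (rule prob_space_bernoulli_shift)
  have "\<bar>\<integral>x. f x \<partial>bernoulli_shift p\<bar> \<le> (\<integral>x. \<bar>f x\<bar> \<partial>bernoulli_shift p)"
    using integral_norm_bound[of "bernoulli_shift p" f] by simp
  also have "\<dots> \<le> (\<integral>x. 1 \<partial>(bernoulli_shift p :: (('d \<Rightarrow> int) \<Rightarrow> 'a) measure))"
    using assms integrable_bounded[OF assms] by (intro integral_mono) auto
  finally show ?thesis using prob_space by simp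
qed

lemma abs_field_moment_le_1:
  assumes "\<And>m. m \<in> S \<Longrightarrow> g m \<in> borel_measurable (bernoulli_shift p)" "\<And>m x. m \<in> S \<Longrightarrow> \<bar>g m x\<bar> \<le> 1"
  shows "\<bar>field_moment p g \<tau> S\<bar> \<le> 1"
  unfolding field_moment_def
proof (rule abs_integral_le_1)
  show "(\<lambda>x. \<Prod>m\<in>S. g m (zshift (\<tau> m) x)) \<in> borel_measurable (bernoulli_shift p)"
    using assms(1) by (intro borel_measurable_prod borel_measurable_zshift) auto
  show "\<bar>\<Prod>m\<in>S. g m (zshift (\<tau> m) x)\<bar> \<le> 1" for x
    by (rule abs_prod_le_1) (rule assms(2))
qed

lemma field_moment_cong:
  assumes "\<And>m. m \<in> S \<Longrightarrow> g m = g' m" "\<And>m. m \<in> S \<Longrightarrow> \<tau> m = \<tau>' m"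
  shows "field_moment p g \<tau> S = field_moment p g' \<tau>' S"
proof -
  have "(\<Prod>m\<in>S. g m (zshift (\<tau> m) x)) = (\<Prod>m\<in>S. g' m (zshift (\<tau>' m) x))" for x
    by (rule prod.cong) (auto simp: assms)
  then show ?thesis unfolding field_moment_def by (simp only:)
qed

lemma field_moment_translate:
  fixes v :: "'d::finite \<Rightarrow> int"
  assumes "\<And>m. m \<in> S \<Longrightarrow> g m \<in> borel_measurable (bernoulli_shift p)"
  shows "field_moment p g (\<lambda>m i. \<tau> m i + v i) S = field_moment p g \<tau> S"
proof -
  have "field_moment p g (\<lambda>m i. \<tau> m i + v i) S
    = (\<integral>x. (\<Prod>m\<in>S. g m (zshift (\<tau> m) (zshift v x))) \<partial>bernoulli_shift p)"
    unfolding field_moment_def by (simp only: zshift_zshift)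
  also have "\<dots> = field_moment p g \<tau> S"
    unfolding field_moment_def
    by (rule integral_zshift) (use assms in \<open>intro borel_measurable_prod borel_measurable_zshift, auto\<close>)
  finally show ?thesis .
qed

text \<open>The approximants are chosen once and serve all sites and all subsets of indices. The
  factor \<open>f\<close> allows one field to stay exact while the others are made local, as the sum
  over the position of \<open>w\<close> requires.\<close>

lemma quasi_local_approx:
  fixes g :: "nat \<Rightarrow> (('d::finite \<Rightarrow> int) \<Rightarrow> 'a::finite) \<Rightarrow> real"
  assumes g: "\<And>m. m < k \<Longrightarrow> quasi_local p A a (g m)"
  obtains h where "\<And>m. m < k \<Longrightarrow> depends_on (h m) (lattice_box s)" "\<And>m x. m < k \<Longrightarrow> \<bar>h m x\<bar> \<le> 1"
    and "\<And>S \<tau> f. S \<subseteq> {..<k} \<Longrightarrow> f \<in> borel_measurable (bernoulli_shift p) \<Longrightarrow> (\<And>x. \<bar>f x\<bar> \<le> 1) \<Longrightarrow>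
      \<bar>(\<integral>x. f x * (\<Prod>m\<in>S. g m (zshift (\<tau> m) x)) \<partial>bernoulli_shift p)
        - (\<integral>x. f x * (\<Prod>m\<in>S. h m (zshift (\<tau> m) x)) \<partial>bernoulli_shift p)\<bar> \<le> real k * (A * exp (- a * real s))"
proof -
  let ?\<mu> = "bernoulli_shift p :: (('d \<Rightarrow> int) \<Rightarrow> 'a) measure"
  define Q where "Q m h \<longleftrightarrow> depends_on h (lattice_box s) \<and> (\<forall>x. \<bar>h x\<bar> \<le> 1) \<and>
       (\<integral>x. \<bar>g m x - h x\<bar> \<partial>?\<mu>) \<le> A * exp (- a * real s)" for m h
  have "\<forall>m\<in>{..<k}. \<exists>h. Q m h" using g unfolding quasi_local_def Q_def by auto
  from bchoice[OF this] obtain h where h: "\<And>m. m < k \<Longrightarrow> Q m (h m)" by auto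
  have hd: "depends_on (h m) (lattice_box s)" "\<bar>h m x\<bar> \<le> 1"
    "(\<integral>x. \<bar>g m x - h m x\<bar> \<partial>?\<mu>) \<le> A * exp (- a * real s)" if "m < k" for m x
    using h[OF that] by (auto simp: Q_def)
  have gm: "g m \<in> borel_measurable ?\<mu>" "\<bar>g m x\<bar> \<le> 1" if "m < k" for m x
    using g[OF that] by (auto simp: quasi_local_def)
  have hm: "h m \<in> borel_measurable ?\<mu>" if "m < k" for m
    by (rule measurable_local[OF hd(1)[OF that]]) simp
  have "\<bar>(\<integral>x. f x * (\<Prod>m\<in>S. g m (zshift (\<tau> m) x)) \<partial>?\<mu>) - (\<integral>x. f x * (\<Prod>m\<in>S. h m (zshift (\<tau> m) x)) \<partial>?\<mu>)\<bar>
      \<le> real k * (A * exp (- a * real s))"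
    if S: "S \<subseteq> {..<k}" and f: "f \<in> borel_measurable ?\<mu>" "\<And>x. \<bar>f x\<bar> \<le> 1" for S \<tau> f
  proof -
    define P where "P x = (\<Prod>m\<in>S. g m (zshift (\<tau> m) x))" for x
    define R where "R x = (\<Prod>m\<in>S. h m (zshift (\<tau> m) x))" for x
    have lt: "m < k" if "m \<in> S" for m using S that by auto
    have P: "P \<in> borel_measurable ?\<mu>" "\<bar>P x\<bar> \<le> 1" for x
      unfolding P_def using gm lt
      by (auto intro!: borel_measurable_prod borel_measurable_zshift abs_prod_le_1)
    have R: "R \<in> borel_measurable ?\<mu>" "\<bar>R x\<bar> \<le> 1" for x
      unfolding R_def using hm hd(2) lt
      by (auto intro!: borel_measurable_prod borel_measurable_zshift abs_prod_le_1)
    have mult1: "\<bar>f x * y\<bar> \<le> 1" if "\<bar>y\<bar> \<le> 1" for x y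
      using mult_mono[OF f(2)[of x] that] by (simp add: abs_mult)
    have "(\<integral>x. f x * P x \<partial>?\<mu>) - (\<integral>x. f x * R x \<partial>?\<mu>) = (\<integral>x. f x * P x - f x * R x \<partial>?\<mu>)"
      by (rule Bochner_Integration.integral_diff[symmetric]; rule integrable_bounded[of _ _ 1])
         (use f(1) P R mult1 in \<open>auto intro!: borel_measurable_times\<close>)
    also have "\<bar>\<dots>\<bar> \<le> (\<integral>x. \<bar>f x * P x - f x * R x\<bar> \<partial>?\<mu>)"
      using integral_norm_bound[of ?\<mu> "\<lambda>x. f x * P x - f x * R x"] by simp
    also have "\<dots> \<le> (\<integral>x. (\<Sum>m\<in>S. \<bar>g m (zshift (\<tau> m) x) - h m (zshift (\<tau> m) x)\<bar>) \<partial>?\<mu>)"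
    proof (rule integral_mono)
      show "integrable ?\<mu> (\<lambda>x. \<bar>f x * P x - f x * R x\<bar>)"
      proof (rule integrable_abs, rule integrable_bounded[of _ _ 2])
        show "(\<lambda>x. f x * P x - f x * R x) \<in> borel_measurable ?\<mu>"
          using f(1) P(1) R(1) by measurable
        show "\<bar>f x * P x - f x * R x\<bar> \<le> 2" for x using mult1[OF P(2), of x x] mult1[OF R(2), of x x] by linarith
      qed
      show "integrable ?\<mu> (\<lambda>x. \<Sum>m\<in>S. \<bar>g m (zshift (\<tau> m) x) - h m (zshift (\<tau> m) x)\<bar>)"
      proof (intro Bochner_Integration.integrable_sum integrable_abs integrable_bounded[of _ _ 2])
        fix m assume "m \<in> S"
        then have m: "m < k" by (rule lt)
        show "(\<lambda>x. g m (zshift (\<tau> m) x) - h m (zshift (\<tau> m) x)) \<in> borel_measurable ?\<mu>"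
          by (intro borel_measurable_diff borel_measurable_zshift gm(1)[OF m] hm[OF m])
        show "\<bar>g m (zshift (\<tau> m) x) - h m (zshift (\<tau> m) x)\<bar> \<le> 2" for x
          using gm(2)[OF m, of "zshift (\<tau> m) x"] hd(2)[OF m, of "zshift (\<tau> m) x"] by linarith
      qed
      fix x
      have "\<bar>f x * P x - f x * R x\<bar> = \<bar>f x\<bar> * \<bar>P x - R x\<bar>" by (simp add: abs_mult right_diff_distrib[symmetric])
      also have "\<dots> \<le> \<bar>P x - R x\<bar>" using f(2)[of x] by (intro mult_left_le_one_le) auto
      also have "\<dots> \<le> (\<Sum>m\<in>S. \<bar>g m (zshift (\<tau> m) x) - h m (zshift (\<tau> m) x)\<bar>)"
        unfolding P_def R_def by (rule abs_prod_diff_le) (use gm(2) hd(2) lt in auto)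
      finally show "\<bar>f x * P x - f x * R x\<bar> \<le> (\<Sum>m\<in>S. \<bar>g m (zshift (\<tau> m) x) - h m (zshift (\<tau> m) x)\<bar>)" .
    qed
    also have "\<dots> = (\<Sum>m\<in>S. \<integral>x. \<bar>g m (zshift (\<tau> m) x) - h m (zshift (\<tau> m) x)\<bar> \<partial>?\<mu>)"
    proof (intro Bochner_Integration.integral_sum integrable_abs integrable_bounded[of _ _ 2])
      fix m assume "m \<in> S"
      then have m: "m < k" by (rule lt)
      show "(\<lambda>x. g m (zshift (\<tau> m) x) - h m (zshift (\<tau> m) x)) \<in> borel_measurable ?\<mu>"
        by (intro borel_measurable_diff borel_measurable_zshift gm(1)[OF m] hm[OF m])
      show "\<bar>g m (zshift (\<tau> m) x) - h m (zshift (\<tau> m) x)\<bar> \<le> 2" for x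
        using gm(2)[OF m, of "zshift (\<tau> m) x"] hd(2)[OF m, of "zshift (\<tau> m) x"] by linarith
    qed
    also have "\<dots> \<le> (\<Sum>m\<in>S. A * exp (- a * real s))"
    proof (rule sum_mono)
      fix m assume "m \<in> S"
      then have m: "m < k" by (rule lt)
      have "(\<integral>x. \<bar>g m (zshift (\<tau> m) x) - h m (zshift (\<tau> m) x)\<bar> \<partial>?\<mu>) = (\<integral>x. \<bar>g m x - h m x\<bar> \<partial>?\<mu>)"
        by (rule integral_zshift) (intro borel_measurable_abs borel_measurable_diff gm(1)[OF m] hm[OF m])
      then show "(\<integral>x. \<bar>g m (zshift (\<tau> m) x) - h m (zshift (\<tau> m) x)\<bar> \<partial>?\<mu>) \<le> A * exp (- a * real s)"
        using hd(3)[OF m] by simp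
    qed
    also have "\<dots> \<le> real k * (A * exp (- a * real s))"
    proof (cases "k = 0")
      case False
      \<comment> \<open>The sign of \<open>A\<close> is read off from the approximation of the field
        with index 0, whose L1 error is nonnegative.\<close>
      then have "0 \<le> A * exp (- a * real s)"
        using order_trans[OF integral_nonneg_AE hd(3)[of 0]] by auto
      moreover have "card S \<le> k" using card_mono[OF _ S] by simp
      ultimately show ?thesis by (simp add: mult_right_mono)
    qed (use S in simp)
    finally show ?thesis unfolding P_def R_def .
  qed
  then show ?thesis using that[of h] hd(1,2) by blast
qed

lemma field_moment_split:
  fixes h :: "nat \<Rightarrow> (('d::finite \<Rightarrow> int) \<Rightarrow> 'a::finite) \<Rightarrow> real"
  assumes h: "\<And>m. m \<in> X \<union> Y \<Longrightarrow> depends_on (h m) (lattice_box s)"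
    and fin: "finite X" "finite Y" and XY: "X \<inter> Y = {}" and S: "S \<subseteq> X \<union> Y"
    and far: "\<And>m n. m \<in> X \<Longrightarrow> n \<in> Y \<Longrightarrow> \<exists>i. \<bar>\<tau> m i - \<tau> n i\<bar> > int (2 * s)"
  shows "field_moment p h \<tau> S = field_moment p h \<tau> (S \<inter> X) * field_moment p h \<tau> (S \<inter> Y)"
proof -
  define W where "W m = translate (\<tau> m) (lattice_box s)" for m
  have dep: "depends_on (\<lambda>x. h m (zshift (\<tau> m) x)) (W m)" if "m \<in> X \<union> Y" for m
    unfolding W_def by (rule depends_on_zshift[OF h[OF that]])
  have "W m \<inter> W n = {}" if mn: "m \<in> X" "n \<in> Y" for m n
  proof (rule equals0I)
    fix j assume "j \<in> W m \<inter> W n"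
    then have j: "\<bar>j i - \<tau> m i\<bar> \<le> int s" "\<bar>j i - \<tau> n i\<bar> \<le> int s" for i
      by (auto simp: W_def translate_lattice_box)
    obtain i where "\<bar>\<tau> m i - \<tau> n i\<bar> > int (2 * s)" using far[OF mn] by auto
    then show False using j[of i] by linarith
  qed
  then have disj: "(\<Union>m\<in>S \<inter> X. W m) \<inter> (\<Union>m\<in>S \<inter> Y. W m) = {}" by blast
  have SXY: "S = (S \<inter> X) \<union> (S \<inter> Y)" "(S \<inter> X) \<inter> (S \<inter> Y) = {}" using S XY by auto
  have "field_moment p h \<tau> S = (\<integral>x. (\<Prod>m\<in>S \<inter> X. h m (zshift (\<tau> m) x)) * (\<Prod>m\<in>S \<inter> Y. h m (zshift (\<tau> m) x)) \<partial>bernoulli_shift p)"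
    unfolding field_moment_def using fin SXY
    by (subst SXY(1)) (subst prod.union_disjoint, auto)
  also have "\<dots> = field_moment p h \<tau> (S \<inter> X) * field_moment p h \<tau> (S \<inter> Y)"
    unfolding field_moment_def
  proof (rule integral_mult_local[OF _ _ _ _ disj])
    show "depends_on (\<lambda>x. \<Prod>m\<in>S \<inter> X. h m (zshift (\<tau> m) x)) (\<Union>m\<in>S \<inter> X. W m)"
      by (rule depends_on_prod) (rule dep, blast)
    show "depends_on (\<lambda>x. \<Prod>m\<in>S \<inter> Y. h m (zshift (\<tau> m) x)) (\<Union>m\<in>S \<inter> Y. W m)"
      by (rule depends_on_prod) (rule dep, blast)
    show "finite (\<Union>m\<in>S \<inter> X. W m)" "finite (\<Union>m\<in>S \<inter> Y. W m)"
      using fin by (auto simp: W_def)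
  qed
  finally show ?thesis .
qed

text \<open>Pigeonhole: stack \<open>k\<close> half-open slabs of width 2t above \<open>z b\<close>.
  If each contained a point, there would be \<open>k\<close> distinct indices below
  \<open>k\<close>, all different from \<open>b\<close>. An empty slab separates the points, with
  \<open>b\<close> below and \<open>a\<close> above.\<close>

lemma exists_gap:
  fixes z :: "nat \<Rightarrow> int"
  assumes ab: "a < k" "b < k" and far: "z a - z b > int (2 * k * t)"
  obtains \<theta> where "z b \<le> \<theta>" "z a > \<theta> + int (2 * t)" "\<And>m. m < k \<Longrightarrow> z m \<le> \<theta> \<or> z m > \<theta> + int (2 * t)"
proof -
  define \<theta> where "\<theta> j = z b + int (2 * t) * int j" for j
  have "\<exists>j<k. \<forall>m<k. z m \<le> \<theta> j \<or> z m > \<theta> j + int (2 * t)"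
  proof (rule ccontr)
    assume "\<not> ?thesis"
    then have "\<forall>j\<in>{..<k}. \<exists>m. m < k \<and> \<theta> j < z m \<and> z m \<le> \<theta> j + int (2 * t)"
      by (metis lessThan_iff not_le)
    from bchoice[OF this] obtain f where f: "\<And>j. j < k \<Longrightarrow> f j < k"
        "\<And>j. j < k \<Longrightarrow> \<theta> j < z (f j)" "\<And>j. j < k \<Longrightarrow> z (f j) \<le> \<theta> j + int (2 * t)" by auto
    have less: "z (f i) < z (f j)" if "i < j" "j < k" for i j
    proof -
      have "int (2 * t) * (int i + 1) \<le> int (2 * t) * int j" using that by (intro mult_left_mono) auto
      then have "\<theta> i + int (2 * t) \<le> \<theta> j" by (simp add: \<theta>_def distrib_left)
      then show ?thesis using f(2)[of j] f(3)[of i] that by linarith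
    qed
    have "inj_on f {..<k}"
    proof (rule inj_onI)
      fix i j assume "i \<in> {..<k}" "j \<in> {..<k}" "f i = f j"
      then show "i = j" using less[of i j] less[of j i] by (cases i j rule: linorder_cases) auto
    qed
    moreover have "f ` {..<k} \<subseteq> {..<k} - {b}"
    proof
      fix m assume "m \<in> f ` {..<k}"
      then obtain j where j: "j < k" "m = f j" by auto
      have "z b \<le> \<theta> j" by (simp add: \<theta>_def)
      then have "m \<noteq> b" using f(2)[OF j(1)] j(2) by auto
      then show "m \<in> {..<k} - {b}" using f(1)[OF j(1)] j(2) by simp
    qed
    ultimately have "card {..<k} \<le> card ({..<k} - {b})" by (intro card_inj_on_le) auto
    then show False using ab by simp
  qed
  then obtain j where j: "j < k" "\<And>m. m < k \<Longrightarrow> z m \<le> \<theta> j \<or> z m > \<theta> j + int (2 * t)" by auto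
  have "int (2 * t) * (int j + 1) \<le> int (2 * t) * int k" using j(1) by (intro mult_left_mono) auto
  then have "\<theta> j + int (2 * t) \<le> z b + int (2 * k * t)" by (simp add: \<theta>_def distrib_left mult_ac)
  then show ?thesis using that[of "\<theta> j"] j(2) far by (simp add: \<theta>_def)
qed

text \<open>Sites of large diameter leave an empty slab of width 2t in some coordinate direction.
  Approximants of radius \<open>t\<close> on its two sides are independent, so their cumulant is 0
  and the true cumulant is pure approximation error. The diameter 2kt is what the pigeonhole
  argument asks for.\<close>

lemma cumulant_decay:
  fixes g :: "nat \<Rightarrow> (('d::finite \<Rightarrow> int) \<Rightarrow> 'a::finite) \<Rightarrow> real"
  assumes g: "\<And>m. m < k \<Longrightarrow> quasi_local p A a (g m)"
    and far: "m < k" "n < k" "(\<lambda>i. \<tau> m i - \<tau> n i) \<notin> lattice_box (2 * k * t)"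
  shows "norm (cumulant k (field_moment p g \<tau>)) \<le> real (k ^ k) * (real k * (real k * (A * exp (- a * real t))))"
proof -
  obtain i where i: "\<bar>\<tau> m i - \<tau> n i\<bar> > int (2 * k * t)" using far(3) by (auto simp: lattice_box_def not_le)
  have "\<exists>m' n'. m' < k \<and> n' < k \<and> \<tau> m' i - \<tau> n' i > int (2 * k * t)"
    using i far(1,2) by (cases "\<tau> m i \<ge> \<tau> n i") force+
  then obtain m' n' where mn: "m' < k" "n' < k" "\<tau> m' i - \<tau> n' i > int (2 * k * t)" by auto
  obtain \<theta> where \<theta>: "\<tau> n' i \<le> \<theta>" "\<tau> m' i > \<theta> + int (2 * t)"
      "\<And>j. j < k \<Longrightarrow> \<tau> j i \<le> \<theta> \<or> \<tau> j i > \<theta> + int (2 * t)"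
    using exists_gap[of m' k n' t "\<lambda>j. \<tau> j i"] mn by blast
  define X where "X = {j\<in>{..<k}. \<tau> j i \<le> \<theta>}"
  define Y where "Y = {j\<in>{..<k}. \<tau> j i > \<theta> + int (2 * t)}"
  have XY: "X \<union> Y = {..<k}" "X \<inter> Y = {}" "X \<noteq> {}" "Y \<noteq> {}"
    using \<theta> mn unfolding X_def Y_def by (auto dest: \<theta>(3))
  obtain h where h: "\<And>m. m < k \<Longrightarrow> depends_on (h m) (lattice_box t)" "\<And>m x. m < k \<Longrightarrow> \<bar>h m x\<bar> \<le> 1"
    and approx: "\<And>S \<tau> f. S \<subseteq> {..<k} \<Longrightarrow> f \<in> borel_measurable (bernoulli_shift p) \<Longrightarrow> (\<And>x. \<bar>f x\<bar> \<le> 1) \<Longrightarrow>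
      \<bar>(\<integral>x. f x * (\<Prod>m\<in>S. g m (zshift (\<tau> m) x)) \<partial>bernoulli_shift p)
        - (\<integral>x. f x * (\<Prod>m\<in>S. h m (zshift (\<tau> m) x)) \<partial>bernoulli_shift p)\<bar> \<le> real k * (A * exp (- a * real t))"
    using quasi_local_approx[of k p A a g t] g by blast
  have "cumulant k (field_moment p h \<tau>) = 0"
  proof (rule cumulant_eq_0_if_splits[OF XY])
    fix S assume S: "S \<subseteq> {..<k}"
    show "field_moment p h \<tau> S = field_moment p h \<tau> (S \<inter> X) * field_moment p h \<tau> (S \<inter> Y)"
    proof (rule field_moment_split[of X Y h t])
      show "depends_on (h j) (lattice_box t)" if "j \<in> X \<union> Y" for j using h(1) that XY(1) by auto
      show "finite X" "finite Y" by (simp_all add: X_def Y_def)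
      show "X \<inter> Y = {}" by fact
      show "S \<subseteq> X \<union> Y" using S XY(1) by simp
      fix j j' assume "j \<in> X" "j' \<in> Y"
      then have "\<bar>\<tau> j i - \<tau> j' i\<bar> > int (2 * t)" by (auto simp: X_def Y_def)
      then show "\<exists>i. \<bar>\<tau> j i - \<tau> j' i\<bar> > int (2 * t)" by blast
    qed
  qed
  moreover have "norm (cumulant k (field_moment p g \<tau>) - cumulant k (field_moment p h \<tau>))
    \<le> real (k ^ k) * (real k * (real k * (A * exp (- a * real t))))"
  proof (rule cumulant_diff_le)
    fix S assume S: "S \<subseteq> {..<k}"
    show "\<bar>field_moment p g \<tau> S\<bar> \<le> 1"
      by (rule abs_field_moment_le_1) (use g S in \<open>auto simp: quasi_local_def\<close>)
    show "\<bar>field_moment p h \<tau> S\<bar> \<le> 1"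
      by (rule abs_field_moment_le_1) (use h S in \<open>auto intro!: measurable_local\<close>)
    show "\<bar>field_moment p g \<tau> S - field_moment p h \<tau> S\<bar> \<le> real k * (A * exp (- a * real t))"
      using approx[OF S, of "\<lambda>_. 1" \<tau>] by (simp add: field_moment_def)
  qed
  ultimately show ?thesis by simp
qed

section \<open>Truncated sums of cumulants over configurations of sites\<close>

definition clusters :: "nat \<Rightarrow> nat \<Rightarrow> nat \<Rightarrow> (nat \<Rightarrow> 'd::finite \<Rightarrow> int) set" where
  "clusters k r pin = {\<tau> \<in> PiE {..<k} (\<lambda>_. UNIV). \<tau> pin = (\<lambda>_. 0) \<and>
     (\<forall>m<k. \<forall>n<k. (\<lambda>i. \<tau> m i - \<tau> n i) \<in> lattice_box r)}"

text \<open>No infinite series over configurations is formed; the truncation \<open>r\<close> tends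
  to infinity along multiples of 2k.\<close>

definition cluster_sum :: "'a pmf \<Rightarrow> nat \<Rightarrow> nat \<Rightarrow> nat \<Rightarrow> (nat \<Rightarrow> (('d::finite \<Rightarrow> int) \<Rightarrow> 'a) \<Rightarrow> real) \<Rightarrow> complex" where
  "cluster_sum p k r pin g = (\<Sum>\<tau>\<in>clusters k r pin. cumulant k (field_moment p g \<tau>))"

text \<open>Each configuration is recentred at the newly fixed entry. The truncation bounds mutual
  differences rather than distances from the origin, so it is translation invariant and recentring
  is an exact bijection.\<close>

lemma cluster_sum_repin:
  fixes g :: "nat \<Rightarrow> (('d::finite \<Rightarrow> int) \<Rightarrow> 'a::finite) \<Rightarrow> real"
  assumes pin: "pin < k" "pin' < k"
    and g: "\<And>m. m < k \<Longrightarrow> g m \<in> borel_measurable (bernoulli_shift p)"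
  shows "cluster_sum p k r pin g = cluster_sum p k r pin' g"
proof -
  define R where "R n \<tau> = (\<lambda>m\<in>{..<k}. \<lambda>i. \<tau> m i - \<tau> n i)" for n and \<tau> :: "nat \<Rightarrow> 'd \<Rightarrow> int"
  have R1: "R n \<tau> \<in> clusters k r n" if "n < k" "\<tau> \<in> clusters k r n'" for n n' \<tau>
    using that unfolding clusters_def R_def by auto
  have R2: "R n (R n' \<tau>) = \<tau>" if "\<tau> \<in> clusters k r n" "n < k" "n' < k" for n n' \<tau>
  proof (rule ext)
    fix m
    have "\<tau> n = (\<lambda>_. 0)" and e: "\<tau> \<in> extensional {..<k}" using that(1) by (auto simp: clusters_def PiE_iff)
    then show "R n (R n' \<tau>) m = \<tau> m"
      using that(2,3) by (cases "m < k") (auto simp: R_def extensional_def fun_eq_iff)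
  qed
  show ?thesis
    unfolding cluster_sum_def
  proof (rule sum.reindex_bij_witness[where j = "R pin'" and i = "R pin"])
    fix \<tau> :: "nat \<Rightarrow> 'd \<Rightarrow> int" assume t: "\<tau> \<in> clusters k r pin"
    show "R pin (R pin' \<tau>) = \<tau>" using R2[OF t pin] .
    show "R pin' \<tau> \<in> clusters k r pin'" using R1[OF pin(2) t] .
    show "cumulant k (field_moment p g (R pin' \<tau>)) = cumulant k (field_moment p g \<tau>)"
    proof (rule cumulant_cong)
      fix S assume S: "S \<subseteq> {..<k}"
      have "field_moment p g (R pin' \<tau>) S = field_moment p g (\<lambda>m i. \<tau> m i + - \<tau> pin' i) S"
        by (rule field_moment_cong) (use S in \<open>auto simp: R_def\<close>)
      also have "\<dots> = field_moment p g \<tau> S"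
        by (rule field_moment_translate) (use S g in auto)
      finally show "field_moment p g (R pin' \<tau>) S = field_moment p g \<tau> S" .
    qed
  next
    fix \<tau> :: "nat \<Rightarrow> 'd \<Rightarrow> int" assume t: "\<tau> \<in> clusters k r pin'"
    show "R pin' (R pin \<tau>) = \<tau>" using R2[OF t pin(2,1)] .
    show "R pin \<tau> \<in> clusters k r pin" using R1[OF pin(1) t] .
  qed
qed

lemma clusters_subset:
  assumes "pin < k"
  shows "clusters k r pin \<subseteq> PiE {..<k} (\<lambda>_. lattice_box r)"
proof
  fix \<tau> :: "nat \<Rightarrow> 'a \<Rightarrow> int" assume "\<tau> \<in> clusters k r pin"
  then have t: "\<tau> \<in> PiE {..<k} (\<lambda>_. UNIV)" "\<tau> pin = (\<lambda>_. 0)"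
    "\<And>m. m < k \<Longrightarrow> (\<lambda>i. \<tau> m i - \<tau> pin i) \<in> lattice_box r" using assms unfolding clusters_def by blast+
  have "\<tau> m \<in> lattice_box r" if "m < k" for m using t(3)[OF that] by (simp add: t(2))
  then show "\<tau> \<in> PiE {..<k} (\<lambda>_. lattice_box r)" using t(1) by (auto simp: PiE_iff)
qed

lemma finite_clusters: "pin < k \<Longrightarrow> finite (clusters k r pin)"
  by (rule finite_subset[OF clusters_subset]) (auto intro!: finite_PiE)

text \<open>Unless all sites are at the origin, those at the origin and the others form two
  independent groups and the cumulant vanishes. A single term survives, whatever the
  truncation.\<close>

lemma cluster_sum_iid:
  fixes p :: "'a::finite pmf" and f :: "'a \<Rightarrow> real"
  assumes "0 < k"
  shows "cluster_sum p k r 0 (\<lambda>_ (x :: ('d::finite \<Rightarrow> int) \<Rightarrow> 'a). f (x (\<lambda>_. 0)))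
    = cumulant k (\<lambda>S. \<Sum>a\<in>UNIV. pmf p a * f a ^ card S)"
proof -
  define g where "g = (\<lambda>(_::nat) (x :: ('d \<Rightarrow> int) \<Rightarrow> 'a). f (x (\<lambda>_. 0)))"
  define \<tau>0 where "\<tau>0 = (\<lambda>m\<in>{..<k}. \<lambda>_::'d. 0::int)"
  have box0: "lattice_box 0 = {\<lambda>_::'d. 0::int}" by (auto simp: lattice_box_def fun_eq_iff)
  have dep: "depends_on (g m) (lattice_box 0)" for m
    unfolding g_def box0 by (simp add: depends_on_def)
  have "cluster_sum p k r 0 g = (\<Sum>\<tau>\<in>{\<tau>0}. cumulant k (field_moment p g \<tau>))"
    unfolding cluster_sum_def
  proof (rule sum.mono_neutral_right)
    show "finite (clusters k r 0 :: (nat \<Rightarrow> 'd \<Rightarrow> int) set)" using assms by (rule finite_clusters)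
    show "{\<tau>0} \<subseteq> clusters k r 0" using assms by (auto simp: clusters_def \<tau>0_def lattice_box_def)
    show "\<forall>\<tau>\<in>clusters k r 0 - {\<tau>0}. cumulant k (field_moment p g \<tau>) = 0"
    proof
      fix \<tau> :: "nat \<Rightarrow> 'd \<Rightarrow> int" assume t: "\<tau> \<in> clusters k r 0 - {\<tau>0}"
      define X where "X = {m\<in>{..<k}. \<tau> m = (\<lambda>_. 0)}"
      define Y where "Y = {m\<in>{..<k}. \<tau> m \<noteq> (\<lambda>_. 0)}"
      have "0 \<in> X" using t assms by (auto simp: X_def clusters_def)
      moreover have "Y \<noteq> {}"
      proof
        assume "Y = {}"
        then have "\<tau> = \<tau>0" using t by (auto simp: Y_def \<tau>0_def clusters_def PiE_iff extensional_def fun_eq_iff)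
        then show False using t by simp
      qed
      moreover have XY: "X \<union> Y = {..<k}" "X \<inter> Y = {}" by (auto simp: X_def Y_def)
      ultimately show "cumulant k (field_moment p g \<tau>) = 0"
      proof (intro cumulant_eq_0_if_splits[of X Y])
        fix S assume S: "S \<subseteq> {..<k}"
        show "field_moment p g \<tau> S = field_moment p g \<tau> (S \<inter> X) * field_moment p g \<tau> (S \<inter> Y)"
        proof (rule field_moment_split[of X Y g 0])
          show "S \<subseteq> X \<union> Y" using S XY(1) by simp
          fix m n assume "m \<in> X" "n \<in> Y"
          then show "\<exists>i. \<bar>\<tau> m i - \<tau> n i\<bar> > int (2 * 0)" by (auto simp: X_def Y_def fun_eq_iff)
        qed (auto simp: X_def Y_def dep)
      qed auto
    qed
  qed
  also have "\<dots> = cumulant k (field_moment p g \<tau>0)" by simp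
  also have "\<dots> = cumulant k (\<lambda>S. \<Sum>a\<in>UNIV. pmf p a * f a ^ card S)"
  proof (rule cumulant_cong)
    fix S assume S: "S \<subseteq> {..<k}"
    have "(\<Prod>m\<in>S. g m (zshift (\<tau>0 m) x)) = f (x (\<lambda>_. 0)) ^ card S" for x
    proof -
      have "(\<Prod>m\<in>S. g m (zshift (\<tau>0 m) x)) = (\<Prod>m\<in>S. f (x (\<lambda>_. 0)))"
        by (rule prod.cong) (use S in \<open>auto simp: g_def \<tau>0_def zshift_def\<close>)
      then show ?thesis by simp
    qed
    then have "field_moment p g \<tau>0 S = (\<integral>x. f (x (\<lambda>_. 0)) ^ card S \<partial>(bernoulli_shift p :: (('d \<Rightarrow> int) \<Rightarrow> 'a) measure))"
      unfolding field_moment_def by (simp only:)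
    also have "\<dots> = (\<Sum>a\<in>UNIV. pmf p a * f a ^ card S)" by (rule integral_coordinate)
    finally show "field_moment p g \<tau>0 S = (\<Sum>a\<in>UNIV. pmf p a * f a ^ card S)" .
  qed
  finally show ?thesis unfolding g_def .
qed

text \<open>The configurations are enlarged to a product set, in which the position of entry
  \<open>m\<close> runs over a full box whatever the other positions are. The added configurations
  have diameter above \<open>r\<close> and are controlled by \<open>cumulant_decay\<close>; the full
  sum over the position of \<open>m\<close> is controlled by the correlation bound
  \<open>resp\<close>. The powers of \<open>6 * r + 1\<close> are crude counts.\<close>

lemma cluster_sum_le:
  fixes g :: "nat \<Rightarrow> (('d::finite \<Rightarrow> int) \<Rightarrow> 'a::finite) \<Rightarrow> real"
  assumes g: "\<And>m. m < k \<Longrightarrow> quasi_local p A a (g m)"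
    and pos: "m < k" "pin < k" "m \<noteq> pin" and A: "0 \<le> A" and C: "0 \<le> C"
    and resp: "\<And>s G. depends_on G (lattice_box (2 * s)) \<Longrightarrow> (\<And>x. \<bar>G x\<bar> \<le> 1) \<Longrightarrow>
      \<bar>\<Sum>j\<in>lattice_box (3 * s). \<integral>x. G x * g m (zshift j x) \<partial>bernoulli_shift p\<bar> \<le> C * exp (- a' * real s)"
    and r: "r = 2 * k * t"
  shows "norm (cluster_sum p k r pin g) \<le> real ((6 * r + 1) ^ (CARD('d) * k)) *
    (real (k ^ k) * (real k * (real k * (A * exp (- a * real t)))) +
     real (k ^ k) * (C * exp (- a' * real r) + real ((6 * r + 1) ^ CARD('d)) * (real k * (A * exp (- a * real r)))))"
proof -
  let ?\<mu> = "bernoulli_shift p :: (('d \<Rightarrow> int) \<Rightarrow> 'a) measure"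
  define \<delta>1 where "\<delta>1 = real (k ^ k) * (real k * (real k * (A * exp (- a * real t))))"
  define \<delta>2 where "\<delta>2 = C * exp (- a' * real r) + real ((6 * r + 1) ^ CARD('d)) * (real k * (A * exp (- a * real r)))"
  \<comment> \<open>The other entries lie within radius \<open>r\<close> and their approximants have
    radius \<open>r\<close>, so a product of these lives in radius 2r; \<open>resp\<close> at scale
    \<open>r\<close> then asks for \<open>m\<close> to range over radius 3r.\<close>
  define F where "F j = (if j = pin then {\<lambda>_. 0} else if j = m then lattice_box (3 * r) else lattice_box r :: ('d \<Rightarrow> int) set)" for j
  define P where "P = PiE {..<k} F"
  define I where "I = {..<k} - {m}"
  define f where "f \<tau> = cumulant k (field_moment p g \<tau>)" for \<tau>
  have F: "finite (F j)" "card (F j) \<le> (6 * r + 1) ^ CARD('d)" for j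
    by (auto simp: F_def card_lattice_box intro!: power_mono)
  have finP: "finite P" unfolding P_def by (intro finite_PiE F) simp
  have cardPiE: "card (PiE J F) \<le> (6 * r + 1) ^ (CARD('d) * k)" if "J \<subseteq> {..<k}" for J
  proof -
    have "card (PiE J F) = (\<Prod>j\<in>J. card (F j))" using that by (intro card_PiE) (auto intro: finite_subset)
    also have "\<dots> \<le> (\<Prod>j\<in>J. (6 * r + 1) ^ CARD('d))" using F(2) by (intro prod_mono) (auto simp del: One_nat_def add_Suc_right)
    also have "\<dots> = (6 * r + 1) ^ (CARD('d) * card J)" by (simp add: power_mult)
    also have "\<dots> \<le> (6 * r + 1) ^ (CARD('d) * k)"
      using card_mono[OF _ that] by (intro power_increasing) auto
    finally show ?thesis .
  qed
  have \<delta>1: "0 \<le> \<delta>1" unfolding \<delta>1_def using A by simp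
  have \<delta>2: "0 \<le> \<delta>2" unfolding \<delta>2_def using A C by simp
  have sub: "clusters k r pin \<subseteq> P"
  proof
    fix \<tau> :: "nat \<Rightarrow> 'd \<Rightarrow> int" assume t: "\<tau> \<in> clusters k r pin"
    then have "\<tau> \<in> PiE {..<k} (\<lambda>_. lattice_box r)" "\<tau> pin = (\<lambda>_. 0)"
      using clusters_subset[OF pos(2)] by (auto simp: clusters_def)
    moreover have "lattice_box r \<subseteq> (lattice_box (3 * r) :: ('d \<Rightarrow> int) set)" by (rule lattice_box_mono) simp
    ultimately show "\<tau> \<in> P" unfolding P_def F_def by (auto simp: PiE_iff)
  qed
  have split: "cluster_sum p k r pin g = (\<Sum>\<tau>\<in>P. f \<tau>) - (\<Sum>\<tau>\<in>P - clusters k r pin. f \<tau>)"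
    unfolding cluster_sum_def f_def using sum.subset_diff[OF sub finP, of "\<lambda>\<tau>. cumulant k (field_moment p g \<tau>)"] by simp
  have part1: "norm (\<Sum>\<tau>\<in>P - clusters k r pin. f \<tau>) \<le> real ((6 * r + 1) ^ (CARD('d) * k)) * \<delta>1"
  proof -
    have "norm (\<Sum>\<tau>\<in>P - clusters k r pin. f \<tau>) \<le> (\<Sum>\<tau>\<in>P - clusters k r pin. \<delta>1)"
    proof (rule sum_norm_le)
      fix \<tau> assume t: "\<tau> \<in> P - clusters k r pin"
      then have "\<tau> pin \<in> F pin" "\<tau> \<in> PiE {..<k} (\<lambda>_. UNIV)"
        using pos(2) by (auto simp: P_def PiE_iff)
      then have "\<tau> pin = (\<lambda>_. 0)" "\<tau> \<in> PiE {..<k} (\<lambda>_. UNIV)" by (auto simp: F_def)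
      then obtain j j' where "j < k" "j' < k" "(\<lambda>i. \<tau> j i - \<tau> j' i) \<notin> lattice_box r"
        using t by (auto simp: clusters_def)
      then show "norm (f \<tau>) \<le> \<delta>1"
        unfolding f_def \<delta>1_def r by (intro cumulant_decay g)
    qed
    also have "\<dots> = real (card (P - clusters k r pin)) * \<delta>1" by simp
    also have "\<dots> \<le> real ((6 * r + 1) ^ (CARD('d) * k)) * \<delta>1"
    proof (intro mult_right_mono \<delta>1)
      have "card (P - clusters k r pin) \<le> card P" using finP by (intro card_mono) auto
      also have "\<dots> \<le> (6 * r + 1) ^ (CARD('d) * k)" unfolding P_def by (rule cardPiE) simp
      finally show "real (card (P - clusters k r pin)) \<le> real ((6 * r + 1) ^ (CARD('d) * k))"
        by (simp only: of_nat_le_iff)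
    qed
    finally show ?thesis .
  qed
  have I: "I \<inter> {m} = {}" "I \<union> {m} = {..<k}" using pos by (auto simp: I_def)
  have "(\<Sum>\<tau>\<in>P. f \<tau>) = (\<Sum>(\<tau>, b)\<in>PiE I F \<times> PiE {m} F. f (\<lambda>i. if i \<in> I then \<tau> i else b i))"
    unfolding P_def I(2)[symmetric] by (rule sum_PiE_Un_disjoint[OF I(1)])
  also have "\<dots> = (\<Sum>\<tau>\<in>PiE I F. \<Sum>b\<in>PiE {m} F. f (\<lambda>i. if i \<in> I then \<tau> i else b i))"
    by (simp add: sum.cartesian_product)
  also have "\<dots> = (\<Sum>\<tau>\<in>PiE I F. \<Sum>j\<in>lattice_box (3 * r). f (\<tau>(m := j)))"
  proof (rule sum.cong[OF refl])
    fix \<tau> assume t: "\<tau> \<in> PiE I F"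
    have Fm: "F m = lattice_box (3 * r)" using pos(3) by (simp add: F_def)
    show "(\<Sum>b\<in>PiE {m} F. f (\<lambda>i. if i \<in> I then \<tau> i else b i)) = (\<Sum>j\<in>lattice_box (3 * r). f (\<tau>(m := j)))"
    proof (rule sum.reindex_bij_witness[where j = "\<lambda>b. b m" and i = "\<lambda>j. \<lambda>i\<in>{m}. j"])
      fix b assume b: "b \<in> PiE {m} F"
      show "restrict (\<lambda>i. b m) {m} = b" using b by (auto simp: fun_eq_iff PiE_iff extensional_def)
      show "b m \<in> lattice_box (3 * r)" using b Fm by (auto simp: PiE_iff)
      have "(\<lambda>i. if i \<in> I then \<tau> i else b i) = \<tau>(m := b m)"
      proof
        fix i show "(if i \<in> I then \<tau> i else b i) = (\<tau>(m := b m)) i"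
          using t b I(1) by (cases "i \<in> I"; cases "i = m") (auto simp: PiE_iff extensional_def)
      qed
      then show "f (\<tau>(m := b m)) = f (\<lambda>i. if i \<in> I then \<tau> i else b i)" by simp
    qed (auto simp: Fm)
  qed
  also have "norm \<dots> \<le> (\<Sum>\<tau>\<in>PiE I F. real (k ^ k) * \<delta>2)"
  proof (rule sum_norm_le)
    fix \<tau> assume t: "\<tau> \<in> PiE I F"
    have t_box: "\<tau> j \<in> lattice_box r" if "j < k" "j \<noteq> m" for j
    proof -
      have "\<tau> j \<in> F j" using t that by (auto simp: I_def PiE_iff)
      then show ?thesis using that(2) by (cases "j = pin") (simp_all add: F_def zero_in_lattice_box)
    qed
    obtain h where h: "\<And>m. m < k \<Longrightarrow> depends_on (h m) (lattice_box r)" "\<And>m x. m < k \<Longrightarrow> \<bar>h m x\<bar> \<le> 1"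
      and approx: "\<And>S \<tau> f. S \<subseteq> {..<k} \<Longrightarrow> f \<in> borel_measurable ?\<mu> \<Longrightarrow> (\<And>x. \<bar>f x\<bar> \<le> 1) \<Longrightarrow>
        \<bar>(\<integral>x. f x * (\<Prod>m\<in>S. g m (zshift (\<tau> m) x)) \<partial>?\<mu>)
          - (\<integral>x. f x * (\<Prod>m\<in>S. h m (zshift (\<tau> m) x)) \<partial>?\<mu>)\<bar> \<le> real k * (A * exp (- a * real r))"
      using quasi_local_approx[of k p A a g r] g by blast
    show "norm (\<Sum>j\<in>lattice_box (3 * r). f (\<tau>(m := j))) \<le> real (k ^ k) * \<delta>2"
      unfolding f_def
    proof (rule norm_sum_cumulant_le[OF pos(1), where ?M0.0 = "field_moment p g \<tau>"])
      show "finite (lattice_box (3 * r) :: ('d \<Rightarrow> int) set)" by simp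
      show "field_moment p g (\<tau>(m := j)) S = field_moment p g \<tau> S" if "m \<notin> S" for j S
        by (rule field_moment_cong) (use that in auto)
      show "\<bar>field_moment p g \<tau> S\<bar> \<le> 1" if "S \<subseteq> {..<k}" for S
        by (rule abs_field_moment_le_1) (use g that in \<open>auto simp: quasi_local_def\<close>)
      fix S assume S: "S \<subseteq> {..<k}" "m \<in> S"
      \<comment> \<open>In the replica containing \<open>m\<close>, the remaining fields are made
        local and form the observable \<open>H\<close> tested against the field \<open>m\<close>,
        which stays exact.\<close>
      define S' where "S' = S - {m}"
      have S': "S' \<subseteq> {..<k}" "\<And>j. j \<in> S' \<Longrightarrow> j < k \<and> j \<noteq> m" using S by (auto simp: S'_def)
      define H where "H x = (\<Prod>n\<in>S'. h n (zshift (\<tau> n) x))" for x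
      have H1: "\<bar>H x\<bar> \<le> 1" for x
        unfolding H_def by (rule abs_prod_le_1) (use S' h(2) in auto)
      have "depends_on H (\<Union>n\<in>S'. translate (\<tau> n) (lattice_box r))"
        unfolding H_def by (rule depends_on_prod) (use S' h(1) in \<open>auto intro: depends_on_zshift\<close>)
      moreover have "(\<Union>n\<in>S'. translate (\<tau> n) (lattice_box r)) \<subseteq> lattice_box (2 * r)"
      proof (rule UN_least)
        fix n assume "n \<in> S'"
        then have "\<tau> n \<in> lattice_box r" using S'(2) t_box by blast
        then show "translate (\<tau> n) (lattice_box r) \<subseteq> lattice_box (2 * r)"
          using translate_subset_box[of "\<tau> n" r r] by (simp add: mult_2)
      qed
      ultimately have H2: "depends_on H (lattice_box (2 * r))" by (rule depends_on_mono)
      have mom: "field_moment p g (\<tau>(m := j)) S = (\<integral>x. g m (zshift j x) * (\<Prod>n\<in>S'. g n (zshift (\<tau> n) x)) \<partial>?\<mu>)" for j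
      proof -
        have fin: "finite S" using S(1) finite_subset by blast
        have rest: "(\<Prod>n\<in>S'. g n (zshift ((\<tau>(m := j)) n) x)) = (\<Prod>n\<in>S'. g n (zshift (\<tau> n) x))" for x
          by (rule prod.cong) (auto simp: S'_def)
        have "(\<Prod>n\<in>S. g n (zshift ((\<tau>(m := j)) n) x)) = g m (zshift j x) * (\<Prod>n\<in>S'. g n (zshift (\<tau> n) x))" for x
          using prod.remove[OF fin S(2), of "\<lambda>n. g n (zshift ((\<tau>(m := j)) n) x)"]
          unfolding S'_def[symmetric] rest by simp
        then show ?thesis unfolding field_moment_def by (simp only:)
      qed
      have gm: "g m \<in> borel_measurable ?\<mu>" "\<bar>g m x\<bar> \<le> 1" for x using g[OF pos(1)] by (auto simp: quasi_local_def)
      have "\<bar>\<Sum>j\<in>lattice_box (3 * r). field_moment p g (\<tau>(m := j)) S\<bar> \<le>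
        \<bar>\<Sum>j\<in>lattice_box (3 * r). \<integral>x. H x * g m (zshift j x) \<partial>?\<mu>\<bar> +
        \<bar>\<Sum>j\<in>lattice_box (3 * r). field_moment p g (\<tau>(m := j)) S - (\<integral>x. H x * g m (zshift j x) \<partial>?\<mu>)\<bar>"
        by (simp add: sum_subtractf)
      also have "\<dots> \<le> C * exp (- a' * real r) + (\<Sum>j\<in>(lattice_box (3 * r) :: ('d \<Rightarrow> int) set). real k * (A * exp (- a * real r)))"
      proof (rule add_mono)
        show "\<bar>\<Sum>j\<in>lattice_box (3 * r). \<integral>x. H x * g m (zshift j x) \<partial>?\<mu>\<bar> \<le> C * exp (- a' * real r)"
          by (rule resp[OF H2 H1])
        show "\<bar>\<Sum>j\<in>lattice_box (3 * r). field_moment p g (\<tau>(m := j)) S - (\<integral>x. H x * g m (zshift j x) \<partial>?\<mu>)\<bar>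
          \<le> (\<Sum>j\<in>(lattice_box (3 * r) :: ('d \<Rightarrow> int) set). real k * (A * exp (- a * real r)))"
        proof (rule order_trans[OF sum_abs], rule sum_mono)
          fix j :: "'d \<Rightarrow> int"
          show "\<bar>field_moment p g (\<tau>(m := j)) S - (\<integral>x. H x * g m (zshift j x) \<partial>?\<mu>)\<bar> \<le> real k * (A * exp (- a * real r))"
            using approx[OF S'(1) borel_measurable_zshift[OF gm(1)], of j \<tau>] gm(2)
            unfolding mom H_def by (simp add: mult.commute)
        qed
      qed
      also have "\<dots> = \<delta>2" by (simp add: \<delta>2_def card_lattice_box)
      finally show "\<bar>\<Sum>j\<in>lattice_box (3 * r). field_moment p g (\<tau>(m := j)) S\<bar> \<le> \<delta>2" .
    qed
  qed
  also have "\<dots> = real (card (PiE I F)) * (real (k ^ k) * \<delta>2)" by simp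
  also have "\<dots> \<le> real ((6 * r + 1) ^ (CARD('d) * k)) * (real (k ^ k) * \<delta>2)"
  proof (rule mult_right_mono)
    show "real (card (PiE I F)) \<le> real ((6 * r + 1) ^ (CARD('d) * k))"
      using cardPiE[of I] by (simp only: of_nat_le_iff I_def Diff_subset)
  qed (use \<delta>2 in simp)
  finally have part2: "norm (\<Sum>\<tau>\<in>P. f \<tau>) \<le> real ((6 * r + 1) ^ (CARD('d) * k)) * (real (k ^ k) * \<delta>2)" .
  have "norm (cluster_sum p k r pin g) \<le> real ((6 * r + 1) ^ (CARD('d) * k)) * (real (k ^ k) * \<delta>2)
     + real ((6 * r + 1) ^ (CARD('d) * k)) * \<delta>1"
    unfolding split by (rule order_trans[OF norm_triangle_ineq4]) (rule add_mono[OF part2 part1])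
  then show ?thesis unfolding \<delta>1_def \<delta>2_def by (simp only: distrib_left add.commute)
qed

text \<open>\<open>r\<close> is linear in \<open>t\<close>, so the polynomial counts in
  \<open>r\<close> lose to the exponentials in \<open>t\<close>.\<close>

lemma cluster_sum_tendsto_0:
  fixes g :: "nat \<Rightarrow> (('d::finite \<Rightarrow> int) \<Rightarrow> 'a::finite) \<Rightarrow> real"
  assumes g: "\<And>m. m < k \<Longrightarrow> quasi_local p A a (g m)"
    and pos: "m < k" "pin < k" "m \<noteq> pin" and A: "0 \<le> A" and C: "0 \<le> C" and a: "0 < a" "0 < a'"
    and resp: "\<And>s G. depends_on G (lattice_box (2 * s)) \<Longrightarrow> (\<And>x. \<bar>G x\<bar> \<le> 1) \<Longrightarrow>
      \<bar>\<Sum>j\<in>lattice_box (3 * s). \<integral>x. G x * g m (zshift j x) \<partial>bernoulli_shift p\<bar> \<le> C * exp (- a' * real s)"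
  shows "(\<lambda>t. cluster_sum p k (2 * k * t) pin g) \<longlonglongrightarrow> 0"
proof -
  define d where "d = CARD('d)"
  define b where "b = min a a'"
  define D where "D = real (k ^ k) * (real k * (real k * A) + C + real k * A)"
  \<comment> \<open>With \<open>r = 2 * k * t\<close> the exponent \<open>b * t\<close> equals
    \<open>2 * \<beta> * r\<close>. One half is spent on the polynomial, the other remains as the
    rate \<open>b / 2\<close> in \<open>t\<close>.\<close>
  define \<beta> where "\<beta> = b / (4 * real k)"
  have k: "0 < k" using pos by simp
  have b: "0 < b" "b \<le> a" "b \<le> a'" using a by (auto simp: b_def)
  have \<beta>: "0 < \<beta>" using b k by (simp add: \<beta>_def)
  have D: "0 \<le> D" using A C by (simp add: D_def)
  obtain C1 where C1: "\<And>s. real (6 * s + 1) ^ (d * (k + 1)) * exp (- (2 * \<beta>) * real s) \<le> C1 * exp (- \<beta> * real s)"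
    using poly_exp_bounded[OF \<beta>, of "d * (k + 1)"] by blast
  have bound: "norm (cluster_sum p k (2 * k * t) pin g) \<le> D * C1 * exp (- (b / 2) * real t)" for t
  proof -
    define r where "r = 2 * k * t"
    define q where "q = real (6 * r + 1)"
    define E where "E = exp (- b * real t)"
    have q1: "1 \<le> q" by (simp add: q_def)
    have "t \<le> r" using k by (cases k) (auto simp: r_def)
    then have rt: "real t \<le> real r" by simp
    have ea: "exp (- u * real w) \<le> E" if "b \<le> u" "real t \<le> real w" for u w
    proof -
      have "b * real t \<le> u * real w" using that b(1) by (intro mult_mono) auto
      then show ?thesis by (simp add: E_def)
    qed
    have E0: "0 \<le> E" by (simp add: E_def)
    have qd: "1 \<le> q ^ d" using q1 by simp
    have "norm (cluster_sum p k r pin g) \<le> q ^ (d * k) *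
      (real (k ^ k) * (real k * (real k * (A * exp (- a * real t)))) +
       real (k ^ k) * (C * exp (- a' * real r) + q ^ d * (real k * (A * exp (- a * real r)))))"
      using cluster_sum_le[where g = g and m = m, OF g pos A C resp r_def] unfolding q_def d_def by simp
    also have "\<dots> \<le> q ^ (d * k) * (real (k ^ k) * (real k * (real k * (A * (q ^ d * E)))) +
       real (k ^ k) * (C * (q ^ d * E) + q ^ d * (real k * (A * E))))"
    proof -
      have le: "x \<le> q ^ d * E" if "x \<le> E" for x
        using mult_right_mono[OF qd E0] that by simp
      show ?thesis
        using A C q1 b rt by (intro mult_left_mono add_mono le ea) auto
    qed
    also have "\<dots> = D * (q ^ (d * (k + 1)) * E)"
      by (simp add: D_def power_add algebra_simps)
    also have "E = exp (- (2 * \<beta>) * real r)" using k by (simp add: E_def \<beta>_def r_def)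
    also have "D * (q ^ (d * (k + 1)) * exp (- (2 * \<beta>) * real r)) \<le> D * (C1 * exp (- \<beta> * real r))"
      unfolding q_def by (intro mult_left_mono C1 D)
    also have "- \<beta> * real r = - (b / 2) * real t" using k by (simp add: \<beta>_def r_def)
    finally show ?thesis unfolding r_def by (simp add: mult.assoc)
  qed
  have "(\<lambda>t. D * C1 * exp (- (b / 2) * real t)) \<longlonglongrightarrow> D * C1 * 0"
  proof (rule tendsto_mult_left)
    have "(\<lambda>t. exp (- (b / 2)) ^ t) \<longlonglongrightarrow> 0"
      using b(1) by (intro LIMSEQ_realpow_zero) auto
    then show "(\<lambda>t. exp (- (b / 2) * real t)) \<longlonglongrightarrow> 0"
      by (simp add: exp_of_nat_mult[symmetric] mult.commute)
  qed
  then have lim: "(\<lambda>t. D * C1 * exp (- (b / 2) * real t)) \<longlonglongrightarrow> 0" by (simp only: mult_zero_right)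
  show ?thesis
    by (rule Lim_null_comparison[OF always_eventually lim]) (rule allI, rule bound)
qed

section \<open>Exchanging input and output information one entry at a time\<close>

context exp_coding
begin

text \<open>Both scaled informations are at most 1/2, so their difference meets the bound 1 demanded
  by \<open>quasi_local\<close>. The summand 1 keeps the denominator positive when
  \<open>info_bound\<close> is 0.\<close>

definition info_scale :: real where "info_scale = 1 / (2 * info_bound + 1)"

definition in_field :: "(('d \<Rightarrow> int) \<Rightarrow> 'a) \<Rightarrow> real" where
  "in_field x = - info_scale * ln (pmf p (x (\<lambda>_. 0)))"

definition out_field :: "(('d \<Rightarrow> int) \<Rightarrow> 'a) \<Rightarrow> real" where
  "out_field x = - info_scale * ln (pmf q (\<phi> x (\<lambda>_. 0)))"

definition diff_field :: "(('d \<Rightarrow> int) \<Rightarrow> 'a) \<Rightarrow> real" where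
  "diff_field x = info_scale * info_diff x"

lemma info_scale_pos: "0 < info_scale"
  using info_bound_nonneg by (simp add: info_scale_def)

lemma scaled_ln_le: "\<bar>info_scale * ln (pmf p u)\<bar> \<le> 1 / 2" "\<bar>info_scale * ln (pmf q w)\<bar> \<le> 1 / 2"
proof -
  have "\<bar>info_scale * y\<bar> \<le> 1 / 2" if "\<bar>y\<bar> \<le> info_bound" for y
  proof -
    have "\<bar>info_scale * y\<bar> = info_scale * \<bar>y\<bar>" using info_scale_pos by (simp add: abs_mult)
    also have "\<dots> \<le> info_scale * info_bound" using info_scale_pos that by (intro mult_left_mono) auto
    also have "\<dots> \<le> 1 / 2" using info_bound_nonneg by (simp add: info_scale_def field_simps)
    finally show ?thesis .
  qed
  then show "\<bar>info_scale * ln (pmf p u)\<bar> \<le> 1 / 2" "\<bar>info_scale * ln (pmf q w)\<bar> \<le> 1 / 2"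
    using abs_ln_p_le abs_ln_q_le by blast+
qed

lemma diff_field_eq: "diff_field x = in_field x - out_field x"
  by (simp add: diff_field_def in_field_def out_field_def info_diff_def algebra_simps)

lemma abs_in_field: "\<bar>in_field x\<bar> \<le> 1 / 2" and abs_out_field: "\<bar>out_field x\<bar> \<le> 1 / 2"
  using scaled_ln_le(1)[of "x (\<lambda>_. 0)"] scaled_ln_le(2)[of "\<phi> x (\<lambda>_. 0)"] by (auto simp: in_field_def out_field_def)

lemma depends_on_in_field: "depends_on in_field {\<lambda>_. 0}"
  unfolding in_field_def by (rule depends_on_coordinate)

lemma measurable_in_field: "in_field \<in> borel_measurable \<mu>"
  by (rule measurable_local[OF depends_on_in_field]) simp

lemma measurable_out_field: "out_field \<in> borel_measurable \<mu>"
  unfolding out_field_def by (rule borel_measurable_phi)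

lemma quasi_local_in_field: "quasi_local p K c in_field"
  unfolding quasi_local_def
proof (intro conjI allI)
  show "\<bar>in_field x\<bar> \<le> 1" for x using abs_in_field[of x] by linarith
  show "\<exists>h. depends_on h (lattice_box s) \<and> (\<forall>x. \<bar>h x\<bar> \<le> 1) \<and>
       (\<integral>x. \<bar>in_field x - h x\<bar> \<partial>\<mu>) \<le> K * exp (- c * real s)" for s
  proof (intro exI[of _ in_field] conjI allI)
    show "depends_on in_field (lattice_box s)"
      by (rule depends_on_mono[OF depends_on_in_field]) (simp add: zero_in_lattice_box)
    show "\<bar>in_field x\<bar> \<le> 1" for x using abs_in_field[of x] by linarith
  qed (simp add: K_nonneg)
qed (rule measurable_in_field)

definition loc_field :: "nat \<Rightarrow> (('d \<Rightarrow> int) \<Rightarrow> 'a) \<Rightarrow> real" where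
  "loc_field s x = - info_scale * ln (pmf q (local_code p \<phi> s x))"

lemma loc_field:
  shows "depends_on (loc_field s) (lattice_box s)" "\<bar>loc_field s x\<bar> \<le> 1 / 2"
    and "(\<integral>x. \<bar>out_field x - loc_field s x\<bar> \<partial>\<mu>) \<le> K * exp (- c * real s)"
proof -
  show "depends_on (loc_field s) (lattice_box s)"
    unfolding loc_field_def by (rule depends_on_compose[OF depends_on_local_code])
  show "\<bar>loc_field s x\<bar> \<le> 1 / 2"
    using scaled_ln_le(2)[of "local_code p \<phi> s x"] by (simp add: loc_field_def)
  show "(\<integral>x. \<bar>out_field x - loc_field s x\<bar> \<partial>\<mu>) \<le> K * exp (- c * real s)"
    using code_error[of "\<lambda>b. - info_scale * ln (pmf q b)" "1 / 2" s] scaled_ln_le(2)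
    unfolding out_field_def loc_field_def by simp
qed

lemma quasi_local_out_field: "quasi_local p K c out_field"
  unfolding quasi_local_def
proof (intro conjI allI)
  show "\<bar>out_field x\<bar> \<le> 1" for x using abs_out_field[of x] by linarith
  show "\<exists>h. depends_on h (lattice_box s) \<and> (\<forall>x. \<bar>h x\<bar> \<le> 1) \<and>
       (\<integral>x. \<bar>out_field x - h x\<bar> \<partial>\<mu>) \<le> K * exp (- c * real s)" for s
  proof (intro exI[of _ "loc_field s"] conjI allI loc_field)
    show "\<bar>loc_field s x\<bar> \<le> 1" for x using loc_field(2)[of s x] by linarith
  qed
qed (rule measurable_out_field)

lemma quasi_local_diff_field: "quasi_local p K c diff_field"
  unfolding quasi_local_def
proof (intro conjI allI)
  show "\<bar>diff_field x\<bar> \<le> 1" for x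
    using abs_in_field[of x] abs_out_field[of x] unfolding diff_field_eq by linarith
  show "\<exists>h. depends_on h (lattice_box s) \<and> (\<forall>x. \<bar>h x\<bar> \<le> 1) \<and>
       (\<integral>x. \<bar>diff_field x - h x\<bar> \<partial>\<mu>) \<le> K * exp (- c * real s)" for s
  proof (intro exI[of _ "\<lambda>x. in_field x - loc_field s x"] conjI allI)
    show "depends_on (\<lambda>x. in_field x - loc_field s x) (lattice_box s)"
      by (rule depends_on_compose2[OF depends_on_mono[OF depends_on_in_field] loc_field(1)])
         (simp add: zero_in_lattice_box)
    show "\<bar>in_field x - loc_field s x\<bar> \<le> 1" for x
      using abs_in_field[of x] loc_field(2)[of s x] by linarith
    have "\<bar>diff_field x - (in_field x - loc_field s x)\<bar> = \<bar>out_field x - loc_field s x\<bar>" for x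
      by (simp add: diff_field_eq)
    then show "(\<integral>x. \<bar>diff_field x - (in_field x - loc_field s x)\<bar> \<partial>\<mu>) \<le> K * exp (- c * real s)"
      using loc_field(3)[of s] by (simp only:)
  qed
  show "diff_field \<in> borel_measurable \<mu>"
    unfolding diff_field_def using measurable_info_diff by simp
qed

text \<open>Up to scaling, interpolates between v in every entry at \<open>j = 0\<close> and u in
  every entry at \<open>j = k\<close>.\<close>

definition mixed :: "nat \<Rightarrow> nat \<Rightarrow> (('d \<Rightarrow> int) \<Rightarrow> 'a) \<Rightarrow> real" where
  "mixed j m = (if m < j then in_field else out_field)"

definition mixed_diff :: "nat \<Rightarrow> nat \<Rightarrow> (('d \<Rightarrow> int) \<Rightarrow> 'a) \<Rightarrow> real" where
  "mixed_diff j m = (if m = j then diff_field else mixed j m)"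

lemma quasi_local_mixed: "quasi_local p K c (mixed j m)" "quasi_local p K c (mixed_diff j m)"
  by (auto simp: mixed_def mixed_diff_def quasi_local_in_field quasi_local_out_field quasi_local_diff_field)

text \<open>Neighbouring families differ in entry \<open>j\<close> alone, so linearity of the
  cumulant in that entry puts the difference field there.\<close>

lemma cluster_sum_step:
  assumes j: "j < k"
  shows "cluster_sum p k r pin (mixed (Suc j)) - cluster_sum p k r pin (mixed j) = cluster_sum p k r pin (mixed_diff j)"
  unfolding cluster_sum_def sum_subtractf[symmetric]
proof (rule sum.cong[OF refl], rule cumulant_diff_position[OF j])
  fix \<tau> :: "nat \<Rightarrow> 'd \<Rightarrow> int" and S assume S: "S \<subseteq> {..<k}"
  show "field_moment p (mixed (Suc j)) \<tau> S = field_moment p (mixed_diff j) \<tau> S \<and>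
      field_moment p (mixed j) \<tau> S = field_moment p (mixed_diff j) \<tau> S" if "j \<notin> S"
  proof (intro conjI field_moment_cong refl)
    fix m assume "m \<in> S"
    then have "m \<noteq> j" using that by auto
    then show "mixed (Suc j) m = mixed_diff j m" "mixed j m = mixed_diff j m"
      by (auto simp: mixed_def mixed_diff_def)
  qed
  show "field_moment p (mixed_diff j) \<tau> S = field_moment p (mixed (Suc j)) \<tau> S - field_moment p (mixed j) \<tau> S"
    if jS: "j \<in> S"
  proof -
    have fin: "finite S" using S finite_subset by blast
    define R where "R x = (\<Prod>m\<in>S - {j}. mixed j m (zshift (\<tau> m) x))" for x
    have ql: "f \<in> borel_measurable \<mu>" "\<bar>f x\<bar> \<le> 1" if "quasi_local p K c f" for f x
      using that by (auto simp: quasi_local_def)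
    have R: "R \<in> borel_measurable \<mu>" "\<bar>R x\<bar> \<le> 1" for x
      unfolding R_def
      by (intro borel_measurable_prod borel_measurable_zshift ql(1)[OF quasi_local_mixed(1)],
          intro abs_prod_le_1 ql(2)[OF quasi_local_mixed(1)])
    have eq: "(\<Prod>m\<in>S. G m (zshift (\<tau> m) x)) = G j (zshift (\<tau> j) x) * R x"
      if "\<And>m. m \<noteq> j \<Longrightarrow> G m = mixed j m" for G x
    proof -
      have "(\<Prod>m\<in>S - {j}. G m (zshift (\<tau> m) x)) = R x"
        unfolding R_def by (rule prod.cong) (auto simp: that)
      then show ?thesis using prod.remove[OF fin jS, of "\<lambda>m. G m (zshift (\<tau> m) x)"] by simp
    qed
    have int: "integrable \<mu> (\<lambda>x. f (zshift (\<tau> j) x) * R x)" if "quasi_local p K c f" for f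
    proof (rule integrable_bounded[of _ _ 1])
      show "(\<lambda>x. f (zshift (\<tau> j) x) * R x) \<in> borel_measurable \<mu>"
        by (intro borel_measurable_times borel_measurable_zshift ql[OF that] R)
      show "\<bar>f (zshift (\<tau> j) x) * R x\<bar> \<le> 1" for x
        using mult_mono[OF ql(2)[OF that, of "zshift (\<tau> j) x"] R(2)[of x]] by (simp add: abs_mult)
    qed
    have 1: "field_moment p (mixed_diff j) \<tau> S = (\<integral>x. diff_field (zshift (\<tau> j) x) * R x \<partial>\<mu>)"
      unfolding field_moment_def by (subst eq) (auto simp: mixed_diff_def)
    have 2: "field_moment p (mixed (Suc j)) \<tau> S = (\<integral>x. in_field (zshift (\<tau> j) x) * R x \<partial>\<mu>)"
      unfolding field_moment_def by (subst eq) (auto simp: mixed_def)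
    have 3: "field_moment p (mixed j) \<tau> S = (\<integral>x. out_field (zshift (\<tau> j) x) * R x \<partial>\<mu>)"
      unfolding field_moment_def by (subst eq) (auto simp: mixed_def)
    show ?thesis
      unfolding 1 2 3 diff_field_eq left_diff_distrib
      by (rule Bochner_Integration.integral_diff) (intro int quasi_local_in_field quasi_local_out_field)+
  qed
qed

lemma mixed_diff_tendsto_0:
  assumes k: "2 \<le> k" and j: "j < k"
  shows "(\<lambda>t. cluster_sum p k (2 * k * t) 0 (mixed_diff j)) \<longlonglongrightarrow> 0"
proof -
  \<comment> \<open>The position of entry \<open>j\<close> has to be summed freely, so a different
    entry is held at the origin; \<open>2 \<le> k\<close> provides one. The pin then moves back to
    0, the common choice for all \<open>j\<close> in the telescoping sum.\<close>
  define pin where "pin = (if j = 0 then 1 else 0 :: nat)"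
  have pin: "pin < k" "j \<noteq> pin" using k by (auto simp: pin_def)
  obtain C c' where C: "0 < C" "0 < c'"
    "\<And>s G. depends_on G (lattice_box (2 * s)) \<Longrightarrow> (\<And>x. \<bar>G x\<bar> \<le> 1) \<Longrightarrow>
      \<bar>\<Sum>j\<in>lattice_box (3 * s). \<integral>x. G x * info_diff (zshift j x) \<partial>\<mu>\<bar> \<le> C * exp (- c' * real s)"
    using response_bound by blast
  have "(\<lambda>t. cluster_sum p k (2 * k * t) pin (mixed_diff j)) \<longlonglongrightarrow> 0"
  proof (rule cluster_sum_tendsto_0[OF quasi_local_mixed(2) j pin(1) pin(2) K_nonneg _ c_pos C(2)])
    show "0 \<le> info_scale * C" using info_scale_pos C(1) by simp
    fix s and G :: "(('d \<Rightarrow> int) \<Rightarrow> 'a) \<Rightarrow> real"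
    assume G: "depends_on G (lattice_box (2 * s))" "\<And>x. \<bar>G x\<bar> \<le> 1"
    have "(\<integral>x. G x * mixed_diff j j (zshift i x) \<partial>\<mu>) = info_scale * (\<integral>x. G x * info_diff (zshift i x) \<partial>\<mu>)" for i
    proof -
      have "(\<lambda>x. G x * mixed_diff j j (zshift i x)) = (\<lambda>x. info_scale * (G x * info_diff (zshift i x)))"
        by (simp add: mixed_diff_def diff_field_def mult.left_commute)
      then show ?thesis by (simp only: integral_mult_right_zero)
    qed
    then have "\<bar>\<Sum>i\<in>lattice_box (3 * s). \<integral>x. G x * mixed_diff j j (zshift i x) \<partial>\<mu>\<bar>
      = info_scale * \<bar>\<Sum>i\<in>lattice_box (3 * s). \<integral>x. G x * info_diff (zshift i x) \<partial>\<mu>\<bar>"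
      using info_scale_pos by (simp add: sum_distrib_left[symmetric] abs_mult)
    also have "\<dots> \<le> info_scale * (C * exp (- c' * real s))"
      using info_scale_pos C(3)[OF G] by (intro mult_left_mono) auto
    finally show "\<bar>\<Sum>i\<in>lattice_box (3 * s). \<integral>x. G x * mixed_diff j j (zshift i x) \<partial>\<mu>\<bar> \<le> info_scale * C * exp (- c' * real s)"
      by (simp add: mult.assoc)
  qed
  moreover have "cluster_sum p k r 0 (mixed_diff j) = cluster_sum p k r pin (mixed_diff j)" for r
    using k pin quasi_local_mixed(2) by (intro cluster_sum_repin) (auto simp: quasi_local_def)
  ultimately show ?thesis by (simp only:)
qed

text \<open>Equivariance at the finitely many sites of \<open>S\<close> and the image law of
  \<open>\<phi>\<close> make v an i.i.d. field, although it is computed from the input by a code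
  whose range may be unbounded.\<close>

lemma field_moment_out_field:
  "field_moment p (\<lambda>_. out_field) \<tau> S = field_moment q (\<lambda>_ y. - info_scale * ln (pmf q (y (\<lambda>_. 0)))) \<tau> S"
  if "finite S"
proof -
  let ?f = "\<lambda>y :: ('d \<Rightarrow> int) \<Rightarrow> 'b. \<Prod>m\<in>S. - info_scale * ln (pmf q (y (\<tau> m)))"
  have meas: "?f \<in> borel_measurable (bernoulli_shift q)"
    by (intro borel_measurable_prod measurable_local[OF depends_on_coordinate]) simp
  have "AE x in \<mu>. \<forall>m\<in>S. \<phi> (zshift (\<tau> m) x) = zshift (\<tau> m) (\<phi> x)"
    using that by (rule AE_finite_allI) (rule phi_zshift)
  then have "AE x in \<mu>. (\<Prod>m\<in>S. out_field (zshift (\<tau> m) x)) = ?f (\<phi> x)"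
  proof eventually_elim
    case (elim x)
    show ?case by (rule prod.cong) (use elim in \<open>auto simp: out_field_def zshift_def\<close>)
  qed
  then have "field_moment p (\<lambda>_. out_field) \<tau> S = (\<integral>x. ?f (\<phi> x) \<partial>\<mu>)"
    unfolding field_moment_def
    by (intro integral_cong_AE borel_measurable_prod borel_measurable_zshift measurable_out_field
        measurable_compose[OF measurable_phi meas])
  also have "\<dots> = (\<integral>y. ?f y \<partial>bernoulli_shift q)" by (rule integral_phi[OF meas])
  finally show ?thesis unfolding field_moment_def by (simp add: zshift_def)
qed

text \<open>Both ends of the interpolation are i.i.d. sums and do not depend on the truncation,
  while every step between them tends to 0; a constant sequence with limit 0 is 0.\<close>

lemma cumulants_eq:
  assumes k: "2 \<le> k"
  shows "cumulant k (\<lambda>S. \<Sum>a\<in>UNIV. pmf p a * (- info_scale * ln (pmf p a)) ^ card S)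
    = cumulant k (\<lambda>S. \<Sum>b\<in>UNIV. pmf q b * (- info_scale * ln (pmf q b)) ^ card S)" (is "?P = ?Q")
proof -
  have cong: "cluster_sum p k r 0 g = cluster_sum p k r 0 g'" if "\<And>m. m < k \<Longrightarrow> g m = g' m" for r g g'
    unfolding cluster_sum_def
    by (intro sum.cong refl cumulant_cong field_moment_cong) (use that in auto)
  have P: "cluster_sum p k r 0 (mixed k) = ?P" for r
  proof -
    have "cluster_sum p k r 0 (mixed k) = cluster_sum p k r 0 (\<lambda>_. in_field)"
      by (rule cong) (simp add: mixed_def)
    also have "\<dots> = ?P"
      unfolding in_field_def using k by (intro cluster_sum_iid) simp
    finally show ?thesis .
  qed
  have Q: "cluster_sum p k r 0 (mixed 0) = ?Q" for r
  proof -
    have "cluster_sum p k r 0 (mixed 0) = cluster_sum p k r 0 (\<lambda>_. out_field)"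
      by (rule cong) (simp add: mixed_def)
    also have "\<dots> = cluster_sum q k r 0 (\<lambda>_ (y :: ('d \<Rightarrow> int) \<Rightarrow> 'b). - info_scale * ln (pmf q (y (\<lambda>_. 0))))"
      unfolding cluster_sum_def
      by (intro sum.cong refl cumulant_cong field_moment_out_field) (auto intro: finite_subset)
    also have "\<dots> = ?Q" using k by (intro cluster_sum_iid) simp
    finally show ?thesis .
  qed
  have "(\<lambda>t. \<Sum>j<k. cluster_sum p k (2 * k * t) 0 (mixed_diff j)) \<longlonglongrightarrow> (\<Sum>j<k. 0)"
    by (rule tendsto_sum) (use mixed_diff_tendsto_0[OF k] in auto)
  moreover have "(\<Sum>j<k. cluster_sum p k r 0 (mixed_diff j)) = ?P - ?Q" for r
  proof -
    have "(\<Sum>j<k. cluster_sum p k r 0 (mixed_diff j))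
      = (\<Sum>j<k. cluster_sum p k r 0 (mixed (Suc j)) - cluster_sum p k r 0 (mixed j))"
      by (rule sum.cong) (auto simp: cluster_sum_step)
    also have "\<dots> = cluster_sum p k r 0 (mixed k) - cluster_sum p k r 0 (mixed 0)"
      by (rule sum_lessThan_telescope)
    finally show ?thesis by (simp only: P Q)
  qed
  ultimately have "(\<lambda>t::nat. ?P - ?Q) \<longlonglongrightarrow> 0" by (simp only: sum.neutral_const)
  then show ?thesis by (simp add: LIMSEQ_const_iff)
qed

text \<open>The first moment is the equality of entropies itself. From order 2 on, the cumulants
  agree and determine the moment once the lower ones are known.\<close>

lemma moments_eq:
  "(\<Sum>a\<in>UNIV. pmf p a * (- info_scale * ln (pmf p a)) ^ k) = (\<Sum>b\<in>UNIV. pmf q b * (- info_scale * ln (pmf q b)) ^ k)"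
proof (induction k rule: less_induct)
  case (less k)
  consider "k = 0" | "k = 1" | "2 \<le> k" by linarith
  then show ?case
  proof cases
    case 1
    then show ?thesis by (simp add: sum_pmf_eq_1)
  next
    case 2
    have "(\<Sum>a\<in>UNIV. pmf p a * ln (pmf p a)) = (\<Sum>b\<in>UNIV. pmf q b * ln (pmf q b))"
      using entropy_eq by (simp add: pmf_entropy_def)
    then have "- info_scale * (\<Sum>a\<in>UNIV. pmf p a * ln (pmf p a)) = - info_scale * (\<Sum>b\<in>UNIV. pmf q b * ln (pmf q b))"
      by (simp only:)
    then show ?thesis unfolding 2 power_one_right sum_distrib_left by (simp only: mult.left_commute)
  next
    case 3
    show ?thesis
      by (rule moment_eq_if_cumulant_eq[OF _ less.IH _ cumulants_eq[OF 3]])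
         (use 3 in \<open>auto simp: sum_pmf_eq_1\<close>)
  qed
qed

end

section \<open>Equality of the laws\<close>

text \<open>Moments determine integrals of polynomials. A polynomial vanishing at every information
  value except that of \<open>y\<close> isolates the symbols of mass \<open>y\<close>, so their
  number can be read off.\<close>

lemma card_level_sets_eq:
  fixes p :: "'a::finite pmf" and q :: "'b::finite pmf"
  assumes s: "0 < s" and y: "0 < y"
    and mom: "\<And>k. (\<Sum>a\<in>UNIV. pmf p a * (- s * ln (pmf p a)) ^ k) = (\<Sum>b\<in>UNIV. pmf q b * (- s * ln (pmf q b)) ^ k)"
  shows "card {a. pmf p a = y} = card {b. pmf q b = y}"
proof -
  define Z where "Z = ((\<lambda>a. - s * ln (pmf p a)) ` UNIV \<union> (\<lambda>b. - s * ln (pmf q b)) ` UNIV) - {- s * ln y}"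
  define P where "P = (\<Prod>z\<in>Z. [:- z, 1:])"
  have finZ: "finite Z" by (simp add: Z_def)
  have poly_P: "poly P x = (\<Prod>z\<in>Z. x - z)" for x by (simp add: P_def poly_prod)
  have P0: "poly P (- s * ln y) \<noteq> 0" using finZ by (auto simp: poly_P Z_def)
  have Pz: "poly P z = 0" if "z \<in> Z" for z using finZ that by (auto simp: poly_P)
  have level: "(\<Sum>a\<in>UNIV. pmf r a * poly P (- s * ln (pmf r a))) = real (card {a. pmf r a = y}) * (y * poly P (- s * ln y))"
    if r: "\<And>a. - s * ln (pmf r a) \<noteq> - s * ln y \<Longrightarrow> - s * ln (pmf r a) \<in> Z" for r :: "'c::finite pmf"
  proof -
    have "(\<Sum>a\<in>UNIV. pmf r a * poly P (- s * ln (pmf r a))) = (\<Sum>a\<in>{a. pmf r a = y}. pmf r a * poly P (- s * ln (pmf r a)))"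
    proof (rule sum.mono_neutral_right)
      show "\<forall>a\<in>UNIV - {a. pmf r a = y}. pmf r a * poly P (- s * ln (pmf r a)) = 0"
      proof
        fix a assume a: "a \<in> UNIV - {a. pmf r a = y}"
        show "pmf r a * poly P (- s * ln (pmf r a)) = 0"
        \<comment> \<open>Since \<open>ln 0 = 0 = ln 1\<close>, a null symbol shares the information
          value of mass 1; its weight 0 removes it.\<close>
        proof (cases "pmf r a = 0")
          case False
          then have "0 < pmf r a" using pmf_nonneg[of r a] by linarith
          then have "- s * ln (pmf r a) \<noteq> - s * ln y" using a s y by (simp add: ln_inj_iff)
          then show ?thesis using r Pz by simp
        qed simp
      qed
    qed auto
    also have "\<dots> = (\<Sum>a\<in>{a. pmf r a = y}. y * poly P (- s * ln y))" by (rule sum.cong) auto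
    finally show ?thesis by simp
  qed
  have expand: "(\<Sum>a\<in>UNIV. pmf r a * poly P (- s * ln (pmf r a)))
      = (\<Sum>i\<le>degree P. coeff P i * (\<Sum>a\<in>UNIV. pmf r a * (- s * ln (pmf r a)) ^ i))" for r :: "'c::finite pmf"
    unfolding poly_altdef sum_distrib_left by (subst sum.swap) (simp only: mult.left_commute)
  have "(\<Sum>a\<in>UNIV. pmf p a * poly P (- s * ln (pmf p a))) = (\<Sum>b\<in>UNIV. pmf q b * poly P (- s * ln (pmf q b)))"
    unfolding expand by (simp only: mom)
  then have "real (card {a. pmf p a = y}) * (y * poly P (- s * ln y)) = real (card {b. pmf q b = y}) * (y * poly P (- s * ln y))"
    by (subst (asm) (1 2) level) (auto simp: Z_def)
  then show ?thesis using P0 y by simp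
qed

lemma bij_of_card_level_sets_eq:
  fixes p :: "'a::finite pmf" and q :: "'b::finite pmf"
  assumes "\<And>y. 0 < y \<Longrightarrow> card {a. pmf p a = y} = card {b. pmf q b = y}"
  shows "\<exists>f. bij_betw f (set_pmf p) (set_pmf q) \<and> (\<forall>a\<in>set_pmf p. pmf q (f a) = pmf p a)"
proof -
  have "\<forall>y\<in>{0<..}. \<exists>h. bij_betw h {a. pmf p a = y} {b. pmf q b = y}"
    using assms by (auto intro!: finite_same_card_bij)
  from bchoice[OF this] obtain h where h: "\<And>y. 0 < y \<Longrightarrow> bij_betw (h y) {a. pmf p a = y} {b. pmf q b = y}" by auto
  define f where "f a = h (pmf p a) a" for a
  have pos: "0 < pmf p a" if "a \<in> set_pmf p" for a using that by (rule pmf_positive)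
  have qf: "pmf q (f a) = pmf p a" if "a \<in> set_pmf p" for a
    using bij_betwE[OF h[OF pos[OF that]]] by (auto simp: f_def)
  have "inj_on f (set_pmf p)"
  proof (rule inj_onI)
    fix a a' assume a: "a \<in> set_pmf p" "a' \<in> set_pmf p" "f a = f a'"
    then have eq: "pmf p a = pmf p a'" using qf by metis
    then have "h (pmf p a) a = h (pmf p a) a'" using a(3) by (simp add: f_def)
    then show "a = a'"
      using bij_betw_imp_inj_on[OF h[OF pos[OF a(1)]]] eq by (auto dest: inj_onD)
  qed
  moreover have "f ` set_pmf p = set_pmf q"
  proof (intro equalityI subsetI)
    fix b assume "b \<in> f ` set_pmf p"
    then obtain a where "a \<in> set_pmf p" "b = f a" by auto
    then have "0 < pmf q b" using qf pos by simp
    then show "b \<in> set_pmf q" by (simp add: set_pmf_iff)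
  next
    fix b assume "b \<in> set_pmf q"
    then have b: "0 < pmf q b" by (rule pmf_positive)
    then have "b \<in> h (pmf q b) ` {a. pmf p a = pmf q b}"
      using bij_betw_imp_surj_on[OF h[OF b]] by auto
    then obtain a where a: "pmf p a = pmf q b" "b = h (pmf q b) a" by auto
    then have "b = f a" by (simp add: f_def)
    moreover have "a \<in> set_pmf p" using a(1) b by (simp add: set_pmf_iff)
    ultimately show "b \<in> f ` set_pmf p" by blast
  qed
  ultimately show ?thesis using qf by (auto simp: bij_betw_def)
qed

section \<open>From the coding radius to failure probabilities, and the conclusion\<close>

lemma coding_radius_le_iff:
  "coding_radius \<mu> \<phi> x \<le> enat n \<longleftrightarrow>
     (\<exists>m\<le>n. AE a in \<mu>. (\<forall>i\<in>lattice_box m. a i = x i) \<longrightarrow> \<phi> a (\<lambda>_. 0) = \<phi> x (\<lambda>_. 0))"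
proof -
  define T where "T m \<longleftrightarrow> (AE a in \<mu>. (\<forall>i\<in>lattice_box m. a i = x i) \<longrightarrow> \<phi> a (\<lambda>_. 0) = \<phi> x (\<lambda>_. 0))" for m
  define P where "P n \<longleftrightarrow> n = \<infinity> \<or> (\<exists>m. n = enat m \<and> T m)" for n
  have R: "coding_radius \<mu> \<phi> x = (LEAST n. P n)" unfolding coding_radius_def P_def T_def ..
  have "P (LEAST n. P n)" by (rule LeastI[of P \<infinity>]) (simp add: P_def)
  then have "(LEAST n. P n) \<le> enat n \<Longrightarrow> \<exists>m\<le>n. T m" by (auto simp: P_def)
  moreover have "(LEAST n. P n) \<le> enat n" if "m \<le> n" "T m" for m
  proof -
    have "(LEAST n. P n) \<le> enat m" by (rule Least_le) (use that in \<open>simp add: P_def\<close>)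
    also have "\<dots> \<le> enat n" using that by simp
    finally show ?thesis .
  qed
  ultimately show ?thesis unfolding R T_def[symmetric] by blast
qed

text \<open>The defining condition quantifies over almost every \<open>a\<close>, but it depends on
  \<open>x\<close> only through a finite pattern and the symbol of \<open>\<phi> x\<close> at the
  origin; the complementary event is a finite union of measurable sets.\<close>

lemma sets_coding_radius:
  fixes p :: "'a::finite pmf" and q :: "'b::finite pmf"
    and \<phi> :: "(('d::finite \<Rightarrow> int) \<Rightarrow> 'a) \<Rightarrow> ('d \<Rightarrow> int) \<Rightarrow> 'b"
  assumes phi: "\<phi> \<in> measurable (bernoulli_shift p) (bernoulli_shift q)"
  shows "{x. coding_radius (bernoulli_shift p) \<phi> x > enat n} \<in> sets (bernoulli_shift p)"
proof -
  let ?\<mu> = "bernoulli_shift p :: (('d \<Rightarrow> int) \<Rightarrow> 'a) measure"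
  define T where "T m y b \<longleftrightarrow> (AE a in ?\<mu>. (\<forall>i\<in>lattice_box m. a i = y i) \<longrightarrow> \<phi> a (\<lambda>_. 0) = b)" for m y b
  have T_cong: "T m y b = T m z b" if "\<forall>i\<in>lattice_box m. y i = z i" for m y z b
    using that by (simp add: T_def cong: agree_cong)
  have "{x. coding_radius ?\<mu> \<phi> x \<le> enat n} = (\<Union>m\<in>{..n}. \<Union>y\<in>PiE (lattice_box m) (\<lambda>_. UNIV).
      \<Union>b\<in>{b. T m y b}. {x. \<forall>i\<in>lattice_box m. x i = y i} \<inter> (\<lambda>x. \<phi> x (\<lambda>_. 0)) -` {b} \<inter> space ?\<mu>)"
    (is "?L = ?R")
  proof (intro equalityI subsetI)
    fix x assume "x \<in> ?L"
    then obtain m where m: "m \<le> n" "T m x (\<phi> x (\<lambda>_. 0))" by (auto simp: coding_radius_le_iff T_def)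
    define y where "y = restrict x (lattice_box m)"
    have y: "y \<in> PiE (lattice_box m) (\<lambda>_. UNIV)" "\<forall>i\<in>lattice_box m. x i = y i" by (auto simp: y_def)
    have "T m y (\<phi> x (\<lambda>_. 0))" using m(2) T_cong[OF y(2)] by simp
    then show "x \<in> ?R" using m(1) y by auto
  next
    fix x assume "x \<in> ?R"
    then obtain m y where m: "m \<le> n" "T m y (\<phi> x (\<lambda>_. 0))" "\<forall>i\<in>lattice_box m. x i = y i" by auto
    then have "T m x (\<phi> x (\<lambda>_. 0))" using T_cong[OF m(3)] by simp
    then show "x \<in> ?L" using m(1) by (auto simp: coding_radius_le_iff T_def)
  qed
  also have "\<dots> \<in> sets ?\<mu>"
  proof (intro sets.finite_UN)
    fix m y b
    have "(\<lambda>x. \<phi> x (\<lambda>_. 0)) \<in> measurable ?\<mu> (count_space UNIV)"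
      by (rule measurable_compose[OF phi measurable_component_bernoulli])
    then have "(\<lambda>x. \<phi> x (\<lambda>_. 0)) -` {b} \<inter> space ?\<mu> \<in> sets ?\<mu>" by (rule measurable_sets) simp
    then show "{x. \<forall>i\<in>lattice_box m. x i = y i} \<inter> (\<lambda>x. \<phi> x (\<lambda>_. 0)) -` {b} \<inter> space ?\<mu> \<in> sets ?\<mu>"
      using sets_cylinder[of "lattice_box m" y p] by (simp add: sets.Int)
  qed (auto intro!: finite_PiE)
  finally have "space ?\<mu> - {x. coding_radius ?\<mu> \<phi> x \<le> enat n} \<in> sets ?\<mu>" by (rule sets.compl_sets)
  moreover have "space ?\<mu> - {x. coding_radius ?\<mu> \<phi> x \<le> enat n} = {x. coding_radius ?\<mu> \<phi> x > enat n}"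
    by (auto simp: not_le)
  ultimately show ?thesis by simp
qed

text \<open>If the radius at \<open>x\<close> is at most \<open>n\<close>, the symbol of
  \<open>\<phi> x\<close> at the origin witnesses that the code does not fail on the box of radius
  \<open>n\<close>.\<close>

lemma measure_code_fails_le:
  fixes p :: "'a::finite pmf" and q :: "'b::finite pmf"
    and \<phi> :: "(('d::finite \<Rightarrow> int) \<Rightarrow> 'a) \<Rightarrow> ('d \<Rightarrow> int) \<Rightarrow> 'b"
  assumes phi: "\<phi> \<in> measurable (bernoulli_shift p) (bernoulli_shift q)"
  shows "measure (bernoulli_shift p) {x. code_fails p \<phi> n x}
    \<le> measure (bernoulli_shift p) {x. coding_radius (bernoulli_shift p) \<phi> x > enat n}"
proof -
  interpret prob_space "bernoulli_shift p :: (('d \<Rightarrow> int) \<Rightarrow> 'a) measure" by (rule prob_space_bernoulli_shift)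
  have "coding_radius (bernoulli_shift p) \<phi> x > enat n" if fails: "code_fails p \<phi> n x" for x
  proof (rule ccontr)
    assume "\<not> coding_radius (bernoulli_shift p) \<phi> x > enat n"
    then obtain m where m: "m \<le> n"
      "AE a in bernoulli_shift p. (\<forall>i\<in>lattice_box m. a i = x i) \<longrightarrow> \<phi> a (\<lambda>_. 0) = \<phi> x (\<lambda>_. 0)"
      by (auto simp: not_less coding_radius_le_iff)
    have "AE a in bernoulli_shift p. (\<forall>i\<in>lattice_box n. a i = x i) \<longrightarrow> \<phi> a (\<lambda>_. 0) = \<phi> x (\<lambda>_. 0)"
      using m(2) by eventually_elim (use lattice_box_mono[OF m(1)] in blast)
    then show False using fails unfolding code_fails_def by blast
  qed
  then show ?thesis by (intro finite_measure_mono sets_coding_radius[OF phi]) auto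
qed

theorem theorem2:
  fixes p :: "'a::finite pmf" and q :: "'b::finite pmf"
    and \<phi> :: "(('d::finite \<Rightarrow> int) \<Rightarrow> 'a) \<Rightarrow> (('d \<Rightarrow> int) \<Rightarrow> 'b)"
    and c :: real
  assumes "pmf_entropy p = pmf_entropy q"
    and "c > 0"
    and "is_factor_map (bernoulli_shift p) (bernoulli_shift q) \<phi>"
    and "(\<lambda>n::nat. measure (bernoulli_shift p)
            {x \<in> space (bernoulli_shift p). coding_radius (bernoulli_shift p) \<phi> x > enat n})
         \<in> O(\<lambda>n. exp (- c * real n))"
  shows "\<exists>f. bij_betw f (set_pmf p) (set_pmf q) \<and> (\<forall>a\<in>set_pmf p. pmf q (f a) = pmf p a)"
proof -
  let ?\<mu> = "bernoulli_shift p :: (('d \<Rightarrow> int) \<Rightarrow> 'a) measure"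
  interpret M: prob_space ?\<mu> by (rule prob_space_bernoulli_shift)
  have phi: "\<phi> \<in> measurable (bernoulli_shift p) (bernoulli_shift q)"
    using assms(3) by (simp add: is_factor_map_def)
  obtain C where "0 < C" and C: "\<forall>\<^sub>F n in sequentially.
      norm (measure ?\<mu> {x. coding_radius ?\<mu> \<phi> x > enat n}) \<le> C * norm (exp (- c * real n))"
    using landau_o.bigE[OF assms(4)] by auto
  from C obtain n0 where n0: "\<And>n. n0 \<le> n \<Longrightarrow>
      measure ?\<mu> {x. coding_radius ?\<mu> \<phi> x > enat n} \<le> C * exp (- c * real n)"
    by (auto simp: eventually_sequentially)
  \<comment> \<open>The O-bound concerns large \<open>n\<close> only. For \<open>s\<close> below
    \<open>n0\<close> the second term makes \<open>K * exp (- c * real s)\<close> at least 1, which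
    bounds any probability.\<close>
  define K where "K = max C (exp (c * real n0))"
  have "measure ?\<mu> {x. code_fails p \<phi> s x} \<le> K * exp (- c * real s)" for s
  proof (cases "n0 \<le> s")
    case True
    have "measure ?\<mu> {x. code_fails p \<phi> s x} \<le> C * exp (- c * real s)"
      using measure_code_fails_le[OF phi] n0[OF True] by (rule order_trans)
    also have "\<dots> \<le> K * exp (- c * real s)" by (intro mult_right_mono) (auto simp: K_def)
    finally show ?thesis .
  next
    case False
    have "measure ?\<mu> {x. code_fails p \<phi> s x} \<le> 1" by simp
    also have "1 \<le> exp (c * real n0) * exp (- c * real s)"
      using False assms(2) by (simp add: exp_add[symmetric])
    also have "\<dots> \<le> K * exp (- c * real s)" by (intro mult_right_mono) (auto simp: K_def)
    finally show ?thesis .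
  qed
  then interpret exp_coding p q \<phi> K c
    using assms by unfold_locales auto
  show ?thesis
    by (intro bij_of_card_level_sets_eq card_level_sets_eq[OF info_scale_pos _ moments_eq])
qed

end
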